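(* Let $L>0$, $Z\in\mathbb R\setminus\{0\}$, and let $\omega>\frac{\pi^2}{2L^2}$ and $\omega>\frac{Z^2}{4}$, with $(\omega,Z)$ in the range where the dnoidal-peak $\varphi_{\omega,Z}$ of the context is defined. Let $n(\mathcal L_{1,Z})$ be the number of negative eigenvalues of $\mathcal L_{1,Z}$. Then (1) for $Z>0$, $n(\mathcal L_{1,Z})=1$; (2) for $Z<0$, $n(\mathcal L_{1,Z})=2$.
   Context: $\mathcal L_{1,Z}\zeta=-\zeta''+\omega\zeta-3\varphi_{\omega,Z}^2\zeta$ is self-adjoint on $L^2_{per}([-L,L])$ ($2L$-periodic functions) with domain $\{\zeta\in H^1_{per}([-L,L])\cap H^2((-L,L)\setminus\{0\})\cap H^2((0,2L)):\zeta'(0+)-\zeta'(0-)=-Z\zeta(0)\}$ (derivatives taken away from $2L\mathbb Z$). Dnoidal-peak: $\mathrm{dn}(\cdot;k)$ is the Jacobi elliptic function of modulus $k\in(0,1)$, $K(k)$ the complete elliptic integral of the first kind, and for $y\in[\sqrt{1-k^2},1]$, $\mathrm{dn}^{-1}(y;k)$ is the unique $u\in[0,K(k)]$ with $\mathrm{dn}(u;k)=y$. For $\omega>Z^2/4$ put $\theta(\omega,Z)=-\frac{\sqrt2}{4}|Z|+\sqrt{\omega-\frac{Z^2}{8}}$, and for $\eta\in(0,\theta(\omega,Z))$ put $$k^2(\eta,\omega)=\frac{2\omega-2\eta^2}{2\omega-\eta^2},\qquad \Phi^2(\eta,\omega,Z)=\tfrac12\Big[(2\omega-\tfrac{Z^2}{2})+\sqrt{(2\omega-\tfrac{Z^2}{2})^2-4\eta^2(2\omega-\eta^2)}\Big]\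 (\Phi>0),$$ $$a(\eta,\omega,Z)=\mathrm{dn}^{-1}\Big(\frac{\Phi(\eta,\omega,Z)}{\sqrt{2\omega-\eta^2}};k(\eta,\omega)\Big),\qquad T_{\mp}(\eta,\omega,Z)=\frac{2\sqrt2}{\sqrt{2\omega-\eta^2}}\big[K(k(\eta,\omega))\mp a(\eta,\omega,Z)\big].$$ Let $T_0(\omega,Z)=\lim_{\eta\to\theta(\omega,Z)}T_-(\eta,\omega,Z)$ and $T_1(\omega,Z)=\lim_{\eta\to\theta(\omega,Z)}T_+(\eta,\omega,Z)$. If $Z>0$ and $2L>T_0(\omega,Z)$, let $\eta_2\in(0,\theta(\omega,Z))$ be the unique value with $T_-(\eta_2,\omega,Z)=2L$; if $Z<0$ and $2L>T_1(\omega,Z)$, let $\eta_2\in(0,\theta(\omega,Z))$ be the unique value with $T_+(\eta_2,\omega,Z)=2L$. Put $\eta_1=\sqrt{2\omega-\eta_2^2}$, $k=k(\eta_2,\omega)$, $a=a(\eta_2,\omega,Z)$, and define, for $\xi\in[-L,L]$ and extended $2L$-periodically, $$\varphi_{\omega,Z}(\xi)=\eta_1\,\mathrm{dn}\Big(\tfrac{\eta_1}{\sqrt2}|\xi|+a;k\Big)\ \text{ if }Z>0,\qquad \varphi_{\omega,Z}(\xi)=\eta_1\,\mathrm{dn}\Big(\tfrac{\eta_1}{\sqrt2}|\xi|-a;k\Big)\ \text{ if }Z<0.$$ It is positive, even and solves $-\varphi''+\omega\varphi-Z\delta(x)\varphi=\varphi^3$. *)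

theory Defs
  imports "HOL-Analysis.Analysis" "HOL-Library.Function_Algebras"
begin

subsection \<open>Jacobi's elliptic function dn\<close>

text \<open>Everything is in terms of the modulus \<open>k\<close> (not the parameter \<open>k\<^sup>2\<close>).  The interval integral
  is signed, so \<open>elliptic_F\<close> is odd in its first argument, the amplitude \<open>jacobi_am\<close> is its inverse
  on the whole real line, and \<open>jacobi_dn\<close> is defined for negative arguments as well.\<close>

definition elliptic_F :: "real \<Rightarrow> real \<Rightarrow> real" where
  "elliptic_F \<phi> k = (LBINT t=ereal 0..ereal \<phi>. 1 / sqrt (1 - k\<^sup>2 * (sin t)\<^sup>2))"

definition elliptic_K :: "real \<Rightarrow> real" where
  "elliptic_K k = elliptic_F (pi / 2) k"

definition jacobi_am :: "real \<Rightarrow> real \<Rightarrow> real" where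
  "jacobi_am u k = (THE \<phi>. elliptic_F \<phi> k = u)"

definition jacobi_dn :: "real \<Rightarrow> real \<Rightarrow> real" where
  "jacobi_dn u k = sqrt (1 - k\<^sup>2 * (sin (jacobi_am u k))\<^sup>2)"

definition jacobi_dn_inv :: "real \<Rightarrow> real \<Rightarrow> real" where
  "jacobi_dn_inv y k = (THE u. u \<in> {0..elliptic_K k} \<and> jacobi_dn u k = y)"


subsection \<open>The dnoidal-peak\<close>

definition peak_theta :: "real \<Rightarrow> real \<Rightarrow> real" where
  "peak_theta \<omega> Z = - (sqrt 2 / 4) * \<bar>Z\<bar> + sqrt (\<omega> - Z\<^sup>2 / 8)"

definition peak_k :: "real \<Rightarrow> real \<Rightarrow> real" where
  "peak_k \<eta> \<omega> = sqrt ((2 * \<omega> - 2 * \<eta>\<^sup>2) / (2 * \<omega> - \<eta>\<^sup>2))"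

definition peak_Phi :: "real \<Rightarrow> real \<Rightarrow> real \<Rightarrow> real" where
  "peak_Phi \<eta> \<omega> Z =
     sqrt (1 / 2 * ((2 * \<omega> - Z\<^sup>2 / 2) +
        sqrt ((2 * \<omega> - Z\<^sup>2 / 2)\<^sup>2 - 4 * \<eta>\<^sup>2 * (2 * \<omega> - \<eta>\<^sup>2))))"

definition peak_a :: "real \<Rightarrow> real \<Rightarrow> real \<Rightarrow> real" where
  "peak_a \<eta> \<omega> Z = jacobi_dn_inv (peak_Phi \<eta> \<omega> Z / sqrt (2 * \<omega> - \<eta>\<^sup>2)) (peak_k \<eta> \<omega>)"

definition T_minus :: "real \<Rightarrow> real \<Rightarrow> real \<Rightarrow> real" where
  "T_minus \<eta> \<omega> Z =
     2 * sqrt 2 / sqrt (2 * \<omega> - \<eta>\<^sup>2) * (elliptic_K (peak_k \<eta> \<omega>) - peak_a \<eta> \<omega> Z)"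

definition T_plus :: "real \<Rightarrow> real \<Rightarrow> real \<Rightarrow> real" where
  "T_plus \<eta> \<omega> Z =
     2 * sqrt 2 / sqrt (2 * \<omega> - \<eta>\<^sup>2) * (elliptic_K (peak_k \<eta> \<omega>) + peak_a \<eta> \<omega> Z)"

definition T_0 :: "real \<Rightarrow> real \<Rightarrow> real" where
  "T_0 \<omega> Z = Lim (at_left (peak_theta \<omega> Z)) (\<lambda>\<eta>. T_minus \<eta> \<omega> Z)"

definition T_1 :: "real \<Rightarrow> real \<Rightarrow> real" where
  "T_1 \<omega> Z = Lim (at_left (peak_theta \<omega> Z)) (\<lambda>\<eta>. T_plus \<eta> \<omega> Z)"

text \<open>\<open>\<eta>\<^sub>2\<close> is the unique \<open>\<eta> \<in> (0, \<theta>(\<omega>, Z))\<close> with \<open>T\<^sub>-(\<eta>) = 2L\<close> (for \<open>Z > 0\<close>),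
  respectively \<open>T\<^sub>+(\<eta>) = 2L\<close> (for \<open>Z < 0\<close>).  The requirements \<open>2L > T\<^sub>0\<close>, \<open>2L > T\<^sub>1\<close> are part of
  the range in which the dnoidal-peak is defined; the second one cannot be dropped, since
  \<open>T\<^sub>+\<close> is not monotone in \<open>\<eta>\<close> on the whole of \<open>(0, \<theta>)\<close>.\<close>

definition peak_parameter :: "real \<Rightarrow> real \<Rightarrow> real \<Rightarrow> real \<Rightarrow> bool" where
  "peak_parameter L \<omega> Z \<eta>\<^sub>2 \<longleftrightarrow>
     (Z > 0 \<and> 2 * L > T_0 \<omega> Z \<and>
        {\<eta> \<in> {0<..<peak_theta \<omega> Z}. T_minus \<eta> \<omega> Z = 2 * L} = {\<eta>\<^sub>2}) \<or>
     (Z < 0 \<and> 2 * L > T_1 \<omega> Z \<and>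
        {\<eta> \<in> {0<..<peak_theta \<omega> Z}. T_plus \<eta> \<omega> Z = 2 * L} = {\<eta>\<^sub>2})"

text \<open>\<open>\<xi>\<close> is the representative of \<open>x\<close> modulo \<open>2L\<close> in \<open>[-L, L)\<close>.\<close>

definition dnoidal_peak :: "real \<Rightarrow> real \<Rightarrow> real \<Rightarrow> real \<Rightarrow> real \<Rightarrow> real" where
  "dnoidal_peak L \<omega> Z \<eta>\<^sub>2 x =
     (let \<xi> = x - 2 * L * of_int \<lfloor>(x + L) / (2 * L)\<rfloor>;
          \<eta>\<^sub>1 = sqrt (2 * \<omega> - \<eta>\<^sub>2\<^sup>2);
          k = peak_k \<eta>\<^sub>2 \<omega>;
          a = peak_a \<eta>\<^sub>2 \<omega> Z
      in if Z > 0 then \<eta>\<^sub>1 * jacobi_dn (\<eta>\<^sub>1 / sqrt 2 * \<bar>\<xi>\<bar> + a) k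
         else \<eta>\<^sub>1 * jacobi_dn (\<eta>\<^sub>1 / sqrt 2 * \<bar>\<xi>\<bar> - a) k)"


subsection \<open>Sobolev spaces in one dimension\<close>

definition L2_on :: "real set \<Rightarrow> (real \<Rightarrow> complex) set" where
  "L2_on U = {f. f \<in> borel_measurable (lebesgue_on U) \<and>
                 integrable (lebesgue_on U) (\<lambda>x. (cmod (f x))\<^sup>2)}"

text \<open>Test functions are of class \<open>C\<^sup>1\<close> with compact support in \<open>U\<close> (as in Brezis' treatment of
  Sobolev spaces in one dimension); on locally integrable functions they give the same weak
  derivatives as the smooth ones.\<close>

definition test_function :: "real set \<Rightarrow> (real \<Rightarrow> real) \<Rightarrow> bool" where
  "test_function U \<psi> \<longleftrightarrow>
     (\<forall>x. \<psi> differentiable (at x)) \<and> continuous_on UNIV (deriv \<psi>) \<and>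
     (\<exists>C. compact C \<and> C \<subseteq> U \<and> (\<forall>x. x \<notin> C \<longrightarrow> \<psi> x = 0))"

definition weak_derivative :: "real set \<Rightarrow> (real \<Rightarrow> complex) \<Rightarrow> (real \<Rightarrow> complex) \<Rightarrow> bool" where
  "weak_derivative U f g \<longleftrightarrow>
     (\<forall>\<psi>. test_function U \<psi> \<longrightarrow>
        (\<integral>x. deriv \<psi> x *\<^sub>R f x \<partial>lebesgue_on U) = - (\<integral>x. \<psi> x *\<^sub>R g x \<partial>lebesgue_on U))"

definition H1_on :: "real set \<Rightarrow> (real \<Rightarrow> complex) set" where
  "H1_on U = {f \<in> L2_on U. \<exists>g\<in>L2_on U. weak_derivative U f g}"

definition H2_on :: "real set \<Rightarrow> (real \<Rightarrow> complex) set" where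
  "H2_on U = {f \<in> L2_on U. \<exists>g\<in>H1_on U. weak_derivative U f g}"

text \<open>Elements of the periodic space \<open>H\<^sup>1\<close> are represented by their unique continuous
  representatives, so that point values make sense and distinct functions are distinct
  elements of \<open>L\<^sup>2\<close>.\<close>

definition H1_per :: "real \<Rightarrow> (real \<Rightarrow> complex) set" where
  "H1_per L = {f. continuous_on UNIV f \<and> (\<forall>x. f (x + 2 * L) = f x) \<and> f \<in> H1_on {-L<..<L}}"


subsection \<open>The linearized operator and its negative eigenvalues\<close>

text \<open>\<open>dp\<close> and \<open>dm\<close> are the one-sided limits \<open>\<zeta>'(0+)\<close> and \<open>\<zeta>'(0-)\<close>; they exist because of the
  \<open>H\<^sup>2\<close> conditions, which also make \<open>\<zeta>\<close> continuously differentiable off \<open>2L\<int>\<close>.\<close>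

definition L1_domain :: "real \<Rightarrow> real \<Rightarrow> (real \<Rightarrow> complex) set" where
  "L1_domain L Z =
     {\<zeta> \<in> H1_per L \<inter> H2_on ({-L<..<L} - {0}) \<inter> H2_on {0<..<2 * L}.
        \<exists>dp dm. ((\<lambda>x. vector_derivative \<zeta> (at x)) \<longlongrightarrow> dp) (at_right 0) \<and>
                ((\<lambda>x. vector_derivative \<zeta> (at x)) \<longlongrightarrow> dm) (at_left 0) \<and>
                dp - dm = - of_real Z * \<zeta> 0}"

text \<open>The graph of \<open>\<zeta> \<mapsto> -\<zeta>'' + \<omega>\<zeta> - 3\<phi>\<^sup>2\<zeta>\<close> on this domain.  The identity is one in \<open>L\<^sup>2\<close> over a
  period; the period \<open>(0, 2L)\<close> contains no point of \<open>2L\<int>\<close>, so \<open>\<zeta>\<^sub>2\<close> is the second derivative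
  taken away from \<open>2L\<int>\<close> and carries no delta contribution.\<close>

definition L1_graph ::
  "real \<Rightarrow> real \<Rightarrow> real \<Rightarrow> (real \<Rightarrow> real) \<Rightarrow> (real \<Rightarrow> complex) \<Rightarrow> (real \<Rightarrow> complex) \<Rightarrow> bool" where
  "L1_graph L \<omega> Z \<phi> \<zeta> f \<longleftrightarrow>
     \<zeta> \<in> L1_domain L Z \<and>
     (\<exists>\<zeta>\<^sub>1\<in>L2_on {0<..<2 * L}. \<exists>\<zeta>\<^sub>2\<in>L2_on {0<..<2 * L}.
        weak_derivative {0<..<2 * L} \<zeta> \<zeta>\<^sub>1 \<and> weak_derivative {0<..<2 * L} \<zeta>\<^sub>1 \<zeta>\<^sub>2 \<and>
        (AE x in lebesgue_on {0<..<2 * L}.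
           f x = - \<zeta>\<^sub>2 x + of_real \<omega> * \<zeta> x - 3 * of_real ((\<phi> x)\<^sup>2) * \<zeta> x))"

definition L1_eigenspace ::
  "real \<Rightarrow> real \<Rightarrow> real \<Rightarrow> (real \<Rightarrow> real) \<Rightarrow> real \<Rightarrow> (real \<Rightarrow> complex) set" where
  "L1_eigenspace L \<omega> Z \<phi> \<mu> = {\<zeta>. L1_graph L \<omega> Z \<phi> \<zeta> (\<lambda>x. of_real \<mu> * \<zeta> x)}"

definition L1_negative_eigenvalues ::
  "real \<Rightarrow> real \<Rightarrow> real \<Rightarrow> (real \<Rightarrow> real) \<Rightarrow> real set" where
  "L1_negative_eigenvalues L \<omega> Z \<phi> = {\<mu>. \<mu> < 0 \<and> (\<exists>\<zeta>\<in>L1_eigenspace L \<omega> Z \<phi> \<mu>. \<zeta> \<noteq> (\<lambda>x. 0))}"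

interpretation cfun: vector_space "\<lambda>(c::complex) (f::real \<Rightarrow> complex) x. c * f x"
  by unfold_locales (auto simp: fun_eq_iff algebra_simps)

text \<open>The number of negative eigenvalues counted with multiplicity (the complex dimension of the
  eigenspace); it is \<open>\<infinity>\<close> if there are infinitely many of them or some eigenspace is
  infinite-dimensional.\<close>

definition n_L1 :: "real \<Rightarrow> real \<Rightarrow> real \<Rightarrow> (real \<Rightarrow> real) \<Rightarrow> enat" where
  "n_L1 L \<omega> Z \<phi> =
     (if finite (L1_negative_eigenvalues L \<omega> Z \<phi>) \<and>
         (\<forall>\<mu>\<in>L1_negative_eigenvalues L \<omega> Z \<phi>.
            \<exists>B. finite B \<and> L1_eigenspace L \<omega> Z \<phi> \<mu> \<subseteq> cfun.span B)
      then enat (\<Sum>\<mu>\<in>L1_negative_eigenvalues L \<omega> Z \<phi>. cfun.dim (L1_eigenspace L \<omega> Z \<phi> \<mu>))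
      else \<infinity>)"

end

theory Submission
  imports Defs
begin

text \<open>Put \<open>s = L - x\<close>.  The eigenvalue problem on a period splits into its even and odd parts, two scalar
  problems for \<open>y'' = (Q - \<mu>) y\<close> on \<open>[0, L]\<close> with \<open>Q = \<omega> - 3 w\<^sup>2\<close>, where \<open>w\<close> is the profile: the even one
  has \<open>y'(0) = 0\<close>, \<open>y'(L) = Z/2 y(L)\<close>, the odd one \<open>y(0) = y(L) = 0\<close>.  Both are settled by Sturm comparison
  with solutions at \<open>\<mu> = 0\<close>.  The odd one is compared with \<open>w'\<close>, which has no zero in \<open>(0, L)\<close> for \<open>Z > 0\<close>
  and one for \<open>Z < 0\<close>.  The even one is compared with the derivative \<open>v\<close> of the profile in its minimum
  \<open>\<eta>\<close>; it has exactly one negative eigenvalue as soon as \<open>v'(L) \<le> Z/2 v(L)\<close>.  That inequality needs no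
  differentiation of elliptic integrals: \<open>T(\<eta>) = 2L\<close> only at \<open>\<eta>\<^sub>2\<close> and \<open>T(\<theta>) < 2L\<close>, so \<open>T(\<eta>) < 2L\<close> for
  \<open>\<eta> > \<eta>\<^sub>2\<close> by continuity, i.e. the profiles with slightly larger minimum meet the line \<open>w' = Z/2 w\<close> before
  \<open>s = L\<close>, and they cross it downwards.\<close>

section \<open>Jacobi elliptic functions\<close>

text \<open>With \<open>s = L - x\<close> the minimum of the profile sits at \<open>s = 0\<close>
  and the delta at \<open>s = L\<close>. Every profile starts with slope 0, so \<open>v\<close> has
  the initial data of an even eigenfunction, and \<open>w'\<close>, up to a factor, those of an odd
  one. The Wronskians that compare eigenfunctions with \<open>v\<close> or \<open>w'\<close>
  therefore vanish at \<open>s = 0\<close>, and everything is decided by signs at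
  \<open>s = L\<close>. The obstacle is that \<open>v\<close> may itself change sign in
  \<open>(0, L)\<close>; the comparison then needs \<open>v < 0\<close> from there up to
  \<open>L\<close>. This comes from the constant Wronskian of \<open>w'\<close> and
  \<open>v\<close>, and for \<open>Z < 0\<close>, where \<open>w'\<close> has a zero of its own,
  from a second use of the inequality at \<open>L\<close>. That inequality is not strict, so it does
  not exclude 0 as an even eigenvalue; if \<open>v\<close> has a zero, the negative even eigenvalue
  is found by way of a Dirichlet condition at \<open>L\<close>. The operator is given by weak
  derivatives, hence a regularity argument turns eigenfunctions into classical solutions. An even
  and an odd eigenvalue may coincide as far as the argument goes, so dimensions are counted and not
  values.\<close>

lemma elliptic_radicand_pos:
  fixes k t :: real
  assumes "\<bar>k\<bar> < 1"
  shows "1 - k\<^sup>2 * (sin t)\<^sup>2 > 0"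
proof -
  have "k\<^sup>2 < 1" using assms by (simp add: abs_square_less_1)
  moreover have "k\<^sup>2 * (sin t)\<^sup>2 \<le> k\<^sup>2 * 1"
    by (rule mult_left_mono) (auto simp: abs_square_le_1)
  ultimately show ?thesis by linarith
qed

lemma elliptic_F_deriv:
  assumes "\<bar>k\<bar> < 1"
  shows "((\<lambda>\<phi>. elliptic_F \<phi> k) has_real_derivative 1 / sqrt (1 - k\<^sup>2 * (sin \<phi>)\<^sup>2)) (at \<phi>)"
proof -
  \<comment> \<open>The base point 0 and \<phi> have to lie in one interval, with \<phi> in its
    interior so that the derivative is two-sided.\<close>
  define a b where "a = - \<bar>\<phi>\<bar> - 1" and "b = \<bar>\<phi>\<bar> + 1"
  have ab: "a \<le> 0" "0 \<le> b" "a \<le> \<phi>" "\<phi> \<le> b" "a < \<phi>" "\<phi> < b" by (auto simp: a_def b_def)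
  have cont: "continuous_on {a..b} (\<lambda>t. 1 / sqrt (1 - k\<^sup>2 * (sin t)\<^sup>2))"
    using elliptic_radicand_pos[OF assms] by (intro continuous_intros) (auto simp: less_imp_neq[symmetric])
  have "((\<lambda>u. LBINT y=ereal 0..ereal u. 1 / sqrt (1 - k\<^sup>2 * (sin y)\<^sup>2)) has_vector_derivative
      1 / sqrt (1 - k\<^sup>2 * (sin \<phi>)\<^sup>2)) (at \<phi> within {a..b})"
    by (rule interval_integral_FTC2[OF ab(1,2) cont ab(3,4)])
  then show ?thesis using at_within_Icc_at[OF ab(5,6)]
    by (simp add: elliptic_F_def[abs_def] has_real_derivative_iff_has_vector_derivative)
qed

lemma elliptic_F_0 [simp]: "elliptic_F 0 k = 0"
  by (simp add: elliptic_F_def)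

lemma elliptic_F_strict_mono:
  assumes "\<bar>k\<bar> < 1"
  shows "strict_mono (\<lambda>\<phi>. elliptic_F \<phi> k)"
proof (rule strict_monoI)
  fix x y :: real assume "x < y"
  then show "elliptic_F x k < elliptic_F y k"
    by (rule DERIV_pos_imp_increasing) (use elliptic_F_deriv[OF assms] elliptic_radicand_pos[OF assms] in \<open>auto intro!: exI\<close>)
qed

lemma elliptic_F_less_iff:
  assumes "\<bar>k\<bar> < 1"
  shows "elliptic_F x k < elliptic_F y k \<longleftrightarrow> x < y"
  using strict_mono_less[OF elliptic_F_strict_mono[OF assms]] .

lemma elliptic_F_minus:
  assumes "\<bar>k\<bar> < 1"
  shows "elliptic_F (- x) k = - elliptic_F x k"
proof -
  have d: "((\<lambda>x. elliptic_F x k + elliptic_F (- x) k) has_real_derivative 0) (at x)" for x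
    by (rule derivative_eq_intros elliptic_F_deriv[OF assms] DERIV_chain2[OF elliptic_F_deriv[OF assms]] | simp)+
  from DERIV_isconst_all[of "\<lambda>x. elliptic_F x k + elliptic_F (- x) k" x 0] d
  show ?thesis by simp
qed

text \<open>The integrand is at least 1. This linear growth brackets every real value, which makes
  \<open>elliptic_F\<close> surjective and the amplitude meaningful for all arguments.\<close>

lemma elliptic_F_ge:
  assumes "\<bar>k\<bar> < 1" "0 \<le> x"
  shows "x \<le> elliptic_F x k"
proof -
  have "elliptic_F 0 k - 0 \<le> elliptic_F x k - x"
  proof (rule DERIV_nonneg_imp_nondecreasing[OF assms(2)])
    fix t
    have "sqrt (1 - k\<^sup>2 * (sin t)\<^sup>2) \<le> 1" by simp
    moreover have "0 < sqrt (1 - k\<^sup>2 * (sin t)\<^sup>2)" using elliptic_radicand_pos[OF assms(1)] by simp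
    ultimately have "1 / sqrt (1 - k\<^sup>2 * (sin t)\<^sup>2) - 1 \<ge> 0" by simp
    then show "\<exists>y. ((\<lambda>x. elliptic_F x k - x) has_real_derivative y) (at t) \<and> 0 \<le> y"
      using DERIV_diff[OF elliptic_F_deriv[OF assms(1)] DERIV_ident] by blast
  qed
  then show ?thesis by simp
qed

lemma elliptic_F_surj:
  assumes "\<bar>k\<bar> < 1"
  shows "\<exists>\<phi>. elliptic_F \<phi> k = u"
proof -
  have c: "continuous_on A (\<lambda>\<phi>. elliptic_F \<phi> k)" for A
    by (rule DERIV_continuous_on) (rule has_field_derivative_at_within[OF elliptic_F_deriv[OF assms]])
  have "elliptic_F (- \<bar>u\<bar>) k \<le> u" "u \<le> elliptic_F \<bar>u\<bar> k"
    using elliptic_F_ge[OF assms, of "\<bar>u\<bar>"] by (auto simp: elliptic_F_minus[OF assms])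
  from IVT'[of "\<lambda>\<phi>. elliptic_F \<phi> k", OF this _ c] show ?thesis by auto
qed

lemma jacobi_am_F:
  assumes "\<bar>k\<bar> < 1"
  shows "jacobi_am (elliptic_F \<phi> k) k = \<phi>"
  unfolding jacobi_am_def
  by (rule the_equality) (use strict_mono_eq[OF elliptic_F_strict_mono[OF assms]] in auto)

lemma elliptic_F_am:
  assumes "\<bar>k\<bar> < 1"
  shows "elliptic_F (jacobi_am u k) k = u"
  using elliptic_F_surj[OF assms, of u] jacobi_am_F[OF assms] by metis

lemma jacobi_am_less_iff:
  assumes "\<bar>k\<bar> < 1"
  shows "jacobi_am u k < jacobi_am v k \<longleftrightarrow> u < v"
  using elliptic_F_less_iff[OF assms, of "jacobi_am u k" "jacobi_am v k"] elliptic_F_am[OF assms] by simp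

lemma jacobi_am_K: "\<bar>k\<bar> < 1 \<Longrightarrow> jacobi_am (elliptic_K k) k = pi / 2"
  by (simp add: elliptic_K_def jacobi_am_F)

lemma jacobi_am_0: "\<bar>k\<bar> < 1 \<Longrightarrow> jacobi_am 0 k = 0"
  using jacobi_am_F[of k 0] by simp

lemma jacobi_am_minus:
  assumes "\<bar>k\<bar> < 1"
  shows "jacobi_am (- u) k = - jacobi_am u k"
  by (metis assms elliptic_F_am elliptic_F_minus jacobi_am_F)

lemma elliptic_K_pos: "\<bar>k\<bar> < 1 \<Longrightarrow> elliptic_K k > 0"
  using elliptic_F_less_iff[of k 0 "pi / 2"] by (simp add: elliptic_K_def)

lemma jacobi_am_deriv:
  assumes "\<bar>k\<bar> < 1"
  shows "((\<lambda>u. jacobi_am u k) has_real_derivative sqrt (1 - k\<^sup>2 * (sin (jacobi_am u k))\<^sup>2)) (at u)"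
proof -
  have cont: "isCont (\<lambda>u. jacobi_am u k) (elliptic_F (jacobi_am u k) k)"
    by (rule isCont_inverse_function[where d = 1])
      (auto simp: jacobi_am_F[OF assms] intro!: DERIV_isCont[OF elliptic_F_deriv[OF assms]])
  have "((\<lambda>u. jacobi_am u k) has_real_derivative
      inverse (1 / sqrt (1 - k\<^sup>2 * (sin (jacobi_am u k))\<^sup>2))) (at u)"
    by (rule DERIV_inverse_function[OF elliptic_F_deriv[OF assms], of _ _ "u - 1" "u + 1"])
      (use cont elliptic_radicand_pos[OF assms, of "jacobi_am u k"] in \<open>auto simp: elliptic_F_am[OF assms]\<close>)
  then show ?thesis by simp
qed

lemma jacobi_dn_pos: "\<bar>k\<bar> < 1 \<Longrightarrow> jacobi_dn u k > 0"
  using elliptic_radicand_pos by (simp add: jacobi_dn_def)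

lemma jacobi_dn_sq: "\<bar>k\<bar> < 1 \<Longrightarrow> (jacobi_dn u k)\<^sup>2 = 1 - k\<^sup>2 * (sin (jacobi_am u k))\<^sup>2"
  using elliptic_radicand_pos[of k "jacobi_am u k"] by (simp add: jacobi_dn_def)

lemma jacobi_dn_deriv:
  assumes "\<bar>k\<bar> < 1"
  shows "((\<lambda>u. jacobi_dn u k) has_real_derivative
    - (k\<^sup>2 * sin (jacobi_am u k) * cos (jacobi_am u k))) (at u)"
proof -
  note p = elliptic_radicand_pos[OF assms, of "jacobi_am u k"]
  have "((\<lambda>u. sqrt (1 - k\<^sup>2 * (sin (jacobi_am u k))\<^sup>2)) has_real_derivative
      (inverse (sqrt (1 - k\<^sup>2 * (sin (jacobi_am u k))\<^sup>2)) / 2) *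
      (- (k\<^sup>2 * (2 * sin (jacobi_am u k) * (cos (jacobi_am u k) * sqrt (1 - k\<^sup>2 * (sin (jacobi_am u k))\<^sup>2)))))) (at u)"
    by (rule DERIV_chain2[where f = sqrt and g = "\<lambda>u. 1 - k\<^sup>2 * (sin (jacobi_am u k))\<^sup>2", OF DERIV_real_sqrt[OF p]])
      (rule derivative_eq_intros jacobi_am_deriv[OF assms] DERIV_chain2[OF DERIV_sin jacobi_am_deriv[OF assms]] | simp)+
  then show ?thesis using p unfolding jacobi_dn_def by (simp add: field_simps)
qed

text \<open>The equation dn'' = (2 - k^2) dn - 2 dn^3, which after scaling becomes the stationary
  cubic equation of the profile.\<close>

lemma jacobi_dn_deriv2:
  assumes "\<bar>k\<bar> < 1"
  shows "((\<lambda>u. - (k\<^sup>2 * sin (jacobi_am u k) * cos (jacobi_am u k))) has_real_derivative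
    (2 - k\<^sup>2) * jacobi_dn u k - 2 * jacobi_dn u k ^ 3) (at u)"
proof -
  have am: "((\<lambda>u. jacobi_am u k) has_real_derivative jacobi_dn u k) (at u)"
    using jacobi_am_deriv[OF assms] by (simp add: jacobi_dn_def)
  have "((\<lambda>u. - (k\<^sup>2 * sin (jacobi_am u k) * cos (jacobi_am u k))) has_real_derivative
    - (k\<^sup>2 * (cos (jacobi_am u k) * jacobi_dn u k) * cos (jacobi_am u k)
       - k\<^sup>2 * sin (jacobi_am u k) * (sin (jacobi_am u k) * jacobi_dn u k))) (at u)"
    by (rule derivative_eq_intros DERIV_chain2[OF DERIV_sin am] DERIV_chain2[OF DERIV_cos am] refl | simp)+
  also have "- (k\<^sup>2 * (cos (jacobi_am u k) * jacobi_dn u k) * cos (jacobi_am u k)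
       - k\<^sup>2 * sin (jacobi_am u k) * (sin (jacobi_am u k) * jacobi_dn u k))
     = jacobi_dn u k * (- k\<^sup>2 * (cos (jacobi_am u k))\<^sup>2 + k\<^sup>2 * (sin (jacobi_am u k))\<^sup>2)"
    by (simp add: algebra_simps power2_eq_square)
  also have "\<dots> = jacobi_dn u k * (- k\<^sup>2 + 2 * (1 - (jacobi_dn u k)\<^sup>2))"
    by (simp add: jacobi_dn_sq[OF assms] cos_squared_eq algebra_simps)
  also have "\<dots> = (2 - k\<^sup>2) * jacobi_dn u k - 2 * jacobi_dn u k ^ 3"
    by (simp add: algebra_simps power2_eq_square power3_eq_cube)
  finally show ?thesis .
qed

lemma jacobi_dn_minus: "\<bar>k\<bar> < 1 \<Longrightarrow> jacobi_dn (- u) k = jacobi_dn u k"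
  by (simp add: jacobi_dn_def jacobi_am_minus)

text \<open>On \<open>[0, K]\<close> the amplitude runs through \<open>[0, pi/2]\<close>, where
  \<open>y^2 = 1 - k^2 sin^2\<close> has one solution. The closed form gives access to continuity in
  \<open>y\<close> and \<open>k\<close> together.\<close>

lemma jacobi_dn_inv_eq:
  assumes k: "0 < k" "k < 1" and y: "sqrt (1 - k\<^sup>2) \<le> y" "y \<le> 1"
  shows "jacobi_dn_inv y k = elliptic_F (arcsin (sqrt (1 - y\<^sup>2) / k)) k"
proof -
  have k': "\<bar>k\<bar> < 1" using k by simp
  define x where "x = sqrt (1 - y\<^sup>2) / k"
  have y0: "0 \<le> y" using y(1) k by (meson order_trans real_sqrt_ge_zero diff_ge_0_iff_ge power_le_one less_imp_le)
  have "1 - k\<^sup>2 \<le> y\<^sup>2" using y(1) y0 real_le_lsqrt sqrt_le_D by blast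
  then have x: "0 \<le> x" "x \<le> 1"
    using k y y0 real_sqrt_le_mono[of "1 - y\<^sup>2" "k\<^sup>2"] by (auto simp: x_def abs_square_le_1 power_le_one)
  have y2: "y\<^sup>2 = 1 - k\<^sup>2 * x\<^sup>2"
    using k y y0 by (simp add: x_def power_divide power_le_one)
  have as: "0 \<le> arcsin x" "arcsin x \<le> pi / 2" "sin (arcsin x) = x"
    using x arcsin_le_arcsin[of 0 x] arcsin_bounded[of x] by auto
  show ?thesis unfolding jacobi_dn_inv_def x_def[symmetric]
  proof (rule the_equality)
    have "elliptic_F (arcsin x) k \<in> {0..elliptic_K k}"
      using elliptic_F_less_iff[OF k', of "arcsin x" 0] elliptic_F_less_iff[OF k', of "pi / 2" "arcsin x"] as
      by (auto simp: elliptic_K_def not_less[symmetric])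
    moreover have "jacobi_dn (elliptic_F (arcsin x) k) k = y"
      using y2 y0 by (simp add: jacobi_dn_def jacobi_am_F[OF k'] as flip: y2)
    ultimately show "elliptic_F (arcsin x) k \<in> {0..elliptic_K k} \<and> jacobi_dn (elliptic_F (arcsin x) k) k = y" by simp
  next
    fix u assume u: "u \<in> {0..elliptic_K k} \<and> jacobi_dn u k = y"
    define \<phi> where "\<phi> = jacobi_am u k"
    have "0 \<le> \<phi>" "\<phi> \<le> pi / 2"
      using u jacobi_am_less_iff[OF k', of u 0] jacobi_am_less_iff[OF k', of "elliptic_K k" u]
      by (auto simp: \<phi>_def jacobi_am_0[OF k'] jacobi_am_K[OF k'])
    moreover have "k\<^sup>2 * x\<^sup>2 = k\<^sup>2 * (sin \<phi>)\<^sup>2"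
      using jacobi_dn_sq[OF k', of u] conjunct2[OF u] y2 unfolding \<phi>_def by (smt (verit))
    then have "(sin \<phi>)\<^sup>2 = x\<^sup>2" using k by (metis mult_cancel_left power_not_zero less_irrefl)
    ultimately have "sin \<phi> = x" using x(1) sin_ge_zero[of \<phi>] by (auto simp: power2_eq_iff)
    then have "arcsin x = \<phi>" using \<open>0 \<le> \<phi>\<close> \<open>\<phi> \<le> pi / 2\<close> by (auto intro!: arcsin_sin)
    then show "u = elliptic_F (arcsin x) k" by (simp add: \<phi>_def elliptic_F_am[OF k'])
  qed
qed

text \<open>Scaling the integration variable by \<phi> moves the variable end point into the
  integrand; over the fixed interval \<open>[0, 1]\<close> this is continuity of a parameter
  integral.\<close>

lemma continuous_on_elliptic_F:
  "continuous_on (UNIV \<times> {-1<..<1}) (\<lambda>(\<phi>, k). elliptic_F \<phi> k)"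
proof -
  have eq: "elliptic_F \<phi> k = integral (cbox 0 1) (\<lambda>t. \<phi> / sqrt (1 - k\<^sup>2 * (sin (\<phi> * t))\<^sup>2))"
    if "\<bar>k\<bar> < 1" for \<phi> k
  proof -
    have "((\<lambda>t. \<phi> / sqrt (1 - k\<^sup>2 * (sin (\<phi> * t))\<^sup>2)) has_integral elliptic_F (\<phi> * 1) k - elliptic_F (\<phi> * 0) k) {0..1}"
    proof (rule fundamental_theorem_of_calculus)
      fix t :: real
      have "((\<lambda>t. elliptic_F (\<phi> * t) k) has_real_derivative 1 / sqrt (1 - k\<^sup>2 * (sin (\<phi> * t))\<^sup>2) * \<phi>) (at t within {0..1})"
        by (rule DERIV_chain2[OF elliptic_F_deriv[OF that]]) (auto intro!: derivative_eq_intros)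
      then show "((\<lambda>t. elliptic_F (\<phi> * t) k) has_vector_derivative \<phi> / sqrt (1 - k\<^sup>2 * (sin (\<phi> * t))\<^sup>2)) (at t within {0..1})"
        by (simp add: has_real_derivative_iff_has_vector_derivative)
    qed simp
    then show ?thesis by (simp add: integral_unique)
  qed
  have "continuous_on (UNIV \<times> {-1<..<1})
     (\<lambda>p. integral (cbox 0 1) ((\<lambda>p t. fst p / sqrt (1 - (snd p)\<^sup>2 * (sin (fst p * t))\<^sup>2)) p))"
  proof (rule integral_continuous_on_param)
    have "1 - (snd (fst q))\<^sup>2 * (sin (fst (fst q) * snd q))\<^sup>2 > 0" if "q \<in> (UNIV \<times> {-1<..<1}) \<times> cbox 0 1"
      for q :: "(real \<times> real) \<times> real"
      by (rule elliptic_radicand_pos) (use that in \<open>auto simp: abs_less_iff\<close>)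
    then show "continuous_on ((UNIV \<times> {-1<..<1}) \<times> cbox 0 1)
      (\<lambda>(p, t). fst p / sqrt (1 - (snd p)\<^sup>2 * (sin (fst p * t))\<^sup>2) :: real)"
      unfolding split_beta by (intro continuous_intros) (auto simp: less_imp_neq[symmetric])
  qed
  then show ?thesis
    by (rule continuous_on_eq) (auto simp: eq abs_less_iff)
qed

section \<open>The dnoidal profile\<close>

text \<open>The positive solution of \<open>w'' = (\<omega> - w^2) w\<close> with
  \<open>w 0 = \<eta>\<close> and \<open>w' 0 = 0\<close>, indexed by its minimum: at the argument
  \<open>K\<close> the function dn has its least value \<open>sqrt (1 - k^2)\<close>, which scales
  to \<eta>.\<close>

definition profile :: "real \<Rightarrow> real \<Rightarrow> real \<Rightarrow> real" where
  "profile \<omega> \<eta> s = sqrt (2 * \<omega> - \<eta>\<^sup>2) *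
     jacobi_dn (elliptic_K (peak_k \<eta> \<omega>) - sqrt (2 * \<omega> - \<eta>\<^sup>2) / sqrt 2 * s) (peak_k \<eta> \<omega>)"

definition profile' :: "real \<Rightarrow> real \<Rightarrow> real \<Rightarrow> real" where
  "profile' \<omega> \<eta> s = (2 * \<omega> - \<eta>\<^sup>2) / sqrt 2 * ((peak_k \<eta> \<omega>)\<^sup>2 *
     sin (jacobi_am (elliptic_K (peak_k \<eta> \<omega>) - sqrt (2 * \<omega> - \<eta>\<^sup>2) / sqrt 2 * s) (peak_k \<eta> \<omega>)) *
     cos (jacobi_am (elliptic_K (peak_k \<eta> \<omega>) - sqrt (2 * \<omega> - \<eta>\<^sup>2) / sqrt 2 * s) (peak_k \<eta> \<omega>)))"

lemma peak_k_sq: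
  assumes "\<eta>\<^sup>2 < \<omega>"
  shows "(peak_k \<eta> \<omega>)\<^sup>2 = (2 * \<omega> - 2 * \<eta>\<^sup>2) / (2 * \<omega> - \<eta>\<^sup>2)"
proof -
  have "(0::real) \<le> \<eta>\<^sup>2" by simp
  then have "0 < 2 * \<omega> - 2 * \<eta>\<^sup>2" "0 < 2 * \<omega> - \<eta>\<^sup>2" using assms by linarith+
  then have "(2 * \<omega> - 2 * \<eta>\<^sup>2) / (2 * \<omega> - \<eta>\<^sup>2) \<ge> 0" by simp
  then show ?thesis unfolding peak_k_def by (rule real_sqrt_pow2)
qed

lemma peak_k_bounds:
  assumes "0 < \<eta>" "\<eta>\<^sup>2 < \<omega>"
  shows "0 < peak_k \<eta> \<omega>" "peak_k \<eta> \<omega> < 1"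
proof -
  have "(0::real) < \<eta>\<^sup>2" using assms by simp
  then have "0 < 2 * \<omega> - 2 * \<eta>\<^sup>2" "2 * \<omega> - 2 * \<eta>\<^sup>2 < 2 * \<omega> - \<eta>\<^sup>2" "0 < 2 * \<omega> - \<eta>\<^sup>2"
    using assms by linarith+
  then show "0 < peak_k \<eta> \<omega>" "peak_k \<eta> \<omega> < 1" by (simp_all add: peak_k_def)
qed

context
  fixes \<omega> \<eta> :: real
  assumes \<eta>: "0 < \<eta>" and \<omega>: "\<eta>\<^sup>2 < \<omega>"
begin

lemma radicand_pos: "2 * \<omega> - \<eta>\<^sup>2 > 0" "\<omega> > 0"
  using \<eta> \<omega> zero_le_power2[of \<eta>] by linarith+

lemma abs_k_less_1: "\<bar>peak_k \<eta> \<omega>\<bar> < 1"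
  using peak_k_bounds[OF \<eta> \<omega>] by simp

text \<open>With \<open>r^2 = 2 \<omega> - \<eta>^2\<close> this is
  \<open>1 - k^2 = (\<eta> / r)^2\<close>: the modulus is tied to the ratio of minimum \<eta> and
  maximum \<open>r\<close>.\<close>

lemma radicand_mult_k_sq: "(2 * \<omega> - \<eta>\<^sup>2) * (peak_k \<eta> \<omega>)\<^sup>2 = 2 * \<omega> - 2 * \<eta>\<^sup>2"
  using radicand_pos(1) by (simp add: peak_k_sq[OF \<omega>])

lemma profile_deriv: "(profile \<omega> \<eta> has_real_derivative profile' \<omega> \<eta> s) (at s within S)"
proof -
  define r k where "r = sqrt (2 * \<omega> - \<eta>\<^sup>2)" and "k = peak_k \<eta> \<omega>"
  have r: "r\<^sup>2 = 2 * \<omega> - \<eta>\<^sup>2" using radicand_pos by (simp add: r_def)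
  have k: "\<bar>k\<bar> < 1" using abs_k_less_1 by (simp add: k_def)
  have inner: "((\<lambda>s. elliptic_K k - r / sqrt 2 * s) has_real_derivative - (r / sqrt 2)) (at s)"
    using DERIV_diff[OF DERIV_const DERIV_cmult_Id, of "elliptic_K k" "r / sqrt 2" s UNIV] by simp
  have "((\<lambda>s. r * jacobi_dn (elliptic_K k - r / sqrt 2 * s) k) has_real_derivative
     r * (- (k\<^sup>2 * sin (jacobi_am (elliptic_K k - r / sqrt 2 * s) k) * cos (jacobi_am (elliptic_K k - r / sqrt 2 * s) k))
       * - (r / sqrt 2))) (at s)"
    by (rule DERIV_cmult[OF DERIV_chain2[where f = "\<lambda>u. jacobi_dn u k", OF jacobi_dn_deriv[OF k] inner]])
  moreover have "r * (- (k\<^sup>2 * sin (jacobi_am (elliptic_K k - r / sqrt 2 * s) k) * cos (jacobi_am (elliptic_K k - r / sqrt 2 * s) k))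
       * - (r / sqrt 2)) = profile' \<omega> \<eta> s"
    unfolding profile'_def r_def[symmetric] k_def unfolding r[symmetric] by (simp add: power2_eq_square)
  moreover have "profile \<omega> \<eta> = (\<lambda>s. r * jacobi_dn (elliptic_K k - r / sqrt 2 * s) k)"
    by (simp add: fun_eq_iff profile_def r_def k_def)
  ultimately show ?thesis by (metis has_field_derivative_at_within)
qed

lemma profile'_deriv:
  "(profile' \<omega> \<eta> has_real_derivative (\<omega> - (profile \<omega> \<eta> s)\<^sup>2) * profile \<omega> \<eta> s) (at s within S)"
proof -
  define r k where "r = sqrt (2 * \<omega> - \<eta>\<^sup>2)" and "k = peak_k \<eta> \<omega>"
  have r: "r\<^sup>2 = 2 * \<omega> - \<eta>\<^sup>2" using radicand_pos by (simp add: r_def)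
  have k: "\<bar>k\<bar> < 1" using abs_k_less_1 by (simp add: k_def)
  define h where "h u = k\<^sup>2 * sin (jacobi_am u k) * cos (jacobi_am u k)" for u
  have inner: "((\<lambda>s. elliptic_K k - r / sqrt 2 * s) has_real_derivative - (r / sqrt 2)) (at s)"
    using DERIV_diff[OF DERIV_const DERIV_cmult_Id, of "elliptic_K k" "r / sqrt 2" s UNIV] by simp
  define d where "d = jacobi_dn (elliptic_K k - r / sqrt 2 * s) k"
  have hd: "((\<lambda>u. - h u) has_real_derivative (2 - k\<^sup>2) * jacobi_dn u k - 2 * jacobi_dn u k ^ 3) (at u)" for u
    unfolding h_def by (rule jacobi_dn_deriv2[OF k])
  have "((\<lambda>s. - (r\<^sup>2 / sqrt 2) * - h (elliptic_K k - r / sqrt 2 * s)) has_real_derivative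
     - (r\<^sup>2 / sqrt 2) * (((2 - k\<^sup>2) * d - 2 * d ^ 3) * - (r / sqrt 2))) (at s)"
    unfolding d_def by (rule DERIV_cmult[OF DERIV_chain2[where f = "\<lambda>u. - h u", OF hd inner]])
  moreover have "(\<lambda>s. - (r\<^sup>2 / sqrt 2) * - h (elliptic_K k - r / sqrt 2 * s)) = profile' \<omega> \<eta>"
    unfolding fun_eq_iff profile'_def r_def[symmetric] k_def h_def unfolding r[symmetric] by simp
  moreover have "- (r\<^sup>2 / sqrt 2) * (((2 - k\<^sup>2) * d - 2 * d ^ 3) * - (r / sqrt 2)) =
      (\<omega> - (r * d)\<^sup>2) * (r * d)"
  proof -
    \<comment> \<open>The relation \<open>r^2 (2 - k^2) = 2 \<omega>\<close> is what turns the
      linear coefficient of the dn equation into \<omega>.\<close>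
    have "r\<^sup>2 * k\<^sup>2 = 2 * r\<^sup>2 - 2 * \<omega>" using radicand_mult_k_sq by (simp add: r k_def)
    then have *: "r\<^sup>2 * (2 - k\<^sup>2) = 2 * \<omega>" by (simp add: algebra_simps)
    have "- (r\<^sup>2 / sqrt 2) * (((2 - k\<^sup>2) * d - 2 * d ^ 3) * - (r / sqrt 2)) =
      (r\<^sup>2 * (2 - k\<^sup>2) * (r * d) - 2 * (r * d) ^ 3) / (sqrt 2 * sqrt 2)"
      by (simp add: field_simps power2_eq_square power3_eq_cube)
    also have "\<dots> = (\<omega> - (r * d)\<^sup>2) * (r * d)" unfolding *
      by (simp add: field_simps power2_eq_square power3_eq_cube)
    finally show ?thesis .
  qed
  moreover have "r * d = profile \<omega> \<eta> s" by (simp add: profile_def r_def k_def d_def)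
  ultimately show ?thesis by (metis has_field_derivative_at_within)
qed

lemma profile_0: "profile \<omega> \<eta> 0 = \<eta>"
proof -
  define k where "k = peak_k \<eta> \<omega>"
  have "(jacobi_dn (elliptic_K k) k)\<^sup>2 = 1 - k\<^sup>2"
    using jacobi_dn_sq[of k] abs_k_less_1 by (simp add: k_def jacobi_am_K)
  then have "(profile \<omega> \<eta> 0)\<^sup>2 = (2 * \<omega> - \<eta>\<^sup>2) * (1 - k\<^sup>2)"
    using radicand_pos by (simp add: profile_def k_def power_mult_distrib)
  also have "\<dots> = \<eta>\<^sup>2" using radicand_mult_k_sq by (simp add: k_def algebra_simps)
  finally have "(profile \<omega> \<eta> 0)\<^sup>2 = \<eta>\<^sup>2" .
  moreover have "profile \<omega> \<eta> 0 > 0"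
    using radicand_pos jacobi_dn_pos[OF abs_k_less_1] by (simp add: profile_def)
  ultimately show ?thesis using \<eta> by (simp add: power2_eq_iff)
qed

lemma profile'_0: "profile' \<omega> \<eta> 0 = 0"
  using abs_k_less_1 by (simp add: profile'_def jacobi_am_K)

lemma profile_pos: "profile \<omega> \<eta> s > 0"
  using radicand_pos jacobi_dn_pos[OF abs_k_less_1] by (simp add: profile_def)

lemma profile_sq_le: "(profile \<omega> \<eta> s)\<^sup>2 \<le> 2 * \<omega>"
proof -
  have "(jacobi_dn (elliptic_K (peak_k \<eta> \<omega>) - sqrt (2 * \<omega> - \<eta>\<^sup>2) / sqrt 2 * s) (peak_k \<eta> \<omega>))\<^sup>2 \<le> 1"
    using jacobi_dn_sq[OF abs_k_less_1] by simp
  then have "(profile \<omega> \<eta> s)\<^sup>2 \<le> (2 * \<omega> - \<eta>\<^sup>2) * 1"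
    unfolding profile_def power_mult_distrib using radicand_pos by (simp del: mult_1_right add: mult_left_le)
  then show ?thesis by (rule order_trans) simp
qed

text \<open>First integral of the profile equation, its constant fixed by the minimum. It gives
  \<open>w'\<close> up to sign from the value of \<open>w\<close>, which locates the point of slope
  \<open>Z/2 w\<close>.\<close>

lemma profile_energy:
  "2 * (profile' \<omega> \<eta> s)\<^sup>2 = (2 * \<omega> - \<eta>\<^sup>2 - (profile \<omega> \<eta> s)\<^sup>2) * ((profile \<omega> \<eta> s)\<^sup>2 - \<eta>\<^sup>2)"
proof -
  define k R where "k = peak_k \<eta> \<omega>" and "R = 2 * \<omega> - \<eta>\<^sup>2"
  define A where "A = jacobi_am (elliptic_K k - sqrt R / sqrt 2 * s) k"
  define D where "D = R * (k\<^sup>2 * (sin A)\<^sup>2)"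
  have w: "(profile \<omega> \<eta> s)\<^sup>2 = R - D"
  proof -
    have "(profile \<omega> \<eta> s)\<^sup>2 = R * (jacobi_dn (elliptic_K k - sqrt R / sqrt 2 * s) k)\<^sup>2"
      using radicand_pos by (simp add: profile_def R_def k_def power_mult_distrib)
    also have "\<dots> = R * (1 - k\<^sup>2 * (sin A)\<^sup>2)"
      using jacobi_dn_sq[OF abs_k_less_1] by (simp add: A_def k_def)
    finally show ?thesis by (simp add: D_def algebra_simps)
  qed
  have "2 * (profile' \<omega> \<eta> s)\<^sup>2 = R\<^sup>2 * (k\<^sup>2 * k\<^sup>2 * (sin A)\<^sup>2 * (cos A)\<^sup>2)"
    by (simp add: profile'_def R_def A_def k_def power_mult_distrib power_divide power2_eq_square mult_ac)
  also have "\<dots> = D * (R * k\<^sup>2 - D)"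
    unfolding D_def cos_squared_eq by (simp add: algebra_simps power2_eq_square)
  also have "R * k\<^sup>2 = R - \<eta>\<^sup>2" using radicand_mult_k_sq by (simp add: R_def k_def)
  finally show ?thesis unfolding w by (simp add: R_def algebra_simps)
qed

text \<open>The maximum is reached where the argument of dn is 0; up to there the amplitude stays in
  \<open>(0, pi/2)\<close>, where sine and cosine are positive.\<close>

lemma profile'_pos:
  assumes "0 < s" "sqrt (2 * \<omega> - \<eta>\<^sup>2) / sqrt 2 * s < elliptic_K (peak_k \<eta> \<omega>)"
  shows "profile' \<omega> \<eta> s > 0"
proof -
  define u where "u = elliptic_K (peak_k \<eta> \<omega>) - sqrt (2 * \<omega> - \<eta>\<^sup>2) / sqrt 2 * s"
  have "0 < sqrt (2 * \<omega> - \<eta>\<^sup>2) / sqrt 2 * s" using assms(1) radicand_pos by simp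
  then have "0 < u" "u < elliptic_K (peak_k \<eta> \<omega>)" using assms by (auto simp: u_def)
  then have "0 < jacobi_am u (peak_k \<eta> \<omega>)" "jacobi_am u (peak_k \<eta> \<omega>) < pi / 2"
    using jacobi_am_less_iff[OF abs_k_less_1] jacobi_am_0[OF abs_k_less_1] jacobi_am_K[OF abs_k_less_1] by metis+
  then show ?thesis unfolding profile'_def u_def[symmetric]
    using radicand_pos peak_k_bounds[OF \<eta> \<omega>] by (intro mult_pos_pos divide_pos_pos) (auto intro: sin_gt_zero cos_gt_zero)
qed

lemma profile'_neg:
  assumes "elliptic_K (peak_k \<eta> \<omega>) < sqrt (2 * \<omega> - \<eta>\<^sup>2) / sqrt 2 * s"
    "sqrt (2 * \<omega> - \<eta>\<^sup>2) / sqrt 2 * s < 2 * elliptic_K (peak_k \<eta> \<omega>)"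
  shows "profile' \<omega> \<eta> s < 0"
proof -
  define u where "u = sqrt (2 * \<omega> - \<eta>\<^sup>2) / sqrt 2 * s - elliptic_K (peak_k \<eta> \<omega>)"
  have "0 < u" "u < elliptic_K (peak_k \<eta> \<omega>)" using assms by (auto simp: u_def)
  then have a: "0 < jacobi_am u (peak_k \<eta> \<omega>)" "jacobi_am u (peak_k \<eta> \<omega>) < pi / 2"
    using jacobi_am_less_iff[OF abs_k_less_1] jacobi_am_0[OF abs_k_less_1] jacobi_am_K[OF abs_k_less_1] by metis+
  have "elliptic_K (peak_k \<eta> \<omega>) - sqrt (2 * \<omega> - \<eta>\<^sup>2) / sqrt 2 * s = - u" by (simp add: u_def)
  then have "profile' \<omega> \<eta> s = - ((2 * \<omega> - \<eta>\<^sup>2) / sqrt 2 * ((peak_k \<eta> \<omega>)\<^sup>2 *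
     sin (jacobi_am u (peak_k \<eta> \<omega>)) * cos (jacobi_am u (peak_k \<eta> \<omega>))))"
    unfolding profile'_def by (simp only: jacobi_am_minus[OF abs_k_less_1] sin_minus cos_minus mult_minus_left mult_minus_right)
  moreover have "(2 * \<omega> - \<eta>\<^sup>2) / sqrt 2 * ((peak_k \<eta> \<omega>)\<^sup>2 *
     sin (jacobi_am u (peak_k \<eta> \<omega>)) * cos (jacobi_am u (peak_k \<eta> \<omega>))) > 0"
    using radicand_pos peak_k_bounds[OF \<eta> \<omega>] a by (intro mult_pos_pos divide_pos_pos) (auto intro: sin_gt_zero cos_gt_zero)
  ultimately show ?thesis by simp
qed

lemma profile'_eq_0:
  assumes "sqrt (2 * \<omega> - \<eta>\<^sup>2) / sqrt 2 * s = elliptic_K (peak_k \<eta> \<omega>)"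
  shows "profile' \<omega> \<eta> s = 0"
  unfolding profile'_def assms using jacobi_am_0[OF abs_k_less_1] by simp

end

section \<open>Contact of a profile with the line \<open>w' = Z/2 w\<close>: threshold, value and
  position\<close>

text \<open>\<theta> is the value of \<eta> at which \<open>\<eta> + |Z| / sqrt 2\<close> equals
  \<open>r = sqrt (2 \<omega> - \<eta>^2)\<close>. Squaring
  \<open>|Z| / sqrt 2 \<le> r - \<eta>\<close> gives
  \<open>2 \<eta> r \<le> 2 \<omega> - Z^2 / 2\<close>, so the discriminant in
  \<open>peak_Phi\<close> is nonnegative up to \<theta> and positive below it.\<close>

lemma peak_theta_ineq:
  assumes \<omega>: "Z\<^sup>2 / 4 < \<omega>" and \<eta>: "0 < \<eta>" "\<eta> \<le> peak_theta \<omega> Z"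
  shows "\<eta> + \<bar>Z\<bar> / sqrt 2 \<le> sqrt (2 * \<omega> - \<eta>\<^sup>2)" "\<eta> < peak_theta \<omega> Z \<Longrightarrow> \<eta> + \<bar>Z\<bar> / sqrt 2 < sqrt (2 * \<omega> - \<eta>\<^sup>2)"
proof -
  define q where "q = \<bar>Z\<bar> / sqrt 2"
  have q: "q \<ge> 0" "q\<^sup>2 = Z\<^sup>2 / 2" by (auto simp: q_def power_divide)
  have q': "sqrt 2 / 4 * \<bar>Z\<bar> = q / 2" by (simp add: q_def real_div_sqrt field_simps)
  have eq: "peak_theta \<omega> Z = sqrt (\<omega> - q\<^sup>2 / 4) - q / 2"
    using q' by (simp add: peak_theta_def q)
  have pos: "\<omega> - q\<^sup>2 / 4 \<ge> 0" using \<omega> q(2) zero_le_power2[of Z] by linarith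
  have sq: "(\<eta> + q / 2)\<^sup>2 = \<eta>\<^sup>2 + \<eta> * q + q\<^sup>2 / 4" "(\<eta> + q)\<^sup>2 = \<eta>\<^sup>2 + 2 * (\<eta> * q) + q\<^sup>2"
    by (simp_all add: power2_eq_square algebra_simps)
  have "\<eta> + q / 2 \<le> sqrt (\<omega> - q\<^sup>2 / 4)" using \<eta> eq by simp
  then have "(\<eta> + q / 2)\<^sup>2 \<le> \<omega> - q\<^sup>2 / 4"
    using \<eta> q pos real_le_rsqrt sqrt_ge_absD by (metis abs_of_nonneg add_nonneg_nonneg divide_nonneg_nonneg less_imp_le zero_le_numeral)
  then have "(\<eta> + q)\<^sup>2 \<le> 2 * \<omega> - \<eta>\<^sup>2" unfolding sq by (simp add: algebra_simps)
  then show "\<eta> + \<bar>Z\<bar> / sqrt 2 \<le> sqrt (2 * \<omega> - \<eta>\<^sup>2)"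
    unfolding q_def by (rule real_le_rsqrt)
  assume "\<eta> < peak_theta \<omega> Z"
  then have "\<eta> + q / 2 < sqrt (\<omega> - q\<^sup>2 / 4)" using eq by simp
  then have "(\<eta> + q / 2)\<^sup>2 < \<omega> - q\<^sup>2 / 4"
    using real_le_lsqrt[of "\<eta> + q / 2" "\<omega> - q\<^sup>2 / 4"] \<eta>(1) q(1) by (meson not_less add_nonneg_nonneg divide_nonneg_nonneg less_imp_le zero_le_numeral)
  then have "(\<eta> + q)\<^sup>2 < 2 * \<omega> - \<eta>\<^sup>2" unfolding sq by (simp add: algebra_simps)
  then show "\<eta> + \<bar>Z\<bar> / sqrt 2 < sqrt (2 * \<omega> - \<eta>\<^sup>2)"
    unfolding q_def by (rule real_less_rsqrt)
qed

lemma peak_theta_sq_less: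
  assumes \<omega>: "Z\<^sup>2 / 4 < \<omega>" and Z: "Z \<noteq> 0" and \<eta>: "0 < \<eta>" "\<eta> \<le> peak_theta \<omega> Z"
  shows "\<eta>\<^sup>2 < \<omega>"
proof -
  have "\<eta> < \<eta> + \<bar>Z\<bar> / sqrt 2" using Z by simp
  also have "\<dots> \<le> sqrt (2 * \<omega> - \<eta>\<^sup>2)" by (rule peak_theta_ineq[OF \<omega> \<eta>])
  finally have "\<eta> < sqrt (2 * \<omega> - \<eta>\<^sup>2)" .
  then have "\<eta>\<^sup>2 < 2 * \<omega> - \<eta>\<^sup>2" using \<eta>(1)
    by (metis abs_of_pos real_sqrt_abs real_sqrt_less_iff)
  then show ?thesis by simp
qed

text \<open>\<open>\<Phi>^2\<close> is the larger root of
  \<open>P^2 - A P + \<eta>^2 r^2 = 0\<close> with \<open>A = 2 \<omega> - Z^2 / 2\<close> and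
  \<open>r^2 = 2 \<omega> - \<eta>^2\<close>. The third claim is this equation in the form of the
  first integral: a profile passing through the value \<Phi> has slope \<open>Z/2 \<Phi>\<close>
  there, up to sign. Being the larger of two distinct roots, \<open>\<Phi>^2\<close> exceeds
  \<open>A / 2\<close>; this is the later transversality.\<close>

lemma peak_Phi_facts:
  assumes \<omega>: "Z\<^sup>2 / 4 < \<omega>" and Z: "Z \<noteq> 0" and \<eta>: "0 < \<eta>" "\<eta> \<le> peak_theta \<omega> Z"
  shows "\<eta> < peak_Phi \<eta> \<omega> Z" "peak_Phi \<eta> \<omega> Z < sqrt (2 * \<omega> - \<eta>\<^sup>2)"
    "(2 * \<omega> - \<eta>\<^sup>2 - (peak_Phi \<eta> \<omega> Z)\<^sup>2) * ((peak_Phi \<eta> \<omega> Z)\<^sup>2 - \<eta>\<^sup>2) = Z\<^sup>2 / 2 * (peak_Phi \<eta> \<omega> Z)\<^sup>2"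
    "\<eta> < peak_theta \<omega> Z \<Longrightarrow> (peak_Phi \<eta> \<omega> Z)\<^sup>2 > \<omega> - Z\<^sup>2 / 4"
proof -
  define A D where "A = 2 * \<omega> - Z\<^sup>2 / 2" and "D = A\<^sup>2 - 4 * \<eta>\<^sup>2 * (2 * \<omega> - \<eta>\<^sup>2)"
  define r where "r = sqrt (2 * \<omega> - \<eta>\<^sup>2)"
  have below: "\<eta>\<^sup>2 < \<omega>" by (rule peak_theta_sq_less[OF assms])
  have r: "r\<^sup>2 = 2 * \<omega> - \<eta>\<^sup>2" "r > 0"
    using radicand_pos[OF \<eta>(1) below] by (auto simp: r_def)
  have A0: "A > 0" using \<omega> by (simp add: A_def)
  have q: "(\<bar>Z\<bar> / sqrt 2)\<^sup>2 = Z\<^sup>2 / 2" by (simp add: power_divide)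
  have "\<bar>Z\<bar> / sqrt 2 \<le> r - \<eta>" using peak_theta_ineq(1)[OF \<omega> \<eta>] by (simp add: r_def)
  then have "(\<bar>Z\<bar> / sqrt 2)\<^sup>2 \<le> (r - \<eta>)\<^sup>2" by (intro power_mono) auto
  then have le: "2 * \<eta> * r \<le> A" using r(1) unfolding q A_def by (simp add: power2_diff algebra_simps)
  have D: "D = A\<^sup>2 - (2 * \<eta> * r)\<^sup>2" by (simp add: D_def r(1)[symmetric] power_mult_distrib)
  have nn: "0 \<le> 2 * \<eta> * r" using \<eta> r by simp
  have D0: "D \<ge> 0" using power_mono[OF le nn, of 2] by (simp add: D)
  define P where "P = (A + sqrt D) / 2"
  have P0: "P > 0" using A0 D0 by (simp add: P_def add_pos_nonneg)
  have Phi: "peak_Phi \<eta> \<omega> Z = sqrt P" by (simp add: peak_Phi_def P_def A_def D_def)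
  then have Phi2: "(peak_Phi \<eta> \<omega> Z)\<^sup>2 = P" using P0 by simp
  have "2 * P - A = sqrt D" by (simp add: P_def field_simps)
  then have "(2 * P - A)\<^sup>2 = D" using D0 by simp
  then have "4 * (P * P) - 4 * (P * A) + 4 * \<eta>\<^sup>2 * r\<^sup>2 = 0"
    by (simp add: D power2_eq_square algebra_simps)
  then have quad: "P * P + \<eta>\<^sup>2 * r\<^sup>2 = P * A" by linarith
  have "(r\<^sup>2 - P) * (P - \<eta>\<^sup>2) = P * (r\<^sup>2 + \<eta>\<^sup>2) - (P * P + \<eta>\<^sup>2 * r\<^sup>2)"
    by (simp add: algebra_simps)
  also have "\<dots> = P * (2 * \<omega>) - P * A" unfolding quad by (simp add: r(1))
  also have "\<dots> = Z\<^sup>2 / 2 * P" by (simp add: A_def algebra_simps)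
  finally have root: "(r\<^sup>2 - P) * (P - \<eta>\<^sup>2) = Z\<^sup>2 / 2 * P" .
  show "(2 * \<omega> - \<eta>\<^sup>2 - (peak_Phi \<eta> \<omega> Z)\<^sup>2) * ((peak_Phi \<eta> \<omega> Z)\<^sup>2 - \<eta>\<^sup>2) = Z\<^sup>2 / 2 * (peak_Phi \<eta> \<omega> Z)\<^sup>2"
    using root by (simp add: Phi2 r(1))
  have "Z\<^sup>2 / 2 * P > 0" using Z P0 by simp
  then have "(r\<^sup>2 - P) * (P - \<eta>\<^sup>2) > 0" using root by simp
  moreover have "\<eta>\<^sup>2 < r\<^sup>2" using below r by linarith
  ultimately have P: "\<eta>\<^sup>2 < P" "P < r\<^sup>2" by (auto simp: zero_less_mult_iff)
  show "\<eta> < peak_Phi \<eta> \<omega> Z" unfolding Phi using P(1) \<eta>(1) by (simp add: real_less_rsqrt)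
  show "peak_Phi \<eta> \<omega> Z < sqrt (2 * \<omega> - \<eta>\<^sup>2)" unfolding Phi using P(2) r by simp
  assume "\<eta> < peak_theta \<omega> Z"
  then have "\<bar>Z\<bar> / sqrt 2 < r - \<eta>" using peak_theta_ineq(2)[OF \<omega> \<eta>] by (simp add: r_def)
  then have "(\<bar>Z\<bar> / sqrt 2)\<^sup>2 < (r - \<eta>)\<^sup>2" by (intro power_strict_mono) auto
  then have le: "2 * \<eta> * r < A" using r(1) unfolding q A_def by (simp add: power2_diff algebra_simps)
  have "D > 0" using power_strict_mono[OF le nn, of 2] by (simp add: D)
  then have "P > A / 2" by (simp add: P_def)
  then show "(peak_Phi \<eta> \<omega> Z)\<^sup>2 > \<omega> - Z\<^sup>2 / 4" by (simp add: Phi2 A_def)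
qed

lemma peak_a_eq:
  assumes \<omega>: "Z\<^sup>2 / 4 < \<omega>" and Z: "Z \<noteq> 0" and \<eta>: "0 < \<eta>" "\<eta> \<le> peak_theta \<omega> Z"
  defines "k \<equiv> peak_k \<eta> \<omega>" and "r \<equiv> sqrt (2 * \<omega> - \<eta>\<^sup>2)" and "\<Phi> \<equiv> peak_Phi \<eta> \<omega> Z"
  defines "x \<equiv> sqrt (1 - (\<Phi> / r)\<^sup>2) / k"
  shows "peak_a \<eta> \<omega> Z = elliptic_F (arcsin x) k" "0 < x" "x < 1" "r * jacobi_dn (peak_a \<eta> \<omega> Z) k = \<Phi>"
proof -
  have below: "\<eta>\<^sup>2 < \<omega>" by (rule peak_theta_sq_less[OF assms(1-4)])
  have k: "0 < k" "k < 1" "\<bar>k\<bar> < 1" using peak_k_bounds[OF \<eta>(1) below] by (auto simp: k_def)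
  have r: "r\<^sup>2 = 2 * \<omega> - \<eta>\<^sup>2" "r > 0" using radicand_pos[OF \<eta>(1) below] by (auto simp: r_def)
  note Phi = peak_Phi_facts(1,2)[OF assms(1-4), folded \<Phi>_def r_def]
  define y where "y = \<Phi> / r"
  have y: "0 < y" "y < 1" using Phi r \<eta> by (auto simp: y_def)
  have "r\<^sup>2 * k\<^sup>2 = r\<^sup>2 - \<eta>\<^sup>2" using radicand_mult_k_sq[OF \<eta>(1) below] by (simp add: r k_def)
  then have k2: "1 - k\<^sup>2 = (\<eta> / r)\<^sup>2" using r(2) by (simp add: power_divide field_simps)
  have "\<eta> / r < y" using Phi r by (simp add: y_def divide_strict_right_mono)
  then have y2: "1 - k\<^sup>2 < y\<^sup>2" unfolding k2 using \<eta> r by (intro power_strict_mono) auto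
  have sq: "sqrt (1 - k\<^sup>2) \<le> y" using y2 y by (simp add: real_le_lsqrt)
  show a: "peak_a \<eta> \<omega> Z = elliptic_F (arcsin x) k"
    unfolding peak_a_def x_def using jacobi_dn_inv_eq[OF k(1,2) sq] y by (simp add: y_def \<Phi>_def r_def k_def)
  have y1: "y\<^sup>2 < 1" using y by (simp add: abs_square_less_1)
  show x0: "0 < x" using k y1 by (simp add: x_def y_def[symmetric])
  have "sqrt (1 - y\<^sup>2) < sqrt (k\<^sup>2)" by (rule real_sqrt_less_mono) (use y2 in simp)
  then show x1: "x < 1" using k by (simp add: x_def y_def[symmetric])
  have "x\<^sup>2 = (1 - y\<^sup>2) / k\<^sup>2" using y1 by (simp add: x_def y_def[symmetric] power_divide)
  then have "k\<^sup>2 * x\<^sup>2 = 1 - y\<^sup>2" using k by simp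
  then have "jacobi_dn (peak_a \<eta> \<omega> Z) k = y"
    using x0 x1 y by (simp add: a jacobi_dn_def jacobi_am_F[OF k(3)])
  then show "r * jacobi_dn (peak_a \<eta> \<omega> Z) k = \<Phi>" using r by (simp add: y_def)
qed

text \<open>\<Phi> lies strictly between minimum and maximum of the profile, which keeps
  \<open>a\<close> off both ends of \<open>[0, K]\<close>.\<close>

lemma peak_a_bounds:
  assumes \<omega>: "Z\<^sup>2 / 4 < \<omega>" and Z: "Z \<noteq> 0" and \<eta>: "0 < \<eta>" "\<eta> \<le> peak_theta \<omega> Z"
  shows "0 < peak_a \<eta> \<omega> Z" "peak_a \<eta> \<omega> Z < elliptic_K (peak_k \<eta> \<omega>)"
proof -
  have k: "\<bar>peak_k \<eta> \<omega>\<bar> < 1"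
    using peak_k_bounds[OF \<eta>(1) peak_theta_sq_less[OF assms]] by simp
  obtain x where x: "peak_a \<eta> \<omega> Z = elliptic_F (arcsin x) (peak_k \<eta> \<omega>)" "0 < x" "x < 1"
    using peak_a_eq(1-3)[OF assms] by blast
  have "0 < arcsin x" "arcsin x < pi / 2"
    using arcsin_less_arcsin[of 0 x] arcsin_less_arcsin[of x 1] x(2,3) by auto
  then show "0 < peak_a \<eta> \<omega> Z" "peak_a \<eta> \<omega> Z < elliptic_K (peak_k \<eta> \<omega>)"
    using elliptic_F_less_iff[OF k, of 0] elliptic_F_less_iff[OF k, of _ "pi / 2"]
    unfolding x(1) elliptic_K_def by auto
qed

section \<open>The half period as a function of the minimum\<close>

text \<open>The interval contains \<theta>, where the discriminant in \<Phi> vanishes but its root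
  is still continuous. Hence the limits \<open>T_0\<close> and \<open>T_1\<close> are values at
  \<theta>.\<close>

lemma continuous_on_half_periods:
  assumes \<omega>: "Z\<^sup>2 / 4 < \<omega>" and Z: "Z \<noteq> 0"
  shows "continuous_on {0<..peak_theta \<omega> Z} (\<lambda>\<eta>. T_minus \<eta> \<omega> Z)"
    "continuous_on {0<..peak_theta \<omega> Z} (\<lambda>\<eta>. T_plus \<eta> \<omega> Z)"
proof -
  let ?I = "{0<..peak_theta \<omega> Z}"
  have facts: "\<eta>\<^sup>2 < \<omega>" "2 * \<omega> - \<eta>\<^sup>2 > 0" "0 < peak_k \<eta> \<omega>" "peak_k \<eta> \<omega> < 1" if "\<eta> \<in> ?I" for \<eta>
  proof -
    show 1: "\<eta>\<^sup>2 < \<omega>" using peak_theta_sq_less[OF assms, of \<eta>] that by auto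
    show "2 * \<omega> - \<eta>\<^sup>2 > 0" "0 < peak_k \<eta> \<omega>" "peak_k \<eta> \<omega> < 1"
      using radicand_pos[of \<eta> \<omega>] peak_k_bounds[of \<eta> \<omega>] 1 that by auto
  qed
  have k1: "- 1 < peak_k \<eta> \<omega>" if "0 < \<eta>" "\<eta> \<le> peak_theta \<omega> Z" for \<eta>
    using facts(3)[of \<eta>] that by simp
  have nz: "peak_k \<eta> \<omega> \<noteq> 0" "sqrt (2 * \<omega> - \<eta>\<^sup>2) \<noteq> 0" if "\<eta> \<in> ?I" for \<eta>
    using facts(2,3)[OF that] by simp_all
  have k: "continuous_on ?I (\<lambda>\<eta>. peak_k \<eta> \<omega>)"
    unfolding peak_k_def by (intro continuous_intros ballI less_imp_neq[symmetric] facts(2))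
  have Phi: "continuous_on ?I (\<lambda>\<eta>. peak_Phi \<eta> \<omega> Z)"
    unfolding peak_Phi_def by (intro continuous_intros)
  have F: "continuous_on ?I (\<lambda>\<eta>. elliptic_F (g \<eta>) (peak_k \<eta> \<omega>))" if "continuous_on ?I g" for g
  proof -
    have "continuous_on ?I (\<lambda>\<eta>. (\<lambda>(\<phi>, k). elliptic_F \<phi> k) (g \<eta>, peak_k \<eta> \<omega>))"
      by (rule continuous_on_compose2[OF continuous_on_elliptic_F])
        (use facts k1 in \<open>auto intro!: continuous_intros that k\<close>)
    then show ?thesis by simp
  qed
  have K: "continuous_on ?I (\<lambda>\<eta>. elliptic_K (peak_k \<eta> \<omega>))"
    unfolding elliptic_K_def by (intro F continuous_intros)
  have r: "continuous_on ?I (\<lambda>\<eta>. sqrt (2 * \<omega> - \<eta>\<^sup>2))" by (intro continuous_intros)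
  have x: "continuous_on ?I (\<lambda>\<eta>. sqrt (1 - (peak_Phi \<eta> \<omega> Z / sqrt (2 * \<omega> - \<eta>\<^sup>2))\<^sup>2) / peak_k \<eta> \<omega>)"
    by (intro continuous_on_divide continuous_on_real_sqrt continuous_on_diff continuous_on_power
        continuous_on_const Phi r k ballI nz)
  have "continuous_on ?I (\<lambda>\<eta>. elliptic_F (arcsin (sqrt (1 - (peak_Phi \<eta> \<omega> Z / sqrt (2 * \<omega> - \<eta>\<^sup>2))\<^sup>2) / peak_k \<eta> \<omega>)) (peak_k \<eta> \<omega>))"
    by (intro F continuous_on_arcsin x) (use peak_a_eq(2,3)[OF assms] in \<open>auto intro!: less_imp_le intro: order.strict_trans[of "-1" 0]\<close>)
  then have a: "continuous_on ?I (\<lambda>\<eta>. peak_a \<eta> \<omega> Z)"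
    by (rule continuous_on_eq) (use peak_a_eq(1)[OF assms] in auto)
  show "continuous_on ?I (\<lambda>\<eta>. T_minus \<eta> \<omega> Z)" unfolding T_minus_def
    by (intro continuous_on_mult continuous_on_divide continuous_on_add continuous_on_diff
        continuous_on_const K a r ballI nz)
  show "continuous_on ?I (\<lambda>\<eta>. T_plus \<eta> \<omega> Z)" unfolding T_plus_def
    by (intro continuous_on_mult continuous_on_divide continuous_on_add continuous_on_diff
        continuous_on_const K a r ballI nz)
qed

text \<open>The value of \<open>s\<close> at which the profile with minimum \<eta> satisfies
  \<open>w' = Z/2 w\<close>, for \<eta> below \<theta>; the dnoidal peak is the member for which it
  equals \<open>L\<close>.\<close>

definition half_period :: "real \<Rightarrow> real \<Rightarrow> real \<Rightarrow> real" where
  "half_period \<omega> Z \<eta> = (if Z > 0 then T_minus \<eta> \<omega> Z else T_plus \<eta> \<omega> Z) / 2"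

lemma half_period_eq:
  "sqrt (2 * \<omega> - \<eta>\<^sup>2) > 0 \<Longrightarrow> sqrt (2 * \<omega> - \<eta>\<^sup>2) / sqrt 2 * half_period \<omega> Z \<eta> =
    elliptic_K (peak_k \<eta> \<omega>) - (if Z > 0 then peak_a \<eta> \<omega> Z else - peak_a \<eta> \<omega> Z)"
  by (simp add: half_period_def T_minus_def T_plus_def)

text \<open>At \<open>s = T\<close> the argument of dn is \<open>a\<close> or \<open>- a\<close>, so
  the profile has the value \<Phi> and the first integral gives its slope up to sign. The sign
  follows from the position of \<open>T\<close>: before the maximum for \<open>Z > 0\<close>, behind
  it for \<open>Z < 0\<close>.\<close>

lemma half_period_Robin:
  assumes \<omega>: "Z\<^sup>2 / 4 < \<omega>" and Z: "Z \<noteq> 0" and \<eta>: "0 < \<eta>" "\<eta> < peak_theta \<omega> Z"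
  defines "T \<equiv> half_period \<omega> Z \<eta>"
  shows "0 < T" "profile' \<omega> \<eta> T = Z / 2 * profile \<omega> \<eta> T" "(profile \<omega> \<eta> T)\<^sup>2 > \<omega> - Z\<^sup>2 / 4"
    "Z > 0 \<Longrightarrow> 0 < s \<Longrightarrow> s \<le> T \<Longrightarrow> profile' \<omega> \<eta> s > 0"
    "Z < 0 \<Longrightarrow> \<exists>t. 0 < t \<and> t < T \<and> profile' \<omega> \<eta> t = 0 \<and> (\<forall>s. 0 < s \<longrightarrow> s < t \<longrightarrow> profile' \<omega> \<eta> s > 0) \<and>
       (\<forall>s. t < s \<longrightarrow> s \<le> T \<longrightarrow> profile' \<omega> \<eta> s < 0)"
proof -
  have \<eta>': "\<eta> \<le> peak_theta \<omega> Z" using \<eta> by simp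
  have below: "\<eta>\<^sup>2 < \<omega>" by (rule peak_theta_sq_less[OF assms(1-3) \<eta>'])
  define r k a where "r = sqrt (2 * \<omega> - \<eta>\<^sup>2)" and "k = peak_k \<eta> \<omega>" and "a = peak_a \<eta> \<omega> Z"
  have k: "\<bar>k\<bar> < 1" using peak_k_bounds[OF \<eta>(1) below] by (auto simp: k_def)
  have r: "r > 0" using radicand_pos[OF \<eta>(1) below] by (auto simp: r_def)
  have a: "0 < a" "a < elliptic_K k" using peak_a_bounds[OF assms(1-3) \<eta>'] by (auto simp: a_def k_def)
  have T: "r / sqrt 2 * T = elliptic_K k - (if Z > 0 then a else - a)"
    using half_period_eq[of \<omega> \<eta> Z] r by (simp add: r_def k_def a_def T_def)
  define q where "q = r / sqrt 2"
  have q: "q > 0" using r by (simp add: q_def)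
  have "q * T > 0" using T a elliptic_K_pos[OF k] by (auto simp: q_def[symmetric])
  then show T0: "0 < T" using q by (simp add: zero_less_mult_iff)
  have prof: "profile \<omega> \<eta> T = peak_Phi \<eta> \<omega> Z"
    using peak_a_eq(4)[OF assms(1-3) \<eta>'] T
    by (auto simp: profile_def r_def[symmetric] k_def[symmetric] a_def[symmetric] jacobi_dn_minus[OF k])
  show "(profile \<omega> \<eta> T)\<^sup>2 > \<omega> - Z\<^sup>2 / 4"
    unfolding prof by (rule peak_Phi_facts(4)[OF assms(1-3) \<eta>' \<eta>(2)])
  have pos: "profile' \<omega> \<eta> s > 0" if "0 < s" "q * s < elliptic_K k" for s
    using profile'_pos[OF \<eta>(1) below that(1)] that(2) by (simp add: q_def r_def k_def)
  have neg: "profile' \<omega> \<eta> s < 0" if "elliptic_K k < q * s" "q * s < 2 * elliptic_K k" for s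
    using profile'_neg[OF \<eta>(1) below] that by (simp add: q_def r_def k_def)
  have le: "q * s \<le> q * T" if "s \<le> T" for s using that q by simp
  show Zpos: "profile' \<omega> \<eta> s > 0" if "Z > 0" "0 < s" "s \<le> T" for s
    using pos[OF that(2)] le[OF that(3)] T a that by (simp add: q_def[symmetric])
  have Zneg: "profile' \<omega> \<eta> s < 0" if "Z < 0" "elliptic_K k < q * s" "s \<le> T" for s
    using neg[OF that(2)] le[OF that(3)] T a that by (simp add: q_def[symmetric])
  have "2 * (profile' \<omega> \<eta> T)\<^sup>2 = Z\<^sup>2 / 2 * (peak_Phi \<eta> \<omega> Z)\<^sup>2"
    unfolding profile_energy[OF \<eta>(1) below] prof by (rule peak_Phi_facts(3)[OF assms(1-3) \<eta>'])
  then have sq: "(profile' \<omega> \<eta> T)\<^sup>2 = (Z / 2 * peak_Phi \<eta> \<omega> Z)\<^sup>2" by (simp add: power_mult_distrib power_divide)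
  have Phi0: "peak_Phi \<eta> \<omega> Z > 0" using peak_Phi_facts(1)[OF assms(1-3) \<eta>'] \<eta> by simp
  show "profile' \<omega> \<eta> T = Z / 2 * profile \<omega> \<eta> T"
  proof (cases "Z > 0")
    case True
    have "profile' \<omega> \<eta> T > 0" using Zpos[OF True T0] by simp
    moreover have "Z / 2 * peak_Phi \<eta> \<omega> Z > 0" using True Phi0 by simp
    ultimately show ?thesis using sq unfolding prof power2_eq_iff by linarith
  next
    case False
    then have Z0: "Z < 0" using Z by simp
    have "profile' \<omega> \<eta> T < 0" using Zneg[OF Z0, of T] T a False by (simp add: q_def[symmetric])
    moreover have "Z / 2 * peak_Phi \<eta> \<omega> Z < 0" using Z0 Phi0 by (simp add: mult_neg_pos)
    ultimately show ?thesis using sq unfolding prof power2_eq_iff by linarith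
  qed
  assume Z0: "Z < 0"
  \<comment> \<open>At \<open>t\<close> the argument of dn is 0, so this is the maximum of the
    profile.\<close>
  define t where "t = elliptic_K k / q"
  have qt: "q * t = elliptic_K k" using q by (simp add: t_def)
  show "\<exists>t. 0 < t \<and> t < T \<and> profile' \<omega> \<eta> t = 0 \<and> (\<forall>s. 0 < s \<longrightarrow> s < t \<longrightarrow> profile' \<omega> \<eta> s > 0) \<and>
       (\<forall>s. t < s \<longrightarrow> s \<le> T \<longrightarrow> profile' \<omega> \<eta> s < 0)"
  proof (intro exI[of _ t] conjI allI impI)
    show "0 < t" using elliptic_K_pos[OF k] q by (simp add: t_def)
    have "q * t < q * T" using qt T a Z0 by (simp add: q_def[symmetric])
    then show "t < T" using q by simp
    show "profile' \<omega> \<eta> t = 0"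
      by (rule profile'_eq_0[OF \<eta>(1) below]) (use qt in \<open>simp add: q_def r_def k_def\<close>)
    show "profile' \<omega> \<eta> s > 0" if "0 < s" "s < t" for s
      using pos[OF that(1)] that(2) q qt by (metis mult_less_cancel_left_pos)
    show "profile' \<omega> \<eta> s < 0" if "t < s" "s \<le> T" for s
      using Zneg[OF Z0 _ that(2)] that(1) q qt by (metis mult_less_cancel_left_pos)
  qed
qed

lemma peak_parameterD:
  assumes \<omega>: "Z\<^sup>2 / 4 < \<omega>" and Z: "Z \<noteq> 0" and par: "peak_parameter L \<omega> Z \<eta>0"
  shows "0 < \<eta>0" "\<eta>0 < peak_theta \<omega> Z" "half_period \<omega> Z \<eta>0 = L"
    "\<And>\<eta>. \<eta>0 < \<eta> \<Longrightarrow> \<eta> < peak_theta \<omega> Z \<Longrightarrow> half_period \<omega> Z \<eta> < L"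
proof -
  let ?\<theta> = "peak_theta \<omega> Z"
  define H where "H = half_period \<omega> Z"
  have set: "{\<eta> \<in> {0<..<?\<theta>}. H \<eta> = L} = {\<eta>0}"
    using par by (cases "Z > 0") (auto simp: peak_parameter_def H_def half_period_def mult.commute)
  then have "\<eta>0 \<in> {\<eta> \<in> {0<..<?\<theta>}. H \<eta> = L}" by simp
  then show \<eta>2: "0 < \<eta>0" "\<eta>0 < ?\<theta>" "half_period \<omega> Z \<eta>0 = L" by (auto simp: H_def)
  have uniq: "\<eta> = \<eta>0" if "0 < \<eta>" "\<eta> < ?\<theta>" "H \<eta> = L" for \<eta> using set that by auto
  have cont: "continuous_on {0<..?\<theta>} H"
    unfolding H_def half_period_def using continuous_on_half_periods[OF \<omega> Z]
    by (cases "Z > 0") (auto intro!: continuous_intros)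
  \<comment> \<open>Continuity up to \<theta> evaluates the one-sided limits defining
    \<open>T_0\<close> and \<open>T_1\<close>, so the hypothesis on \<open>2 L\<close> becomes
    \<open>H ?\<theta> < L\<close>.\<close>
  have lim: "Lim (at_left ?\<theta>) f = f ?\<theta>" if "continuous_on {0<..?\<theta>} f" for f :: "real \<Rightarrow> real"
  proof (rule tendsto_Lim)
    have "continuous_on {\<eta>0..?\<theta>} f"
      by (rule continuous_on_subset[OF that]) (use \<eta>2 in auto)
    then have "(f \<longlongrightarrow> f ?\<theta>) (at ?\<theta> within {\<eta>0..?\<theta>})" using \<eta>2 by (auto simp: continuous_on_def)
    then show "(f \<longlongrightarrow> f ?\<theta>) (at_left ?\<theta>)" by (simp only: at_within_Icc_at_left[OF \<eta>2(2)])
  qed simp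
  have end_less: "H ?\<theta> < L"
    using par lim[OF continuous_on_half_periods(1)[OF \<omega> Z]] lim[OF continuous_on_half_periods(2)[OF \<omega> Z]]
    by (cases "Z > 0") (auto simp: peak_parameter_def H_def half_period_def T_0_def T_1_def)
  show "half_period \<omega> Z \<eta> < L" if \<eta>: "\<eta>0 < \<eta>" "\<eta> < ?\<theta>" for \<eta>
  proof (rule ccontr)
    assume "\<not> half_period \<omega> Z \<eta> < L"
    then have "L \<le> H \<eta>" by (simp add: H_def)
    moreover have "continuous_on {\<eta>..?\<theta>} H"
      by (rule continuous_on_subset[OF cont]) (use \<eta> \<eta>2 in auto)
    ultimately obtain x where "\<eta> \<le> x" "x \<le> ?\<theta>" "H x = L"
      using IVT2'[of H ?\<theta> L \<eta>] end_less \<eta> by auto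
    moreover then have "x \<noteq> ?\<theta>" using end_less by auto
    ultimately show False using uniq[of x] \<eta> \<eta>2 by auto
  qed
qed

lemma half_period_seq:
  assumes \<omega>: "Z\<^sup>2 / 4 < \<omega>" and Z: "Z \<noteq> 0" and par: "peak_parameter L \<omega> Z \<eta>0"
  obtains m where "\<And>n::nat. \<eta>0 < m n" "\<And>n. m n < peak_theta \<omega> Z" "m \<longlonglongrightarrow> \<eta>0"
    "(\<lambda>n. half_period \<omega> Z (m n)) \<longlonglongrightarrow> L"
proof -
  let ?\<theta> = "peak_theta \<omega> Z"
  note p = peak_parameterD[OF assms]
  \<comment> \<open>The denominator is at least 2, so \<open>m n\<close> lies strictly below
    \<theta> already for \<open>n = 0\<close>.\<close>
  define m where "m n = \<eta>0 + (?\<theta> - \<eta>0) / real (n + 2)" for n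
  have m: "\<eta>0 < m n" "m n < ?\<theta>" for n
  proof -
    have "d / real (n + 2) > 0 \<and> d / real (n + 2) < d" if "d > 0" for d :: real
      using that by (simp add: field_simps add_pos_nonneg)
    from this[of "?\<theta> - \<eta>0"] p(2)
    have "(?\<theta> - \<eta>0) / real (n + 2) > 0" "(?\<theta> - \<eta>0) / real (n + 2) < ?\<theta> - \<eta>0"
      by auto
    then show "\<eta>0 < m n" "m n < ?\<theta>" by (auto simp: m_def)
  qed
  have "(\<lambda>n. 1 / real n) \<longlonglongrightarrow> 0" by (rule lim_1_over_n)
  then have "(\<lambda>n. 1 / real (n + 2)) \<longlonglongrightarrow> 0" by (rule LIMSEQ_ignore_initial_segment)
  then have "(\<lambda>n. \<eta>0 + (?\<theta> - \<eta>0) * (1 / real (n + 2))) \<longlonglongrightarrow> \<eta>0 + (?\<theta> - \<eta>0) * 0"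
    by (intro tendsto_intros)
  then have lim: "m \<longlonglongrightarrow> \<eta>0" by (simp add: m_def[abs_def])
  have sub: "{0<..<?\<theta>} \<subseteq> {0<..?\<theta>}" by auto
  have cont: "continuous_on {0<..<?\<theta>} (half_period \<omega> Z)"
    unfolding half_period_def
    using continuous_on_subset[OF continuous_on_half_periods(1)[OF \<omega> Z] sub]
      continuous_on_subset[OF continuous_on_half_periods(2)[OF \<omega> Z] sub]
    by (cases "Z > 0") (auto intro!: continuous_intros)
  then have "isCont (half_period \<omega> Z) \<eta>0" using p(1,2) by (simp add: continuous_on_eq_continuous_at)
  from isCont_tendsto_compose[OF this lim] p(3)
  have "(\<lambda>n. half_period \<omega> Z (m n)) \<longlonglongrightarrow> L" by simp
  with m lim show thesis by (rule that)
qed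

text \<open>As the half period is \<open>L\<close>, counting from the minimum absorbs the shift:
  \<open>K - q (L - y)\<close> is \<open>q y + a\<close> or \<open>q y - a\<close>, where
  \<open>q = r / sqrt 2\<close>. Both sign cases of the peak become one formula.\<close>

lemma dnoidal_peak_eq_profile:
  assumes \<omega>: "Z\<^sup>2 / 4 < \<omega>" and Z: "Z \<noteq> 0" and par: "peak_parameter L \<omega> Z \<eta>0"
  shows "dnoidal_peak L \<omega> Z \<eta>0 x = profile \<omega> \<eta>0 (L - \<bar>x - 2 * L * of_int \<lfloor>(x + L) / (2 * L)\<rfloor>\<bar>)"
proof -
  note p = peak_parameterD[OF assms]
  have below: "\<eta>0\<^sup>2 < \<omega>" by (rule peak_theta_sq_less[OF \<omega> Z p(1)]) (use p in simp)
  define r K a where "r = sqrt (2 * \<omega> - \<eta>0\<^sup>2)" and "K = elliptic_K (peak_k \<eta>0 \<omega>)" and "a = peak_a \<eta>0 \<omega> Z"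
  have r: "r > 0" using radicand_pos[OF p(1) below] by (simp add: r_def)
  have L: "r / sqrt 2 * L = K - (if Z > 0 then a else - a)"
    using half_period_eq[of \<omega> \<eta>0 Z] r p(3) by (simp add: r_def K_def a_def)
  have "K - r / sqrt 2 * (L - y) = r / sqrt 2 * y + (if Z > 0 then a else - a)" for y
    unfolding right_diff_distrib L by simp
  then show ?thesis
    unfolding dnoidal_peak_def profile_def Let_def r_def[symmetric] K_def[symmetric] a_def[symmetric]
    by simp
qed

section \<open>Linear second-order equations\<close>

text \<open>The derivative is carried as a second function, and both derivatives are taken within
  \<open>[0, L]\<close>, one-sided at the ends, so that initial and boundary conditions are plain
  values.\<close>

definition sol2 :: "real \<Rightarrow> (real \<Rightarrow> real) \<Rightarrow> (real \<Rightarrow> real) \<Rightarrow> (real \<Rightarrow> real) \<Rightarrow> bool" where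
  "sol2 L Q y y' \<longleftrightarrow>
     (\<forall>s\<in>{0..L}. (y has_real_derivative y' s) (at s within {0..L}) \<and>
                 (y' has_real_derivative Q s * y s) (at s within {0..L}))"

lemma sol2_deriv:
  assumes "sol2 L Q y y'" "s \<in> {0..L}"
  shows "(y has_real_derivative y' s) (at s within {0..L})"
    and "(y' has_real_derivative Q s * y s) (at s within {0..L})"
  using assms by (auto simp: sol2_def)

lemma sol2_deriv_at:
  assumes "sol2 L Q y y'" "0 < s" "s < L"
  shows "(y has_real_derivative y' s) (at s)"
    and "(y' has_real_derivative Q s * y s) (at s)"
  using sol2_deriv[OF assms(1), of s] assms(2,3) at_within_Icc_at[of 0 s L] by auto

lemma sol2_continuous:
  assumes "sol2 L Q y y'"
  shows "continuous_on {0..L} y" "continuous_on {0..L} y'"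
  using sol2_deriv[OF assms] by (meson DERIV_continuous continuous_on_eq_continuous_within)+

text \<open>For \<open>E = z^2 + z'^2\<close> the function
  \<open>E exp (- (C + 2) t) - e^2 t\<close> does not increase. The one estimate serves uniqueness
  (\<open>g = 0\<close>), dependence on the potential (\<open>g\<close> is the change of potential
  times a solution) and the distance of two nonlinear profiles.\<close>

lemma gronwall_energy:
  fixes z z' R g :: "real \<Rightarrow> real"
  assumes z: "\<And>s. s \<in> {0..L} \<Longrightarrow> (z has_real_derivative z' s) (at s within {0..L})"
    and z': "\<And>s. s \<in> {0..L} \<Longrightarrow> (z' has_real_derivative R s * z s + g s) (at s within {0..L})"
    and R: "\<And>s. s \<in> {0..L} \<Longrightarrow> \<bar>R s\<bar> \<le> C" and g: "\<And>s. s \<in> {0..L} \<Longrightarrow> \<bar>g s\<bar> \<le> e"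
    and s: "s \<in> {0..L}"
  shows "(z s)\<^sup>2 + (z' s)\<^sup>2 \<le> ((z 0)\<^sup>2 + (z' 0)\<^sup>2 + e\<^sup>2 * L) * exp ((C + 2) * L)"
proof -
  have C: "C \<ge> 0" using R[OF s] by simp
  define E where "E t = (z t)\<^sup>2 + (z' t)\<^sup>2" for t
  define f where "f t = E t * exp (- (C + 2) * t) - e\<^sup>2 * t" for t
  define f' where "f' t = (2 * z t * z' t + 2 * z' t * (R t * z t + g t)) * exp (- (C + 2) * t)
     - (C + 2) * E t * exp (- (C + 2) * t) - e\<^sup>2" for t
  have der: "(f has_real_derivative f' t) (at t within {0..L})" if "t \<in> {0..L}" for t
    unfolding f_def E_def f'_def
    by (rule derivative_eq_intros z z' refl that)+ (simp add: E_def algebra_simps)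
  have nonpos: "f' t \<le> 0" if t: "t \<in> {0..L}" for t
  proof -
    \<comment> \<open>The rate \<open>C + 2\<close> is the sum of \<open>1 + C\<close> from this
      term and 1 from \<open>2 z' g \<le> E + e^2\<close> below.\<close>
    have "2 * z t * z' t * (1 + R t) \<le> E t * (1 + C)"
    proof -
      have "2 * z t * z' t * (1 + R t) \<le> \<bar>2 * z t * z' t\<bar> * \<bar>1 + R t\<bar>"
        by (metis abs_ge_self abs_mult)
      also have "\<dots> \<le> E t * (1 + C)"
      proof (rule mult_mono)
        have "0 \<le> (\<bar>z t\<bar> - \<bar>z' t\<bar>)\<^sup>2" by simp
        then show "\<bar>2 * z t * z' t\<bar> \<le> E t" by (simp add: E_def power2_diff abs_mult)
        show "\<bar>1 + R t\<bar> \<le> 1 + C" using R[OF t] by linarith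
      qed (auto simp: E_def)
      finally show ?thesis .
    qed
    moreover have "2 * z' t * g t \<le> E t + e\<^sup>2"
    proof -
      have "0 \<le> (z' t - g t)\<^sup>2" by simp
      moreover have "(g t)\<^sup>2 \<le> e\<^sup>2" using g[OF t] by (simp add: abs_le_square_iff[symmetric])
      ultimately show ?thesis using zero_le_power2[of "z t"] unfolding E_def power2_diff by linarith
    qed
    ultimately have "2 * z t * z' t + 2 * z' t * (R t * z t + g t) - (C + 2) * E t \<le> e\<^sup>2"
      by (simp add: algebra_simps)
    then have "(2 * z t * z' t + 2 * z' t * (R t * z t + g t) - (C + 2) * E t) * exp (- (C + 2) * t)
       \<le> e\<^sup>2 * exp (- (C + 2) * t)" by (rule mult_right_mono) simp
    also have "\<dots> \<le> e\<^sup>2 * 1" 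
    proof (rule mult_left_mono)
      show "exp (- (C + 2) * t) \<le> 1" using t C by (simp add: mult_nonneg_nonneg mult_nonpos_nonneg)
    qed simp
    finally show ?thesis by (simp add: f'_def algebra_simps)
  qed
  have "f s \<le> f 0"
  proof (cases "s = 0")
    case False
    with s have "0 < s" by auto
    show ?thesis
    proof (rule DERIV_nonpos_imp_decreasing_open[of 0 s f])
      show "continuous_on {0..s} f"
        using der s by (meson DERIV_continuous DERIV_subset atLeastatMost_subset_iff atLeastAtMost_iff continuous_on_eq_continuous_within continuous_on_subset order_refl)
      show "\<exists>y. DERIV f x :> y \<and> y \<le> 0" if "0 < x" "x < s" for x
        using der[of x] nonpos[of x] that s at_within_Icc_at[of 0 x L] by auto
    qed (use \<open>0 < s\<close> in auto)
  qed simp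
  then have "E s * exp (- (C + 2) * s) \<le> E 0 + e\<^sup>2 * s" by (simp add: f_def)
  also have "\<dots> \<le> E 0 + e\<^sup>2 * L" using s by (simp add: mult_left_mono)
  finally have "E s * exp (- (C + 2) * s) * exp ((C + 2) * s) \<le> (E 0 + e\<^sup>2 * L) * exp ((C + 2) * s)"
    by (rule mult_right_mono) simp
  also have "\<dots> \<le> (E 0 + e\<^sup>2 * L) * exp ((C + 2) * L)"
    by (rule mult_left_mono) (use s C in \<open>auto simp: E_def mult_left_mono\<close>)
  also have "E s * exp (- (C + 2) * s) * exp ((C + 2) * s) = E s"
    by (simp add: mult.assoc mult_exp_exp algebra_simps)
  finally have "E s \<le> (E 0 + e\<^sup>2 * L) * exp ((C + 2) * L)" .
  then show ?thesis by (simp add: E_def)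
qed

lemma continuous_on_Icc_bounded:
  fixes f :: "real \<Rightarrow> real"
  assumes "continuous_on {a..b} f"
  obtains M where "M \<ge> 0" "\<And>s. s \<in> {a..b} \<Longrightarrow> \<bar>f s\<bar> \<le> M"
proof -
  have "bounded (f ` {a..b})" using assms by (intro compact_imp_bounded compact_continuous_image) auto
  then obtain M where "\<forall>s\<in>{a..b}. \<bar>f s\<bar> \<le> M" by (auto simp: bounded_iff)
  then show thesis using that[of "\<bar>M\<bar>"] by force
qed

text \<open>Picard series. Linearity gives factorial bounds on all of \<open>[0, L]\<close>, hence a
  global solution, and the uniform convergence of the derived series permits differentiation term by
  term.\<close>

lemma sol2_exists:
  fixes Q :: "real \<Rightarrow> real"
  assumes Q: "continuous_on {0..L} Q" and L: "0 \<le> L"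
  shows "\<exists>y y'. sol2 L Q y y' \<and> y 0 = \<alpha> \<and> y' 0 = \<beta>"
proof -
  define J where "J f s = integral {0..s} f" for f :: "real \<Rightarrow> real" and s :: real
  have J_deriv: "(J f has_real_derivative f s) (at s within {0..L})"
    if "continuous_on {0..L} f" "s \<in> {0..L}" for f s
    unfolding J_def by (rule integral_has_real_derivative[OF that])
  have J_cont: "continuous_on {0..L} (J f)" if "continuous_on {0..L} f" for f
    using J_deriv[OF that] by (meson DERIV_continuous continuous_on_eq_continuous_within)
  have J0: "J f 0 = 0" for f by (simp add: J_def)
  have J_mono: "\<bar>J f s\<bar> \<le> J g s"
    if f: "continuous_on {0..L} f" and g: "continuous_on {0..L} g"
      and le: "\<And>t. t \<in> {0..s} \<Longrightarrow> \<bar>f t\<bar> \<le> g t" and s: "s \<in> {0..L}" for f g s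
  proof -
    have "{0..s} \<subseteq> {0..L}" using s by auto
    then have "f integrable_on {0..s}" "g integrable_on {0..s}"
      using f g by (auto intro!: integrable_continuous_real intro: continuous_on_subset)
    then show ?thesis unfolding J_def
      using integral_norm_bound_integral[of f "{0..s}" g] le by simp
  qed
  \<comment> \<open>These are the terms of the series, not its partial sums: the second derivative
    of \<open>Y (Suc n)\<close> is \<open>Q Y n\<close>.\<close>
  define Y where "Y = rec_nat (\<lambda>s. \<alpha> + \<beta> * s) (\<lambda>n y. J (J (\<lambda>r. Q r * y r)))"
  define Z where "Z n = (case n of 0 \<Rightarrow> (\<lambda>s. \<beta>) | Suc n \<Rightarrow> J (\<lambda>r. Q r * Y n r))" for n
  have Y0: "Y 0 = (\<lambda>s. \<alpha> + \<beta> * s)" and YSuc: "Y (Suc n) = J (Z (Suc n))" for n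
    by (simp_all add: Y_def Z_def)
  have Z0: "Z 0 = (\<lambda>s. \<beta>)" and ZSuc: "Z (Suc n) = J (\<lambda>r. Q r * Y n r)" for n
    by (simp_all add: Z_def)
  have Y_cont: "continuous_on {0..L} (Y n)" for n
  proof (induction n)
    case 0 show ?case by (auto simp: Y0 intro!: continuous_intros)
  next
    case (Suc n) show ?case unfolding YSuc ZSuc
      by (intro J_cont continuous_intros Q Suc)
  qed
  have QY_cont: "continuous_on {0..L} (\<lambda>r. Q r * Y n r)" for n
    by (intro continuous_intros Q Y_cont)
  have Z_cont: "continuous_on {0..L} (Z n)" for n
    by (cases n) (auto simp: Z0 ZSuc intro!: J_cont QY_cont)
  \<comment> \<open>Derivatives of the \<open>Z n\<close>. They form the series of the
    \<open>Y n\<close> multiplied by \<open>Q\<close> and shifted by one; this shift yields the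
    differential equation.\<close>
  define Z' where "Z' n = (case n of 0 \<Rightarrow> (\<lambda>s. 0) | Suc n \<Rightarrow> (\<lambda>r. Q r * Y n r))" for n
  have Y_deriv: "(Y n has_real_derivative Z n s) (at s within {0..L})" if "s \<in> {0..L}" for n s
    using that by (cases n) (auto simp: Y0 Z0 YSuc intro!: derivative_eq_intros J_deriv Z_cont)
  have Z_deriv: "(Z n has_real_derivative Z' n s) (at s within {0..L})" if "s \<in> {0..L}" for n s
    using that by (cases n) (auto simp: Z0 Z'_def ZSuc intro!: derivative_eq_intros J_deriv QY_cont)
  obtain M where M0: "M \<ge> 0" and M: "\<And>s. s \<in> {0..L} \<Longrightarrow> \<bar>Q s\<bar> \<le> M"
    using continuous_on_Icc_bounded[OF Q] by blast
  define B where "B = \<bar>\<alpha>\<bar> + \<bar>\<beta>\<bar> * L"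
  have B0: "B \<ge> 0" using L by (simp add: B_def)
  \<comment> \<open>One of the two integrations is estimated crudely by the length \<open>L\<close>;
    the other one produces the factor \<open>s / (n + 1)\<close> behind the factorial.\<close>
  define K where "K = M * L"
  have K0: "K \<ge> 0" using L M0 by (simp add: K_def)
  have Z_bound_aux: "\<bar>Z (Suc n) s\<bar> \<le> K * (B * (K * s) ^ n / fact n)"
    if IH: "\<And>s. s \<in> {0..L} \<Longrightarrow> \<bar>Y n s\<bar> \<le> B * (K * s) ^ n / fact n" and s: "s \<in> {0..L}" for n s
  proof -
    define D where "D = B * (K * s) ^ n / fact n"
    have D0: "D \<ge> 0" using B0 K0 s by (simp add: D_def)
    have "\<bar>J (\<lambda>r. Q r * Y n r) s\<bar> \<le> J (\<lambda>r. M * D) s"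
    proof (rule J_mono[OF QY_cont _ _ s])
      fix t assume t: "t \<in> {0..s}"
      have "\<bar>Y n t\<bar> \<le> B * (K * t) ^ n / fact n" using IH[of t] t s by auto
      also have "\<dots> \<le> D" unfolding D_def
        by (intro divide_right_mono mult_left_mono power_mono) (use t K0 B0 in auto)
      finally show "\<bar>Q t * Y n t\<bar> \<le> M * D"
        using M[of t] t s M0 by (auto simp: abs_mult intro!: mult_mono)
    qed auto
    also have "\<dots> = s * (M * D)" using s by (simp add: J_def)
    also have "\<dots> \<le> L * (M * D)" by (rule mult_right_mono) (use s M0 D0 in auto)
    finally show ?thesis by (simp add: ZSuc D_def K_def mult_ac)
  qed
  have Y_bound: "\<bar>Y n s\<bar> \<le> B * (K * s) ^ n / fact n" if "s \<in> {0..L}" for n s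
    using that
  proof (induction n arbitrary: s)
    case 0
    have "\<bar>\<alpha> + \<beta> * s\<bar> \<le> \<bar>\<alpha>\<bar> + \<bar>\<beta>\<bar> * s" 
      using abs_triangle_ineq[of \<alpha> "\<beta> * s"] 0 by (simp add: abs_mult)
    also have "\<dots> \<le> B" using 0 by (auto simp: B_def intro!: mult_left_mono)
    finally show ?case by (simp add: Y0)
  next
    case (Suc n)
    define G where "G s = B * (K * s) ^ Suc n / fact (Suc n)" for s
    define G' where "G' s = K * (B * (K * s) ^ n / fact n)" for s
    have G: "(G has_real_derivative G' t) (at t within S)" for t S
      unfolding G_def G'_def
      by (rule derivative_eq_intros refl | simp)+
    have "\<bar>J (Z (Suc n)) s\<bar> \<le> J G' s"
    proof (rule J_mono[OF Z_cont _ _ Suc.prems])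
      show "continuous_on {0..L} G'" unfolding G'_def by (intro continuous_intros) auto
      show "\<bar>Z (Suc n) t\<bar> \<le> G' t" if "t \<in> {0..s}" for t
        unfolding G'_def by (rule Z_bound_aux[OF Suc.IH]) (use that Suc.prems in auto)
    qed
    also have "J G' s = G s - G 0"
      unfolding J_def
      by (intro integral_unique fundamental_theorem_of_calculus)
        (use Suc.prems G in \<open>auto simp: has_real_derivative_iff_has_vector_derivative\<close>)
    finally show ?case by (simp add: YSuc G_def)
  qed
  have Y_bound': "\<bar>Y n s\<bar> \<le> B * ((K * L) ^ n / fact n)" if "s \<in> {0..L}" for n s
  proof -
    have "B * (K * s) ^ n / fact n \<le> B * (K * L) ^ n / fact n"
      by (intro divide_right_mono mult_left_mono power_mono) (use that K0 B0 in auto)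
    then show ?thesis using Y_bound[OF that, of n] by simp
  qed
  have Z_bound: "\<bar>Z (Suc n) s\<bar> \<le> K * (B * ((K * L) ^ n / fact n))" if "s \<in> {0..L}" for n s
  proof -
    have "B * (K * s) ^ n / fact n \<le> B * (K * L) ^ n / fact n"
      by (intro divide_right_mono mult_left_mono power_mono) (use that K0 B0 in auto)
    then have "K * (B * (K * s) ^ n / fact n) \<le> K * (B * (K * L) ^ n / fact n)"
      by (rule mult_left_mono[OF _ K0])
    then show ?thesis using Z_bound_aux[OF Y_bound that, of n] by simp
  qed
  have summ: "summable (\<lambda>n. (K * L) ^ n / fact n)"
    using summable_exp[of "K * L"] by (simp add: field_simps)
  have uZ: "uniformly_convergent_on {0..L} (\<lambda>n s. \<Sum>i<n. Z i s)"
  proof (rule Weierstrass_m_test')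
    define m where "m = (\<lambda>n. case n of 0 \<Rightarrow> \<bar>\<beta>\<bar> | Suc n \<Rightarrow> K * (B * ((K * L) ^ n / fact n)))"
    show "norm (Z n s) \<le> m n" if "s \<in> {0..L}" for n s
      using Z_bound[OF that] by (cases n) (auto simp: m_def Z0)
    have "summable (\<lambda>n. m (Suc n))" unfolding m_def nat.case by (intro summable_mult summ)
    then show "summable m" by (simp only: summable_Suc_iff)
  qed
  have uZ': "uniformly_convergent_on {0..L} (\<lambda>n s. \<Sum>i<n. Z' i s)"
  proof (rule Weierstrass_m_test')
    define m where "m = (\<lambda>n. case n of 0 \<Rightarrow> 0 | Suc n \<Rightarrow> M * (B * ((K * L) ^ n / fact n)))"
    show "norm (Z' n s) \<le> m n" if "s \<in> {0..L}" for n s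
      using Y_bound'[OF that] M[OF that] M0
      by (cases n) (auto simp: m_def Z'_def abs_mult mult.assoc intro!: mult_mono
          simp flip: times_divide_eq_right)
    have "summable (\<lambda>n. m (Suc n))" unfolding m_def nat.case by (intro summable_mult summ)
    then show "summable m" by (simp only: summable_Suc_iff)
  qed
  have at0: "Y (Suc n) 0 = 0" "Z (Suc n) 0 = 0" for n by (simp_all add: YSuc ZSuc J0)
  have sums0: "(\<lambda>n. Y n 0) sums \<alpha>" "(\<lambda>n. Z n 0) sums \<beta>"
    using sums_Suc[of "\<lambda>n. Y n 0" 0] sums_Suc[of "\<lambda>n. Z n 0" 0] by (simp_all add: at0 Y0 Z0)
  have 0: "0 \<in> {0..L}" using L by simp
  have lims: "uniform_limit {0..L} (\<lambda>n s. \<Sum>i<n. f i s) (\<lambda>s. \<Sum>i. f i s) sequentially"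
    if "uniformly_convergent_on {0..L} (\<lambda>n s. \<Sum>i<n. f i s)" for f :: "nat \<Rightarrow> real \<Rightarrow> real"
  proof -
    from that obtain g where g: "uniform_limit {0..L} (\<lambda>n s. \<Sum>i<n. f i s) g sequentially"
      by (auto simp: uniformly_convergent_on_def)
    have "(\<lambda>i. f i s) sums g s" if "s \<in> {0..L}" for s
      using tendsto_uniform_limitI[OF g that] by (simp add: sums_def)
    then have "g s = (\<Sum>i. f i s)" if "s \<in> {0..L}" for s using that sums_unique by blast
    with g show ?thesis by (metis (no_types, lifting) uniform_limit_cong')
  qed
  obtain y where y: "\<And>s. s \<in> {0..L} \<Longrightarrow> (\<lambda>n. Y n s) sums y s"
    "\<And>s. s \<in> {0..L} \<Longrightarrow> (y has_real_derivative (\<Sum>n. Z n s)) (at s within {0..L})"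
    using has_field_derivative_series[of "{0..L}" Y Z, OF convex_real_interval(5) Y_deriv lims[OF uZ] 0 sums_summable[OF sums0(1)]]
    by blast
  obtain z where z: "\<And>s. s \<in> {0..L} \<Longrightarrow> (\<lambda>n. Z n s) sums z s"
    "\<And>s. s \<in> {0..L} \<Longrightarrow> (z has_real_derivative (\<Sum>n. Z' n s)) (at s within {0..L})"
    using has_field_derivative_series[of "{0..L}" Z Z', OF convex_real_interval(5) Z_deriv lims[OF uZ'] 0 sums_summable[OF sums0(2)]]
    by blast
  have "(\<Sum>n. Z' n s) = Q s * y s" if "s \<in> {0..L}" for s
  proof -
    have "(\<lambda>n. Z' (Suc n) s) sums (Q s * y s)"
      unfolding Z'_def by (simp add: sums_mult[OF y(1)[OF that]])
    from sums_Suc[OF this] show ?thesis by (simp add: Z'_def sums_iff)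
  qed
  then have "sol2 L Q y z"
    using y(2) z sums_unique[OF z(1)] by (auto simp: sol2_def)
  moreover have "y 0 = \<alpha>" "z 0 = \<beta>"
    using sums_unique2[OF y(1)[OF 0] sums0(1)] sums_unique2[OF z(1)[OF 0] sums0(2)] by auto
  ultimately show ?thesis by blast
qed


lemma sol2_lincomb:
  assumes "sol2 L Q y y'" "sol2 L Q z z'"
  shows "sol2 L Q (\<lambda>s. a * y s + b * z s) (\<lambda>s. a * y' s + b * z' s)"
  unfolding sol2_def
  by (auto intro!: derivative_eq_intros sol2_deriv[OF assms(1)] sol2_deriv[OF assms(2)]
      simp: algebra_simps)

lemma sol2_subinterval:
  assumes "sol2 L Q y y'" "R \<le> L"
  shows "sol2 R Q y y'"
proof -
  have "{0..R} \<subseteq> {0..L}" using assms(2) by auto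
  then show ?thesis unfolding sol2_def
    by (metis DERIV_subset assms(1) sol2_deriv subsetD)
qed

lemma sol2_zero:
  assumes "sol2 L Q y y'" "continuous_on {0..L} Q" "y 0 = 0" "y' 0 = 0" "s \<in> {0..L}"
  shows "y s = 0" "y' s = 0"
proof -
  obtain M where "\<And>s. s \<in> {0..L} \<Longrightarrow> \<bar>Q s\<bar> \<le> M"
    using continuous_on_Icc_bounded[OF assms(2)] by blast
  with gronwall_energy[of L y y' Q "\<lambda>s. 0" M 0 s] sol2_deriv[OF assms(1)] assms(3-5)
  have "(y s)\<^sup>2 + (y' s)\<^sup>2 \<le> 0" by simp
  then show "y s = 0" "y' s = 0" by (auto simp: sum_power2_le_zero_iff)
qed

lemma sol2_unique:
  assumes "sol2 L Q y y'" "sol2 L Q z z'" "continuous_on {0..L} Q"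
    and "y 0 = z 0" "y' 0 = z' 0" "s \<in> {0..L}"
  shows "y s = z s" "y' s = z' s"
  using sol2_zero[OF sol2_lincomb[OF assms(1,2), of 1 "-1"] assms(3) _ _ assms(6)] assms(4,5)
  by auto

lemma sol2_reverse:
  assumes "sol2 L Q y y'"
  shows "sol2 L (\<lambda>s. Q (L - s)) (\<lambda>s. y (L - s)) (\<lambda>s. - y' (L - s))"
proof -
  have img: "(\<lambda>s. L - s) ` {0..L} = {0..L}" by (auto simp: image_iff intro!: bexI[of _ "L - _"])
  have *: "((\<lambda>s. f (L - s)) has_real_derivative - D) (at s within {0..L})"
    if "(f has_real_derivative D) (at (L - s) within {0..L})" for f D s
  proof -
    have "((\<lambda>s. L - s) has_real_derivative -1) (at s within {0..L})"
      by (auto intro!: derivative_eq_intros)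
    from DERIV_image_chain[of f D "\<lambda>s. L - s" s "{0..L}" "-1", unfolded img, OF that this]
    show ?thesis by (simp add: o_def)
  qed
  show ?thesis unfolding sol2_def
  proof (intro ballI conjI)
    fix s assume s: "s \<in> {0..L}"
    then have s': "L - s \<in> {0..L}" by auto
    show "((\<lambda>s. y (L - s)) has_real_derivative - y' (L - s)) (at s within {0..L})"
      using *[OF sol2_deriv(1)[OF assms s']] .
    show "((\<lambda>s. - y' (L - s)) has_real_derivative Q (L - s) * y (L - s)) (at s within {0..L})"
      using DERIV_minus[OF *[OF sol2_deriv(2)[OF assms s']]] by simp
  qed
qed

text \<open>Obtained by reflecting, cutting the interval off and reflecting back.\<close>

lemma sol2_shift:
  assumes "sol2 L Q y y'" "0 \<le> t"
  shows "sol2 (L - t) (\<lambda>s. Q (t + s)) (\<lambda>s. y (t + s)) (\<lambda>s. y' (t + s))"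
proof -
  have "sol2 (L - t) (\<lambda>s. Q (L - s)) (\<lambda>s. y (L - s)) (\<lambda>s. - y' (L - s))"
    by (rule sol2_subinterval[OF sol2_reverse[OF assms(1)]]) (use assms(2) in simp)
  from sol2_reverse[OF this] show ?thesis by (simp add: algebra_simps)
qed

text \<open>Uniqueness applied backwards from \<open>t\<close>, after a reflection.\<close>

lemma sol2_double_zero:
  assumes y: "sol2 L Q y y'" and Q: "continuous_on {0..L} Q"
    and t: "t \<in> {0..L}" "y t = 0" "y' t = 0"
  shows "y 0 = 0" "y' 0 = 0"
proof -
  have rev: "sol2 t (\<lambda>s. Q (t - s)) (\<lambda>s. y (t - s)) (\<lambda>s. - y' (t - s))"
    by (rule sol2_reverse[OF sol2_subinterval[OF y]]) (use t in auto)
  have Q': "continuous_on {0..t} (\<lambda>s. Q (t - s))"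
    by (rule continuous_on_compose2[OF Q]) (use t in \<open>auto intro!: continuous_intros\<close>)
  from sol2_zero[OF rev Q', of t] t show "y 0 = 0" "y' 0 = 0" by auto
qed

text \<open>The difference \<open>z n - y\<close> has zero initial data and the forcing term
  \<open>(R n - Q) y\<close>, which is of size \<open>e n\<close>.\<close>

lemma sol2_tendsto:
  assumes y: "sol2 L Q y y'" and Q: "continuous_on {0..L} Q"
    and z: "\<And>n. sol2 L (R n) (z n) (z' n)"
    and init: "\<And>n. z n 0 = y 0" "\<And>n. z' n 0 = y' 0"
    and R: "\<And>n s. s \<in> {0..L} \<Longrightarrow> \<bar>R n s - Q s\<bar> \<le> e n" and e: "e \<longlonglongrightarrow> 0"
    and s: "s \<in> {0..L}"
  shows "(\<lambda>n. z n s) \<longlonglongrightarrow> y s" "(\<lambda>n. z' n s) \<longlonglongrightarrow> y' s"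
proof -
  obtain M where M: "\<And>s. s \<in> {0..L} \<Longrightarrow> \<bar>Q s\<bar> \<le> M"
    using continuous_on_Icc_bounded[OF Q] by blast
  obtain B where B: "B \<ge> 0" "\<And>s. s \<in> {0..L} \<Longrightarrow> \<bar>y s\<bar> \<le> B"
    using continuous_on_Icc_bounded[OF sol2_continuous(1)[OF y]] by blast
  have ev: "\<forall>\<^sub>F n in sequentially. e n < 1" using e by (rule order_tendstoD) simp
  have bound: "\<forall>\<^sub>F n in sequentially. (z n s - y s)\<^sup>2 + (z' n s - y' s)\<^sup>2
      \<le> ((e n * B)\<^sup>2 * L) * exp ((M + 1 + 2) * L)"
    using ev
  proof eventually_elim
    case (elim n)
    have "(z n s - y s)\<^sup>2 + (z' n s - y' s)\<^sup>2 \<le>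
       ((z n 0 - y 0)\<^sup>2 + (z' n 0 - y' 0)\<^sup>2 + (e n * B)\<^sup>2 * L) * exp ((M + 1 + 2) * L)"
    proof (rule gronwall_energy[where R = "R n" and g = "\<lambda>s. (R n s - Q s) * y s"])
      fix s assume s: "s \<in> {0..L}"
      show "((\<lambda>s. z n s - y s) has_real_derivative z' n s - y' s) (at s within {0..L})"
        by (intro derivative_intros sol2_deriv[OF y s] sol2_deriv[OF z s])
      show "((\<lambda>s. z' n s - y' s) has_real_derivative R n s * (z n s - y s) + (R n s - Q s) * y s)
          (at s within {0..L})"
        by (rule derivative_eq_intros sol2_deriv[OF y s] sol2_deriv[OF z s])+
          (simp add: algebra_simps)
      show "\<bar>R n s\<bar> \<le> M + 1" using R[OF s, of n] M[OF s] elim by linarith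
      show "\<bar>(R n s - Q s) * y s\<bar> \<le> e n * B"
        unfolding abs_mult using R[OF s, of n] B(2)[OF s] by (intro mult_mono) auto
    qed (rule s)
    then show ?case by (simp add: init)
  qed
  have lim0: "(\<lambda>n. ((e n * B)\<^sup>2 * L) * exp ((M + 1 + 2) * L)) \<longlonglongrightarrow> 0"
    using e by (auto intro!: tendsto_eq_intros)
  have sq: "(\<lambda>n. (z n s - y s)\<^sup>2) \<longlonglongrightarrow> 0" "(\<lambda>n. (z' n s - y' s)\<^sup>2) \<longlonglongrightarrow> 0"
    by (rule tendsto_sandwich[OF _ _ tendsto_const lim0];
        use bound in \<open>auto elim!: eventually_mono intro: order_trans[rotated] simp: add_increasing add_increasing2\<close>)+
  from tendsto_real_sqrt[OF sq(1)] tendsto_real_sqrt[OF sq(2)]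
  show "(\<lambda>n. z n s) \<longlonglongrightarrow> y s" "(\<lambda>n. z' n s) \<longlonglongrightarrow> y' s"
    by (auto simp: tendsto_rabs_zero_iff intro: LIM_zero_cancel)
qed

section \<open>Wronskians and first zeros\<close>

lemma wronskian_deriv:
  assumes "sol2 L P u u'" "sol2 L Q v v'" "s \<in> {0..L}"
  shows "((\<lambda>s. u s * v' s - u' s * v s) has_real_derivative (Q s - P s) * (u s * v s))
    (at s within {0..L})"
  by (rule DERIV_cong[OF DERIV_diff[OF DERIV_mult[OF sol2_deriv(1)[OF assms(1,3)] sol2_deriv(2)[OF assms(2,3)]]
        DERIV_mult[OF sol2_deriv(2)[OF assms(1,3)] sol2_deriv(1)[OF assms(2,3)]]]])
    (simp add: algebra_simps)

text \<open>The factor \<sigma> carries a sign, so one statement covers growth, decay and the case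
  of a sign known only through the two energies.\<close>

lemma wronskian_mono:
  fixes \<sigma> :: real
  assumes u: "sol2 L P u u'" and v: "sol2 L Q v v'" and ab: "0 \<le> a" "a < b" "b \<le> L"
    and pos: "\<And>s. a < s \<Longrightarrow> s < b \<Longrightarrow> (Q s - P s) * (u s * v s) * \<sigma> > 0"
  shows "(u a * v' a - u' a * v a) * \<sigma> < (u b * v' b - u' b * v b) * \<sigma>"
proof (rule DERIV_pos_imp_increasing_open[OF ab(2)])
  have sub: "{a..b} \<subseteq> {0..L}" using ab by auto
  show "continuous_on {a..b} (\<lambda>s. (u s * v' s - u' s * v s) * \<sigma>)"
    by (intro continuous_intros continuous_on_subset[OF _ sub] sol2_continuous[OF u] sol2_continuous[OF v])
  show "\<exists>y. ((\<lambda>s. (u s * v' s - u' s * v s) * \<sigma>) has_real_derivative y) (at s) \<and> 0 < y"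
    if "a < s" "s < b" for s
    using DERIV_cmult_right[OF wronskian_deriv[OF u v, of s], of \<sigma>] that ab pos[OF that]
      at_within_Icc_at[of 0 s L] by auto
qed

lemma wronskian_const:
  assumes u: "sol2 L Q u u'" and v: "sol2 L Q v v'" and s: "s \<in> {0..L}"
  shows "u s * v' s - u' s * v s = u 0 * v' 0 - u' 0 * v 0"
proof (cases "s = 0")
  case False
  show ?thesis
  proof (rule DERIV_isconst2[of 0 L "\<lambda>s. u s * v' s - u' s * v s"])
    show "continuous_on {0..L} (\<lambda>s. u s * v' s - u' s * v s)"
      by (intro continuous_intros sol2_continuous[OF u] sol2_continuous[OF v])
    show "((\<lambda>s. u s * v' s - u' s * v s) has_real_derivative 0) (at x)" if "0 < x" "x < L" for x
      using wronskian_deriv[OF u v, of x] that at_within_Icc_at[of 0 x L] by auto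
  qed (use s False in auto)
qed simp

lemma sol2_pos_near_0:
  assumes u: "sol2 L Q u u'" and L: "0 < L" and init: "u 0 > 0 \<or> (u 0 = 0 \<and> u' 0 > 0)"
  shows "\<exists>d>0. d \<le> L \<and> (\<forall>s. 0 < s \<longrightarrow> s < d \<longrightarrow> u s > 0)"
  using init
proof
  assume u0: "u 0 > 0"
  have "continuous (at 0 within {0..L}) u"
    using sol2_continuous(1)[OF u] L by (simp add: continuous_on_eq_continuous_within)
  then have "(u \<longlongrightarrow> u 0) (at 0 within {0..L})" by (simp add: continuous_within)
  then have "\<forall>\<^sub>F s in at 0 within {0..L}. u s > 0" using u0 by (rule order_tendstoD)
  then obtain d where "d > 0" "\<forall>s\<in>{0..L}. s \<noteq> 0 \<and> dist s 0 < d \<longrightarrow> u s > 0"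
    by (auto simp: eventually_at)
  then show ?thesis using L by (intro exI[of _ "min d L"]) auto
next
  assume u0: "u 0 = 0 \<and> u' 0 > 0"
  from has_real_derivative_pos_inc_right[OF sol2_deriv(1)[OF u, of 0]] u0 L
  obtain d where "d > 0" "\<forall>h>0. 0 + h \<in> {0..L} \<longrightarrow> h < d \<longrightarrow> u 0 < u (0 + h)" by auto
  then show ?thesis using u0 L by (intro exI[of _ "min d L"]) auto
qed

text \<open>The two initial conditions are those of even and odd eigenfunctions. The sign of
  \<open>u' t\<close>, given by positivity to the left, is what enters the Wronskian
  arguments.\<close>

lemma sol2_first_zero:
  assumes u: "sol2 L Q u u'" and init: "u 0 > 0 \<or> (u 0 = 0 \<and> u' 0 > 0)"
    and z: "0 < z" "z \<le> L" "u z \<le> 0"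
  obtains t where "0 < t" "t \<le> z" "u t = 0" "u' t \<le> 0" "\<And>s. 0 < s \<Longrightarrow> s < t \<Longrightarrow> u s > 0"
proof -
  have L: "L > 0" using z by linarith
  obtain d where d: "d > 0" "d \<le> L" "\<And>s. 0 < s \<Longrightarrow> s < d \<Longrightarrow> u s > 0"
    using sol2_pos_near_0[OF u L init] by blast
  have dz: "d \<le> z" using d(3)[of z] z by linarith
  \<comment> \<open>Starting at \<open>d/2\<close> leaves out the point 0, where \<open>u\<close>
    may vanish, and loses nothing because \<open>u\<close> is positive on
    \<open>(0, d)\<close>.\<close>
  define S where "S = {d/2..z} \<inter> u -` {..0}"
  have cont: "continuous_on {d/2..z} u"
    by (rule continuous_on_subset[OF sol2_continuous(1)[OF u]]) (use d z in auto)
  have "closed S" unfolding S_def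
    by (rule continuous_closed_preimage[OF cont]) auto
  moreover have "bounded S" unfolding S_def by (meson bounded_Int bounded_closed_interval)
  ultimately have "compact S" by (simp add: compact_eq_bounded_closed)
  moreover have "z \<in> S" using z dz d by (auto simp: S_def)
  ultimately obtain t where t: "t \<in> S" "\<And>s. s \<in> S \<Longrightarrow> t \<le> s"
    by (metis compact_attains_inf emptyE)
  have tz: "d/2 \<le> t" "t \<le> z" "u t \<le> 0" using t(1) by (auto simp: S_def)
  have pos: "u s > 0" if "0 < s" "s < t" for s
    using t(2)[of s] d(3)[of s] that tz d(1) by (cases "s < d") (force simp: S_def not_less)+
  have t0: "0 < t" using tz d by linarith
  have contt: "(u \<longlongrightarrow> u t) (at t within {0..L})"
    using sol2_continuous(1)[OF u] t0 tz z by (simp add: continuous_on_def)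
  have zero: "u t = 0"
  proof (rule ccontr)
    assume "u t \<noteq> 0"
    then have "u t < 0" using tz by simp
    from order_tendstoD(2)[OF contt this]
    obtain e where e: "e > 0" "\<forall>s\<in>{0..L}. s \<noteq> t \<and> dist s t < e \<longrightarrow> u s < 0" by (auto simp: eventually_at)
    define s where "s = max (t/2) (t - e/2)"
    have "0 < s" "s < t" "dist s t < e" using t0 e(1) by (auto simp: s_def dist_real_def)
    then show False using pos[of s] e(2) tz z by force
  qed
  moreover have "u' t \<le> 0"
  proof (rule ccontr)
    assume "\<not> u' t \<le> 0"
    then have "u' t > 0" by simp
    from has_real_derivative_pos_inc_left[OF sol2_deriv(1)[OF u, of t] this] t0 tz z
    obtain e where e: "e > 0" "\<forall>h>0. t - h \<in> {0..L} \<longrightarrow> h < e \<longrightarrow> u (t - h) < u t" by auto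
    define h where "h = min (t/2) (e/2)"
    have "0 < h" "h < t" "h < e" using t0 e(1) by (auto simp: h_def)
    then have "u (t - h) < u t" using e(2) tz z by auto
    then show False using pos[of "t - h"] zero \<open>0 < h\<close> \<open>h < t\<close> by auto
  qed
  ultimately show thesis using that t0 tz pos by blast
qed

section \<open>Weak derivatives on intervals\<close>

text \<open>The branches are continuous up to the break point \<open>b\<close> while
  \<open>f\<close> is prescribed only off it; \<open>b\<close> may or may not belong to
  \<open>U\<close>. This covers the domains \<open>(-L, L)\<close>, \<open>(-L, L) - {0}\<close> and
  \<open>(0, 2L)\<close> of the operator alike.\<close>

definition piecewise_continuous ::
  "real \<Rightarrow> real \<Rightarrow> real \<Rightarrow> real set \<Rightarrow> (real \<Rightarrow> 'b::euclidean_space) \<Rightarrow> (real \<Rightarrow> 'b) \<Rightarrow> (real \<Rightarrow> 'b) \<Rightarrow> bool" where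
  "piecewise_continuous a b c U f f1 f2 \<longleftrightarrow>
     a < b \<and> b < c \<and> (U = {a<..<c} \<or> U = {a<..<c} - {b}) \<and>
     continuous_on {a..b} f1 \<and> continuous_on {b..c} f2 \<and>
     (\<forall>x. a < x \<longrightarrow> x < b \<longrightarrow> f x = f1 x) \<and> (\<forall>x. b < x \<longrightarrow> x < c \<longrightarrow> f x = f2 x)"

lemma piecewise_integral:
  assumes "piecewise_continuous a b c U f f1 f2"
  shows "integrable (lebesgue_on U) f"
    and "integral\<^sup>L (lebesgue_on U) f = integral {a..b} f1 + integral {b..c} f2"
proof -
  have ab: "a < b" "b < c" and U: "U = {a<..<c} \<or> U = {a<..<c} - {b}"
    and f1: "continuous_on {a..b} f1" and f2: "continuous_on {b..c} f2"
    and eq1: "\<And>x. a < x \<Longrightarrow> x < b \<Longrightarrow> f x = f1 x" and eq2: "\<And>x. b < x \<Longrightarrow> x < c \<Longrightarrow> f x = f2 x"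
    using assms by (auto simp: piecewise_continuous_def)
  have Us: "U \<in> sets lebesgue" using U by auto
  have 1: "f absolutely_integrable_on {a..b}"
    by (rule absolutely_integrable_spike[OF absolutely_integrable_continuous_real[OF f1], of "{a, b}"])
      (auto simp: eq1)
  have 2: "f absolutely_integrable_on {b..c}"
    by (rule absolutely_integrable_spike[OF absolutely_integrable_continuous_real[OF f2], of "{b, c}"])
      (auto simp: eq2)
  have "{a..b} \<union> {b..c} = {a..c}" using ab by auto
  with absolutely_integrable_Un[OF 1 2] have 3: "f absolutely_integrable_on {a..c}" by simp
  have "f absolutely_integrable_on U"
    by (rule set_integrable_subset[OF 3 Us]) (use U in auto)
  then show int: "integrable (lebesgue_on U) f" using Us by (rule absolutely_integrable_imp_integrable)
  have "(f has_integral integral {a..b} f1) {a..b}"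
    by (rule has_integral_spike_finite[OF _ _ integrable_integral[OF integrable_continuous_real[OF f1]], of "{a, b}"])
      (auto simp: eq1)
  moreover have "(f has_integral integral {b..c} f2) {b..c}"
    by (rule has_integral_spike_finite[OF _ _ integrable_integral[OF integrable_continuous_real[OF f2]], of "{b, c}"])
      (auto simp: eq2)
  ultimately have "(f has_integral (integral {a..b} f1 + integral {b..c} f2)) {a..c}"
    using ab by (intro has_integral_combine[of a b c]) auto
  moreover have "(f has_integral y) {a..c} \<longleftrightarrow> (f has_integral y) U" for y
    by (rule has_integral_spike_set_eq; rule negligible_subset[OF negligible_finite[of "{a, b, c}"]])
      (use U in auto)
  ultimately have "(f has_integral (integral {a..b} f1 + integral {b..c} f2)) U" by simp
  then show "integral\<^sup>L (lebesgue_on U) f = integral {a..b} f1 + integral {b..c} f2"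
    using lebesgue_integral_eq_integral[OF int Us] by (simp add: integral_unique)
qed

lemma piecewise_L2:
  fixes f :: "real \<Rightarrow> complex"
  assumes "piecewise_continuous a b c U f f1 f2"
  shows "f \<in> L2_on U"
proof -
  have "piecewise_continuous a b c U (\<lambda>x. (cmod (f x))\<^sup>2) (\<lambda>x. (cmod (f1 x))\<^sup>2) (\<lambda>x. (cmod (f2 x))\<^sup>2)"
    using assms by (auto simp: piecewise_continuous_def intro!: continuous_intros)
  then show ?thesis
    using piecewise_integral(1)[OF assms] piecewise_integral(1)
    by (auto simp: L2_on_def)
qed

lemma test_functionD:
  assumes "test_function U \<psi>"
  shows "(\<psi> has_real_derivative deriv \<psi> x) (at x within S)" "continuous_on S \<psi>" "continuous_on S (deriv \<psi>)"
    "x \<notin> U \<Longrightarrow> \<psi> x = 0"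
proof -
  have d: "(\<psi> has_real_derivative deriv \<psi> x) (at x)" for x
    using assms by (simp add: test_function_def DERIV_deriv_iff_real_differentiable)
  then show "(\<psi> has_real_derivative deriv \<psi> x) (at x within S)" by (rule has_field_derivative_at_within)
  show "continuous_on S \<psi>" using d by (meson DERIV_isCont continuous_at_imp_continuous_on)
  show "continuous_on S (deriv \<psi>)" "x \<notin> U \<Longrightarrow> \<psi> x = 0"
    using assms by (auto simp: test_function_def intro: continuous_on_subset)
qed

text \<open>Integration by parts on both pieces. The boundary terms at \<open>a\<close> and
  \<open>c\<close> vanish with the test function; those at \<open>b\<close> cancel if the branches
  match, and vanish if \<open>b\<close> is outside \<open>U\<close>.\<close>

lemma weak_derivative_piecewise:
  fixes f g :: "real \<Rightarrow> complex"
  assumes f: "piecewise_continuous a b c U f f1 f2" and g: "piecewise_continuous a b c U g g1 g2"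
    and d1: "\<And>x. x \<in> {a..b} \<Longrightarrow> (f1 has_vector_derivative g1 x) (at x within {a..b})"
    and d2: "\<And>x. x \<in> {b..c} \<Longrightarrow> (f2 has_vector_derivative g2 x) (at x within {b..c})"
    and b: "b \<in> U \<Longrightarrow> f1 b = f2 b"
  shows "weak_derivative U f g"
  unfolding weak_derivative_def
proof (intro allI impI)
  fix \<psi> assume \<psi>: "test_function U \<psi>"
  note T = test_functionD[OF \<psi>]
  have ab: "a < b" "b < c" and U: "a \<notin> U" "c \<notin> U"
    and cont: "continuous_on {a..b} f1" "continuous_on {b..c} f2" "continuous_on {a..b} g1" "continuous_on {b..c} g2"
    using f g by (auto simp: piecewise_continuous_def)
  have p1: "piecewise_continuous a b c U (\<lambda>x. deriv \<psi> x *\<^sub>R f x) (\<lambda>x. deriv \<psi> x *\<^sub>R f1 x) (\<lambda>x. deriv \<psi> x *\<^sub>R f2 x)"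
    using f T(3) by (auto simp: piecewise_continuous_def intro!: continuous_intros)
  have p2: "piecewise_continuous a b c U (\<lambda>x. \<psi> x *\<^sub>R g x) (\<lambda>x. \<psi> x *\<^sub>R g1 x) (\<lambda>x. \<psi> x *\<^sub>R g2 x)"
    using g T(2) by (auto simp: piecewise_continuous_def intro!: continuous_intros)
  have parts: "integral {p..q} (\<lambda>x. deriv \<psi> x *\<^sub>R F x) + integral {p..q} (\<lambda>x. \<psi> x *\<^sub>R G x)
      = \<psi> q *\<^sub>R F q - \<psi> p *\<^sub>R F p"
    if "p < q" "continuous_on {p..q} F" "continuous_on {p..q} G"
      "\<And>x. x \<in> {p..q} \<Longrightarrow> (F has_vector_derivative G x) (at x within {p..q})" for p q and F G :: "real \<Rightarrow> complex"
  proof -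
    have "((\<lambda>x. deriv \<psi> x *\<^sub>R F x + \<psi> x *\<^sub>R G x) has_integral \<psi> q *\<^sub>R F q - \<psi> p *\<^sub>R F p) {p..q}"
    proof (rule fundamental_theorem_of_calculus)
      fix x assume "x \<in> {p..q}"
      from has_vector_derivative_scaleR[OF T(1) that(4)[OF this]]
      show "((\<lambda>x. \<psi> x *\<^sub>R F x) has_vector_derivative deriv \<psi> x *\<^sub>R F x + \<psi> x *\<^sub>R G x) (at x within {p..q})"
        by (simp add: add.commute)
    qed (use that in simp)
    moreover have "(\<lambda>x. deriv \<psi> x *\<^sub>R F x) integrable_on {p..q}" "(\<lambda>x. \<psi> x *\<^sub>R G x) integrable_on {p..q}"
      using that T by (auto intro!: integrable_continuous_real continuous_intros)
    ultimately show ?thesis by (simp add: integral_unique flip: integral_add)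
  qed
  have "\<psi> b *\<^sub>R f1 b = \<psi> b *\<^sub>R f2 b" using T(4)[of b] b by (cases "b \<in> U") auto
  then have "(integral {a..b} (\<lambda>x. deriv \<psi> x *\<^sub>R f1 x) + integral {b..c} (\<lambda>x. deriv \<psi> x *\<^sub>R f2 x)) +
     (integral {a..b} (\<lambda>x. \<psi> x *\<^sub>R g1 x) + integral {b..c} (\<lambda>x. \<psi> x *\<^sub>R g2 x)) = 0"
    using parts[OF ab(1) cont(1,3) d1] parts[OF ab(2) cont(2,4) d2] T(4)[OF U(1)] T(4)[OF U(2)]
    by (simp add: algebra_simps)
  then show "(\<integral>x. deriv \<psi> x *\<^sub>R f x \<partial>lebesgue_on U) = - (\<integral>x. \<psi> x *\<^sub>R g x \<partial>lebesgue_on U)"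
    unfolding piecewise_integral(2)[OF p1] piecewise_integral(2)[OF p2]
    by (rule eq_neg_iff_add_eq_0[THEN iffD2])
qed

text \<open>A continuous distribution with vanishing second derivative is affine: the test function is
  chosen with \<open>\<psi>'' = \<rho> (g - l)\<close>, where \<open>l\<close> is the affine function closest to \<open>g\<close> in the \<open>L\<^sup>2\<close> space with
  weight \<open>\<rho>\<close>.\<close>

lemma weakly_affine:
  fixes g :: "real \<Rightarrow> real"
  assumes ab: "a < \<alpha>" "\<alpha> < \<beta>" "\<beta> < b" and g: "continuous_on {a..b} g"
    and orth: "\<And>\<psi>. test_function {a<..<b} \<psi> \<Longrightarrow> test_function {a<..<b} (deriv \<psi>) \<Longrightarrow>
        continuous_on UNIV (deriv (deriv \<psi>)) \<Longrightarrow> integral {a..b} (\<lambda>x. deriv (deriv \<psi>) x * g x) = 0"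
  shows "\<exists>A B. \<forall>x\<in>{\<alpha><..<\<beta>}. g x = A + B * x"
proof -
  define I where "I f = integral {a..b} f" for f :: "real \<Rightarrow> real"
  \<comment> \<open>A continuous weight, positive on \<open>(\<alpha>, \<beta>)\<close> and 0
    elsewhere: the test function inherits its compact support from it.\<close>
  define \<rho> where "\<rho> x = max 0 ((x - \<alpha>) * (\<beta> - x))" for x
  \<comment> \<open>\<open>g\<close> is continuous on \<open>[a, b]\<close> only. Freezing its
    argument outside \<open>[\<alpha>, \<beta>]\<close> makes it continuous on the line without
    change where \<rho> is positive.\<close>
  define h where "h x = g (max \<alpha> (min \<beta> x))" for x
  have \<rho>_cont: "continuous_on S \<rho>" for S unfolding \<rho>_def by (intro continuous_intros)
  have h_cont: "continuous_on S h" for S unfolding h_def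
    by (rule continuous_on_compose2[OF g]) (use ab in \<open>auto intro!: continuous_intros\<close>)
  have \<rho>_nn: "\<rho> x \<ge> 0" for x by (simp add: \<rho>_def)
  have \<rho>_pos: "\<rho> x > 0" if "\<alpha> < x" "x < \<beta>" for x using that by (simp add: \<rho>_def)
  have \<rho>_0: "\<rho> x = 0" if "x \<le> \<alpha> \<or> \<beta> \<le> x" for x
  proof -
    have "(x - \<alpha>) * (\<beta> - x) \<le> 0"
      using that ab by (auto intro: mult_nonpos_nonneg mult_nonneg_nonpos)
    then show ?thesis by (simp add: \<rho>_def)
  qed
  have \<rho>_h: "\<rho> x * g x = \<rho> x * h x" for x
    using \<rho>_0[of x] by (cases "x \<le> \<alpha> \<or> \<beta> \<le> x") (auto simp: h_def)
  have int: "f integrable_on {a..b}" if "continuous_on {a..b} f" for f :: "real \<Rightarrow> real"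
    by (rule integrable_continuous_real[OF that])
  have I_add: "I (\<lambda>x. f x + k x) = I f + I k" if "continuous_on {a..b} f" "continuous_on {a..b} k" for f k
    unfolding I_def by (rule integral_add[OF int[OF that(1)] int[OF that(2)]])
  have I_diff: "I (\<lambda>x. f x - k x) = I f - I k" if "continuous_on {a..b} f" "continuous_on {a..b} k" for f k
    unfolding I_def by (rule integral_diff[OF int[OF that(1)] int[OF that(2)]])
  have I_mult: "I (\<lambda>x. r * f x) = r * I f" for f r unfolding I_def by simp
  have I_0: "f x = 0" if "continuous_on {a..b} f" "\<And>x. f x \<ge> 0" "I f = 0" "x \<in> {a..b}" for f x
    using integral_eq_0_iff[of a b f] that ab by (auto simp: I_def)
  have I_nn: "I f \<ge> 0" if "continuous_on {a..b} f" "\<And>x. f x \<ge> 0" for f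
    unfolding I_def by (rule integral_nonneg[OF int]) (use that in auto)
  define m0 where "m0 = I \<rho>"
  \<comment> \<open>The centre of mass of \<rho>: it makes 1 and \<open>x - c\<close> orthogonal in
    the weighted space, so the two coefficients of the projection decouple.\<close>
  define c where "c = I (\<lambda>x. x * \<rho> x) / m0"
  define m2 where "m2 = I (\<lambda>x. (x - c)\<^sup>2 * \<rho> x)"
  have mid: "\<alpha> < x \<Longrightarrow> x < \<beta> \<Longrightarrow> x \<in> {a..b}" for x using ab by auto
  have m0: "m0 \<noteq> 0"
  proof
    assume "m0 = 0"
    then have "\<rho> ((\<alpha> + \<beta>) / 2) = 0"
      using I_0[OF \<rho>_cont \<rho>_nn, of "(\<alpha> + \<beta>) / 2"] mid[of "(\<alpha> + \<beta>) / 2"] ab by (simp add: m0_def)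
    then show False using \<rho>_pos[of "(\<alpha> + \<beta>) / 2"] ab by simp
  qed
  have m2: "m2 \<noteq> 0"
  proof
    assume "m2 = 0"
    have cont: "continuous_on {a..b} (\<lambda>x. (x - c)\<^sup>2 * \<rho> x)" by (intro continuous_intros \<rho>_cont)
    have *: "(x - c)\<^sup>2 * \<rho> x = 0" if "\<alpha> < x" "x < \<beta>" for x
      by (rule I_0[OF cont _ _ mid[OF that]]) (use \<open>m2 = 0\<close> \<rho>_nn in \<open>auto simp: m2_def\<close>)
    have "(2 * \<alpha> + \<beta>) / 3 = c" "(\<alpha> + 2 * \<beta>) / 3 = c"
      using *[of "(2 * \<alpha> + \<beta>) / 3"] *[of "(\<alpha> + 2 * \<beta>) / 3"] \<rho>_pos[of "(2 * \<alpha> + \<beta>) / 3"]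
        \<rho>_pos[of "(\<alpha> + 2 * \<beta>) / 3"] ab by (auto simp: field_simps)
    then show False using ab by simp
  qed
  have X0: "I (\<lambda>x. (x - c) * \<rho> x) = 0"
  proof -
    have "I (\<lambda>x. (x - c) * \<rho> x) = I (\<lambda>x. x * \<rho> x - c * \<rho> x)" by (simp add: algebra_simps)
    also have "\<dots> = I (\<lambda>x. x * \<rho> x) - c * m0"
      by (subst I_diff) (auto intro!: continuous_intros \<rho>_cont simp: I_mult m0_def)
    finally show ?thesis using m0 by (simp add: c_def)
  qed
  define A where "A = I (\<lambda>x. \<rho> x * h x) / m0"
  define B where "B = I (\<lambda>x. (x - c) * (\<rho> x * h x)) / m2"
  \<comment> \<open>The future second derivative of the test function. Its orthogonality to 1 and to
    \<open>x - c\<close> makes first the slope and then the value vanish again beyond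
    \<beta>.\<close>
  define \<kappa> where "\<kappa> x = \<rho> x * (h x - (A + B * (x - c)))" for x
  have \<kappa>_cont: "continuous_on S \<kappa>" for S
    unfolding \<kappa>_def by (intro continuous_intros \<rho>_cont h_cont)
  have I\<kappa>: "I \<kappa> = 0"
  proof -
    have "I \<kappa> = I (\<lambda>x. \<rho> x * h x - (A * \<rho> x + B * ((x - c) * \<rho> x)))"
      unfolding \<kappa>_def by (simp add: algebra_simps)
    also have "\<dots> = I (\<lambda>x. \<rho> x * h x) - (A * m0 + B * I (\<lambda>x. (x - c) * \<rho> x))"
      by (subst I_diff, intro continuous_intros \<rho>_cont h_cont, intro continuous_intros \<rho>_cont,
          subst I_add, intro continuous_intros \<rho>_cont, intro continuous_intros \<rho>_cont) (simp add: I_mult m0_def)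
    finally show ?thesis using m0 by (simp add: A_def X0)
  qed
  have I\<kappa>X: "I (\<lambda>x. (x - c) * \<kappa> x) = 0"
  proof -
    have "I (\<lambda>x. (x - c) * \<kappa> x) = I (\<lambda>x. (x - c) * (\<rho> x * h x) - (A * ((x - c) * \<rho> x) + B * ((x - c)\<^sup>2 * \<rho> x)))"
      unfolding \<kappa>_def by (simp add: algebra_simps power2_eq_square)
    also have "\<dots> = I (\<lambda>x. (x - c) * (\<rho> x * h x)) - (A * I (\<lambda>x. (x - c) * \<rho> x) + B * m2)"
      by (subst I_diff, intro continuous_intros \<rho>_cont h_cont, intro continuous_intros \<rho>_cont,
          subst I_add, intro continuous_intros \<rho>_cont, intro continuous_intros \<rho>_cont) (simp add: I_mult m2_def)
    finally show ?thesis using m2 by (simp add: B_def X0)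
  qed
  have anti: "\<exists>F. (\<forall>x. (F has_real_derivative f x) (at x)) \<and> F \<alpha> = 0"
    if "continuous_on UNIV f" for f :: "real \<Rightarrow> real"
  proof -
    have "isCont f x" for x using that by (simp add: continuous_on_eq_continuous_at)
    then obtain F where "\<And>x. (F has_vector_derivative f x) (at x)"
      using einterval_antiderivative[of "-\<infinity>" "\<infinity>" f] by auto
    then show ?thesis
      by (intro exI[of _ "\<lambda>x. F x - F \<alpha>"])
        (auto intro!: derivative_eq_intros simp: has_real_derivative_iff_has_vector_derivative)
  qed
  obtain \<psi>1 where \<psi>1: "\<And>x. (\<psi>1 has_real_derivative \<kappa> x) (at x)" "\<psi>1 \<alpha> = 0"
    using anti[OF \<kappa>_cont] by blast
  have \<psi>1_cont: "continuous_on S \<psi>1" for S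
    using \<psi>1(1) by (meson DERIV_isCont continuous_at_imp_continuous_on)
  obtain \<psi> where \<psi>: "\<And>x. (\<psi> has_real_derivative \<psi>1 x) (at x)" "\<psi> \<alpha> = 0"
    using anti[OF \<psi>1_cont] by blast
  have const: "F x = F y" if F: "\<And>z. (F has_real_derivative f z) (at z)" and f: "\<And>z. min x y \<le> z \<Longrightarrow> z \<le> max x y \<Longrightarrow> f z = 0"
    for F f :: "real \<Rightarrow> real" and x y
  proof -
    have *: "F q = F p" if pq: "p \<le> q" "\<And>z. p \<le> z \<Longrightarrow> z \<le> q \<Longrightarrow> f z = 0" for p q
    proof (cases "p = q")
      case False
      show ?thesis
      proof (rule DERIV_isconst2[of p q F])
        show "continuous_on {p..q} F" using F by (meson DERIV_isCont continuous_at_imp_continuous_on)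
        show "(F has_real_derivative 0) (at x)" if "p < x" "x < q" for x
          using F[of x] pq(2)[of x] that by simp
      qed (use pq False in auto)
    qed simp
    show ?thesis
      using *[of x y] *[of y x] f by (cases "x \<le> y") (auto simp: min_def max_def)
  qed
  have FTC: "I f = F b - F a" if "\<And>z. (F has_real_derivative f z) (at z)" for F f
    unfolding I_def
    by (intro integral_unique fundamental_theorem_of_calculus)
      (use ab that in \<open>auto simp: has_real_derivative_iff_has_vector_derivative intro: has_vector_derivative_at_within\<close>)
  have \<kappa>_0: "\<kappa> x = 0" if "x \<le> \<alpha> \<or> \<beta> \<le> x" for x using \<rho>_0[OF that] by (simp add: \<kappa>_def)
  have \<psi>1_l: "\<psi>1 x = 0" if "x \<le> \<alpha>" for x
    using const[OF \<psi>1(1), of x \<alpha>] \<psi>1(2) \<kappa>_0 that by simp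
  have \<psi>1_b: "\<psi>1 b = 0" using FTC[OF \<psi>1(1)] I\<kappa> \<psi>1_l[of a] ab by simp
  have \<psi>1_r: "\<psi>1 x = 0" if "\<beta> \<le> x" for x
  proof -
    have "\<kappa> z = 0" if "min x b \<le> z" for z
      using \<kappa>_0[of z] that \<open>\<beta> \<le> x\<close> ab by (auto simp: min_le_iff_disj)
    then show ?thesis using const[OF \<psi>1(1), of x b] \<psi>1_b by simp
  qed
  have \<psi>_l: "\<psi> x = 0" if "x \<le> \<alpha>" for x
    using const[OF \<psi>(1), of x \<alpha>] \<psi>(2) \<psi>1_l that by simp
  \<comment> \<open>A primitive of \<open>(x - c) \<kappa>\<close>: the vanishing first moment
    becomes \<open>\<psi> b = 0\<close>.\<close>
  have "((\<lambda>x. (x - c) * \<psi>1 x - \<psi> x) has_real_derivative (x - c) * \<kappa> x) (at x)" for x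
    by (rule derivative_eq_intros \<psi>1 \<psi> refl | simp)+
  from FTC[OF this] I\<kappa>X have \<psi>_b: "\<psi> b = 0" using \<psi>1_b \<psi>1_l[of a] \<psi>_l[of a] ab by simp
  have \<psi>_r: "\<psi> x = 0" if "\<beta> \<le> x" for x
  proof -
    have "\<psi>1 z = 0" if "min x b \<le> z" for z
      using \<psi>1_r[of z] that \<open>\<beta> \<le> x\<close> ab by (auto simp: min_le_iff_disj)
    then show ?thesis using const[OF \<psi>(1), of x b] \<psi>_b by simp
  qed
  have d\<psi>: "deriv \<psi> = \<psi>1" "deriv \<psi>1 = \<kappa>" using \<psi>(1) \<psi>1(1) by (auto intro!: DERIV_imp_deriv)
  have "test_function {a<..<b} \<psi>" "test_function {a<..<b} (deriv \<psi>)"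
    unfolding test_function_def d\<psi>
    using \<psi>(1) \<psi>1(1) \<psi>1_cont \<kappa>_cont \<psi>_l \<psi>_r \<psi>1_l \<psi>1_r ab
    by (auto intro!: exI[of _ "{\<alpha>..\<beta>}"] simp: real_differentiable_def not_le less_imp_le)
  from orth[OF this] have "I (\<lambda>x. \<kappa> x * g x) = 0" by (simp add: d\<psi> \<kappa>_cont I_def)
  moreover have "\<kappa> x * g x = \<kappa> x * h x" for x
    using \<rho>_h[of x] by (auto simp: \<kappa>_def)
  ultimately have I1: "I (\<lambda>x. \<kappa> x * h x) = 0" by simp
  \<comment> \<open>The squared weighted distance of \<open>h\<close> from the affine function; it
    equals the integral of \<open>\<kappa> h\<close> by orthogonality.\<close>
  have "I (\<lambda>x. \<rho> x * (h x - (A + B * (x - c)))\<^sup>2) = I (\<lambda>x. \<kappa> x * h x - (A * \<kappa> x + B * ((x - c) * \<kappa> x)))"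
    unfolding \<kappa>_def by (simp add: algebra_simps power2_eq_square)
  also have "\<dots> = I (\<lambda>x. \<kappa> x * h x) - (A * I \<kappa> + B * I (\<lambda>x. (x - c) * \<kappa> x))"
    by (subst I_diff, intro continuous_intros \<kappa>_cont h_cont, intro continuous_intros \<kappa>_cont,
        subst I_add, intro continuous_intros \<kappa>_cont, intro continuous_intros \<kappa>_cont) (simp add: I_mult)
  finally have I2: "I (\<lambda>x. \<rho> x * (h x - (A + B * (x - c)))\<^sup>2) = 0" by (simp add: I1 I\<kappa> I\<kappa>X)
  have "g x = (A - B * c) + B * x" if x: "\<alpha> < x" "x < \<beta>" for x
  proof -
    have "\<rho> x * (h x - (A + B * (x - c)))\<^sup>2 = 0"
      by (rule I_0[OF _ _ I2 mid[OF x]]) (auto intro!: continuous_intros \<rho>_cont h_cont simp: \<rho>_nn)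
    then have "h x = A + B * (x - c)" using \<rho>_pos[OF x] by simp
    moreover have "h x = g x" using x by (simp add: h_def)
    ultimately show ?thesis by (simp add: algebra_simps)
  qed
  then show ?thesis by (intro exI[of _ "A - B * c"] exI[of _ B]) auto
qed

text \<open>Subtracting a classical double primitive \<open>H\<close> of \<open>h\<close> leaves a
  continuous function whose second weak derivative is 0, hence an affine one on compact
  subintervals. The intermediate \<zeta>\<open_dummy>\<close>

lemma weak_second_derivative_regular:
  fixes \<zeta> h :: "real \<Rightarrow> complex"
  assumes ab: "a < b" and \<zeta>: "continuous_on {a..b} \<zeta>" and h: "continuous_on {a..b} h"
    and w1: "weak_derivative {a<..<b} \<zeta> \<zeta>\<^sub>1" and w2: "weak_derivative {a<..<b} \<zeta>\<^sub>1 \<zeta>\<^sub>2"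
    and m: "\<zeta>\<^sub>2 \<in> borel_measurable (lebesgue_on {a<..<b})"
    and ae: "AE x in lebesgue_on {a<..<b}. \<zeta>\<^sub>2 x = h x"
  shows "\<exists>\<zeta>'. \<forall>x. a < x \<longrightarrow> x < b \<longrightarrow>
    (\<zeta> has_vector_derivative \<zeta>' x) (at x) \<and> (\<zeta>' has_vector_derivative h x) (at x)"
proof -
  let ?U = "{a<..<b}"
  define p where "p = (a + b) / 2"
  have p: "a < p" "p < b" using ab by (auto simp: p_def)
  have pw: "piecewise_continuous a p b ?U f f f" if "continuous_on {a..b} f" for f :: "real \<Rightarrow> complex"
    using that p by (auto simp: piecewise_continuous_def intro: continuous_on_subset)
  have split: "integral {a..p} f + integral {p..b} f = integral {a..b} f" if "continuous_on {a..b} f" for f :: "real \<Rightarrow> complex"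
    using that p by (intro Henstock_Kurzweil_Integration.integral_combine integrable_continuous_real) auto
  have leb: "integral\<^sup>L (lebesgue_on ?U) f = integral {a..b} f" if "continuous_on {a..b} f" for f :: "real \<Rightarrow> complex"
    using piecewise_integral(2)[OF pw[OF that]] split[OF that] by simp
  obtain H' where H': "\<And>x. x \<in> {a..b} \<Longrightarrow> (H' has_vector_derivative h x) (at x within {a..b})"
    using antiderivative_continuous[OF h] by blast
  have H'_cont: "continuous_on {a..b} H'"
    using H' by (meson has_vector_derivative_continuous continuous_on_eq_continuous_within)
  obtain H where H: "\<And>x. x \<in> {a..b} \<Longrightarrow> (H has_vector_derivative H' x) (at x within {a..b})"
    using antiderivative_continuous[OF H'_cont] by blast
  have H_cont: "continuous_on {a..b} H"
    using H by (meson has_vector_derivative_continuous continuous_on_eq_continuous_within)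
  have wk: "weak_derivative ?U F G"
    if F: "\<And>x. x \<in> {a..b} \<Longrightarrow> (F has_vector_derivative G x) (at x within {a..b})"
      and cont: "continuous_on {a..b} F" "continuous_on {a..b} G" for F G :: "real \<Rightarrow> complex"
    by (rule weak_derivative_piecewise[OF pw[OF cont(1)] pw[OF cont(2)]])
      (use p in \<open>auto intro: has_vector_derivative_within_subset[OF F]\<close>)
  define g where "g x = \<zeta> x - H x" for x
  have g_cont: "continuous_on {a..b} g" unfolding g_def by (intro continuous_intros \<zeta> H_cont)
  have orth: "integral {a..b} (\<lambda>x. deriv (deriv \<psi>) x *\<^sub>R g x) = 0"
    if \<psi>: "test_function ?U \<psi>" "test_function ?U (deriv \<psi>)" "continuous_on UNIV (deriv (deriv \<psi>))" for \<psi>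
  proof -
    have c2: "continuous_on {a..b} (\<lambda>x. deriv (deriv \<psi>) x *\<^sub>R F x)" if "continuous_on {a..b} F" for F :: "real \<Rightarrow> complex"
      using continuous_on_subset[OF \<psi>(3)] that by (intro continuous_intros) auto
    have "(\<integral>x. deriv (deriv \<psi>) x *\<^sub>R \<zeta> x \<partial>lebesgue_on ?U) = (\<integral>x. \<psi> x *\<^sub>R \<zeta>\<^sub>2 x \<partial>lebesgue_on ?U)"
      using w1 w2 \<psi> by (simp add: weak_derivative_def)
    also have "\<dots> = (\<integral>x. \<psi> x *\<^sub>R h x \<partial>lebesgue_on ?U)"
    proof (rule integral_cong_AE)
      have \<psi>m: "\<psi> \<in> borel_measurable (lebesgue_on ?U)"
        by (rule continuous_imp_measurable_on_sets_lebesgue[OF test_functionD(2)[OF \<psi>(1)]]) simp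
      have hm: "h \<in> borel_measurable (lebesgue_on ?U)"
        by (rule continuous_imp_measurable_on_sets_lebesgue) (auto intro: continuous_on_subset[OF h])
      show "(\<lambda>x. \<psi> x *\<^sub>R \<zeta>\<^sub>2 x) \<in> borel_measurable (lebesgue_on ?U)"
        "(\<lambda>x. \<psi> x *\<^sub>R h x) \<in> borel_measurable (lebesgue_on ?U)"
        by (intro borel_measurable_scaleR \<psi>m m hm)+
      show "AE x in lebesgue_on ?U. \<psi> x *\<^sub>R \<zeta>\<^sub>2 x = \<psi> x *\<^sub>R h x" using ae by eventually_elim simp
    qed
    also have "\<dots> = (\<integral>x. deriv (deriv \<psi>) x *\<^sub>R H x \<partial>lebesgue_on ?U)"
      using wk[OF H H_cont H'_cont] wk[OF H' H'_cont h] \<psi> by (simp add: weak_derivative_def)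
    finally have "integral {a..b} (\<lambda>x. deriv (deriv \<psi>) x *\<^sub>R \<zeta> x) = integral {a..b} (\<lambda>x. deriv (deriv \<psi>) x *\<^sub>R H x)"
      unfolding leb[OF c2[OF \<zeta>]] leb[OF c2[OF H_cont]] .
    then show ?thesis unfolding g_def scaleR_diff_right
      by (subst integral_diff) (auto intro!: integrable_continuous_real c2 \<zeta> H_cont)
  qed
  have aff: "\<exists>A B. \<forall>x\<in>{\<alpha><..<\<beta>}. g x = A + of_real x * B" if "a < \<alpha>" "\<alpha> < \<beta>" "\<beta> < b" for \<alpha> \<beta>
  proof -
    have int: "(\<lambda>x. deriv (deriv \<psi>) x *\<^sub>R g x) integrable_on {a..b}" if "continuous_on UNIV (deriv (deriv \<psi>))" for \<psi> :: "real \<Rightarrow> real"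
      using continuous_on_subset[OF that] g_cont by (intro integrable_continuous_real continuous_intros) auto
    have "\<exists>A B. \<forall>x\<in>{\<alpha><..<\<beta>}. Re (g x) = A + B * x"
    proof (rule weakly_affine[OF that])
      show "continuous_on {a..b} (\<lambda>x. Re (g x))" by (intro continuous_intros g_cont)
      fix \<psi> assume \<psi>: "test_function ?U \<psi>" "test_function ?U (deriv \<psi>)" "continuous_on UNIV (deriv (deriv \<psi>))"
      show "integral {a..b} (\<lambda>x. deriv (deriv \<psi>) x * Re (g x)) = 0"
        using integral_linear[OF int[OF \<psi>(3)] bounded_linear_Re] orth[OF \<psi>] by (simp add: o_def)
    qed
    moreover have "\<exists>A B. \<forall>x\<in>{\<alpha><..<\<beta>}. Im (g x) = A + B * x"
    proof (rule weakly_affine[OF that])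
      show "continuous_on {a..b} (\<lambda>x. Im (g x))" by (intro continuous_intros g_cont)
      fix \<psi> assume \<psi>: "test_function ?U \<psi>" "test_function ?U (deriv \<psi>)" "continuous_on UNIV (deriv (deriv \<psi>))"
      show "integral {a..b} (\<lambda>x. deriv (deriv \<psi>) x * Im (g x)) = 0"
        using integral_linear[OF int[OF \<psi>(3)] bounded_linear_Im] orth[OF \<psi>] by (simp add: o_def)
    qed
    ultimately obtain A B C D where "\<And>x. x \<in> {\<alpha><..<\<beta>} \<Longrightarrow> Re (g x) = A + B * x" "\<And>x. x \<in> {\<alpha><..<\<beta>} \<Longrightarrow> Im (g x) = C + D * x"
      by blast
    then show ?thesis
      by (intro exI[of _ "Complex A C"] exI[of _ "Complex B D"]) (auto simp: complex_eq_iff)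
  qed
  \<comment> \<open>The affine coefficients depend on the subinterval. Defining \<zeta>' as the
    pointwise derivative avoids gluing them together.\<close>
  define \<zeta>' where "\<zeta>' x = vector_derivative \<zeta> (at x)" for x
  show ?thesis
  proof (intro exI[of _ \<zeta>'] allI impI)
    fix x assume x: "a < x" "x < b"
    define \<alpha> \<beta> where "\<alpha> = (a + x) / 2" and "\<beta> = (x + b) / 2"
    have \<alpha>\<beta>: "a < \<alpha>" "\<alpha> < \<beta>" "\<beta> < b" "x \<in> {\<alpha><..<\<beta>}" using x by (auto simp: \<alpha>_def \<beta>_def)
    obtain A B where AB: "\<And>y. y \<in> {\<alpha><..<\<beta>} \<Longrightarrow> g y = A + of_real y * B" using aff[OF \<alpha>\<beta>(1-3)] by blast
    have at: "at y within {a..b} = at y" if "y \<in> {\<alpha><..<\<beta>}" for y using that \<alpha>\<beta> by (intro at_within_Icc_at) auto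
    have d1: "(\<zeta> has_vector_derivative H' y + B) (at y)" if y: "y \<in> {\<alpha><..<\<beta>}" for y
    proof (rule has_vector_derivative_transform_within_open[OF _ _ y])
      have "((\<lambda>y. y *\<^sub>R B) has_vector_derivative 1 *\<^sub>R B) (at y)"
        by (auto intro!: derivative_eq_intros)
      then have "((\<lambda>y. of_real y * B) has_vector_derivative B) (at y)" by (simp add: scaleR_conv_of_real)
      moreover have "(H has_vector_derivative H' y) (at y)" using H[of y] at[OF y] y \<alpha>\<beta> by auto
      ultimately show "((\<lambda>y. H y + (A + of_real y * B)) has_vector_derivative H' y + B) (at y)"
        by (auto intro!: derivative_eq_intros)
      show "H z + (A + of_real z * B) = \<zeta> z" if "z \<in> {\<alpha><..<\<beta>}" for z
        using AB[OF that, symmetric] by (simp add: g_def)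
    qed simp
    then have eq: "\<zeta>' y = H' y + B" if "y \<in> {\<alpha><..<\<beta>}" for y
      using that by (simp add: \<zeta>'_def vector_derivative_at)
    show "(\<zeta> has_vector_derivative \<zeta>' x) (at x) \<and> (\<zeta>' has_vector_derivative h x) (at x)"
    proof
      show "(\<zeta> has_vector_derivative \<zeta>' x) (at x)" using d1[OF \<alpha>\<beta>(4)] eq[OF \<alpha>\<beta>(4)] by simp
      show "(\<zeta>' has_vector_derivative h x) (at x)"
      proof (rule has_vector_derivative_transform_within_open[OF _ _ \<alpha>\<beta>(4)])
        have "(H' has_vector_derivative h x) (at x)" using H'[of x] at[OF \<alpha>\<beta>(4)] x by auto
        then show "((\<lambda>y. H' y + B) has_vector_derivative h x) (at x)" by (auto intro!: derivative_eq_intros)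
      qed (simp_all add: eq)
    qed
  qed
qed

section \<open>Sturm comparison\<close>

lemma sturm_before_zero:
  assumes u: "sol2 L (\<lambda>s. Q s - \<mu>) u u'" and v: "sol2 L Q v v'" and \<mu>: "\<mu> < 0"
    and W0: "u 0 * v' 0 - u' 0 * v 0 = 0"
    and t: "0 < t" "t \<le> L" "u t = 0" "u' t \<le> 0" and pos: "\<And>s. 0 < s \<Longrightarrow> s < t \<Longrightarrow> u s > 0"
  shows "\<exists>s. 0 < s \<and> s < t \<and> v s \<le> 0 \<or> s = t \<and> v s < 0"
proof (rule ccontr)
  assume "\<not> ?thesis"
  then have no: "\<not> (0 < s \<and> s < t \<and> v s \<le> 0)" "\<not> (s = t \<and> v s < 0)" for s by blast+
  have vpos: "v s > 0" if "0 < s" "s < t" for s using no(1)[of s] that by simp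
  have vt: "v t \<ge> 0" using no(2)[of t] by simp
  have "(u 0 * v' 0 - u' 0 * v 0) * - 1 < (u t * v' t - u' t * v t) * - 1"
    by (rule wronskian_mono[OF u v]) (use t pos vpos \<mu> in \<open>auto simp: mult_neg_pos\<close>)
  with W0 t(3) have "u' t * v t > 0" by simp
  then show False using t(4) vt by (simp add: zero_less_mult_iff)
qed

lemma sturm_after_zero:
  assumes u: "sol2 L (\<lambda>s. Q s - \<mu>) u u'" and v: "sol2 L Q v v'" and \<mu>: "\<mu> < 0"
    and Q: "continuous_on {0..L} Q"
    and init: "u 0 > 0 \<or> (u 0 = 0 \<and> u' 0 > 0)"
    and W0: "u 0 * v' 0 - u' 0 * v 0 = 0"
    and vpos: "\<And>s. 0 < s \<Longrightarrow> s < t0 \<Longrightarrow> v s > 0" and vneg: "\<And>s. t0 < s \<Longrightarrow> s \<le> L \<Longrightarrow> v s < 0"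
    and vt0: "v t0 = 0"
    and z: "0 < z" "z < L" "u z = 0"
  shows "u L < 0" "u L * v' L - u' L * v L < 0"
proof -
  obtain t where t: "0 < t" "t \<le> z" "u t = 0" "u' t \<le> 0" and pos: "\<And>s. 0 < s \<Longrightarrow> s < t \<Longrightarrow> u s > 0"
    using sol2_first_zero[OF u init, of z] z by auto
  have tL: "t < L" using t z by simp
  obtain s where "0 < s \<and> s < t \<and> v s \<le> 0 \<or> s = t \<and> v s < 0"
    using sturm_before_zero[OF u v \<mu> W0 t(1) less_imp_le[OF tL] t(3,4) pos] by blast
  then have t0t: "t0 < t" using vpos[of s] vt0 t(1) by (metis less_linear not_less order_less_irrefl less_trans)
  have vneg': "v s < 0" if "t \<le> s" "s \<le> L" for s using vneg[of s] t0t that by simp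
  have contP: "continuous_on {0..L} (\<lambda>s. Q s - \<mu>)" by (intro continuous_intros Q)
  have "u' t \<noteq> 0"
    using sol2_double_zero[OF u contP, of t] t tL init by auto
  with t(4) have u't: "u' t < 0" by simp
  have Wt: "u t * v' t - u' t * v t < 0"
    using vneg'[of t] tL u't t(3) by (simp add: mult_neg_neg)
  have neg: "u s < 0" if s: "t < s" "s \<le> L" for s
  proof (rule ccontr)
    assume "\<not> u s < 0"
    then have us: "- u (t + (s - t)) \<le> 0" by simp
    have "sol2 (L - t) (\<lambda>s. Q (t + s) - \<mu>) (\<lambda>s. - u (t + s)) (\<lambda>s. - u' (t + s))"
      using sol2_lincomb[OF sol2_shift[OF u] sol2_shift[OF u], of t "-1" 0] t by simp
    then obtain r where r: "0 < r" "r \<le> s - t" "- u (t + r) = 0" "- u' (t + r) \<le> 0"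
      and pos: "\<And>q. 0 < q \<Longrightarrow> q < r \<Longrightarrow> - u (t + q) > 0"
      by (rule sol2_first_zero[of _ _ _ _ "s - t"]) (use t(3) u't s us in auto)
    have un: "u q < 0" if "t < q" "q < t + r" for q using pos[of "q - t"] that by simp
    have "(u t * v' t - u' t * v t) * - 1 < (u (t + r) * v' (t + r) - u' (t + r) * v (t + r)) * - 1"
      by (rule wronskian_mono[OF u v])
        (use t r s un vneg' \<mu> in \<open>auto simp: mult_neg_pos mult_neg_neg\<close>)
    with Wt r(3) have "u' (t + r) * v (t + r) > 0" by simp
    moreover have "v (t + r) < 0" using vneg'[of "t + r"] r s by auto
    ultimately show False using r(4) by (simp add: zero_less_mult_iff)
  qed
  show "u L < 0" using neg[of L] tL by simp
  have "(u t * v' t - u' t * v t) * - 1 < (u L * v' L - u' L * v L) * - 1"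
    by (rule wronskian_mono[OF u v]) (use t tL neg vneg' \<mu> in \<open>auto simp: mult_neg_pos mult_neg_neg\<close>)
  with Wt show "u L * v' L - u' L * v L < 0" by simp
qed

lemma comparison_positive:
  assumes u: "sol2 L P u u'" and w: "sol2 L R w w'" and PR: "\<And>s. 0 < s \<Longrightarrow> s < L \<Longrightarrow> R s < P s"
    and wpos: "\<And>s. 0 \<le> s \<Longrightarrow> s \<le> L \<Longrightarrow> w s > 0"
    and init: "u 0 > 0 \<or> (u 0 = 0 \<and> u' 0 > 0)" and W0: "w 0 * u' 0 - w' 0 * u 0 \<ge> 0" and L: "L > 0"
  shows "u L > 0" "w L * u' L - w' L * u L > 0"
proof -
  have pos: "u s > 0" if s: "0 < s" "s \<le> L" for s
  proof (rule ccontr)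
    assume "\<not> u s > 0"
    then obtain t where t: "0 < t" "t \<le> s" "u t = 0" "u' t \<le> 0" and pos: "\<And>s. 0 < s \<Longrightarrow> s < t \<Longrightarrow> u s > 0"
      using sol2_first_zero[OF u init, of s] s by auto
    have "(w 0 * u' 0 - w' 0 * u 0) * 1 < (w t * u' t - w' t * u t) * 1"
      by (rule wronskian_mono[OF w u]) (use t s pos wpos PR in \<open>auto intro!: mult_pos_pos\<close>)
    then have "w t * u' t > 0" using W0 t(3) by simp
    then show False using t(4) wpos[of t] t s by (simp add: zero_less_mult_iff)
  qed
  then show "u L > 0" using L by simp
  have "(w 0 * u' 0 - w' 0 * u 0) * 1 < (w L * u' L - w' L * u L) * 1"
    by (rule wronskian_mono[OF w u]) (use L pos wpos PR in \<open>auto intro!: mult_pos_pos\<close>)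
  then show "w L * u' L - w' L * u L > 0" using W0 by simp
qed

section \<open>Variation of the profile\<close>

lemma profile_variation_Robin:
  assumes \<omega>: "Z\<^sup>2 / 4 < \<omega>" and Z: "Z \<noteq> 0" and par: "peak_parameter L \<omega> Z \<eta>0"
    and v: "sol2 L (\<lambda>s. \<omega> - 3 * (profile \<omega> \<eta>0 s)\<^sup>2) v v'" "v 0 = 1" "v' 0 = 0"
  shows "v' L \<le> Z / 2 * v L"
proof -
  note p = peak_parameterD[OF assms(1-3)]
  have below: "\<eta>\<^sup>2 < \<omega>" if "0 < \<eta>" "\<eta> < peak_theta \<omega> Z" for \<eta>
    using peak_theta_sq_less[OF \<omega> Z that(1)] that(2) by simp
  obtain m where m: "\<And>n::nat. \<eta>0 < m n" "\<And>n. m n < peak_theta \<omega> Z" "m \<longlonglongrightarrow> \<eta>0"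
    and T_lim: "(\<lambda>n. half_period \<omega> Z (m n)) \<longlonglongrightarrow> L" using half_period_seq[OF assms(1-3)] by blast
  have m0: "0 < m n" for n using m(1)[of n] p(1) by linarith
  note R2 = half_period_Robin[OF \<omega> Z p(1,2), unfolded p(3)]
  have L: "0 < L" by (rule R2(1))
  define w w' where "w = profile \<omega> \<eta>0" and "w' = profile' \<omega> \<eta>0"
  define u u' where "u n = profile \<omega> (m n)" and "u' n = profile' \<omega> (m n)" for n
  define d where "d n = m n - \<eta>0" for n
  have d: "d n > 0" for n using m(1) by (simp add: d_def)
  have d_lim: "d \<longlonglongrightarrow> 0" using tendsto_diff[OF m(3) tendsto_const[of \<eta>0]] by (simp add: d_def[abs_def])
  have w: "(w has_real_derivative w' s) (at s within S)"
    "(w' has_real_derivative (\<omega> - (w s)\<^sup>2) * w s) (at s within S)" for s S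
    unfolding w_def w'_def using profile_deriv[OF p(1) below[OF p(1,2)]] profile'_deriv[OF p(1) below[OF p(1,2)]] by auto
  have u: "(u n has_real_derivative u' n s) (at s within S)"
    "(u' n has_real_derivative (\<omega> - (u n s)\<^sup>2) * u n s) (at s within S)" for n s S
    unfolding u_def u'_def using profile_deriv[OF m0 below[OF m0 m(2)]] profile'_deriv[OF m0 below[OF m0 m(2)]] by auto
  have init: "w 0 = \<eta>0" "w' 0 = 0" "u n 0 = m n" "u' n 0 = 0" for n
    unfolding w_def w'_def u_def u'_def
    using profile_0[OF p(1) below[OF p(1,2)]] profile'_0[OF p(1) below[OF p(1,2)]]
      profile_0[OF m0 below[OF m0 m(2)]] profile'_0[OF m0 below[OF m0 m(2)]] by auto
  have sq: "(w s)\<^sup>2 \<le> 2 * \<omega>" "(u n s)\<^sup>2 \<le> 2 * \<omega>" for n s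
    unfolding w_def u_def using profile_sq_le[OF p(1) below[OF p(1,2)]] profile_sq_le[OF m0 below[OF m0 m(2)]] by auto
  have wpos: "w s > 0" for s unfolding w_def by (rule profile_pos[OF p(1) below[OF p(1,2)]])
  define R where "R n s = \<omega> - ((u n s)\<^sup>2 + u n s * w s + (w s)\<^sup>2)" for n s
  have R_eq: "(\<omega> - (u n s)\<^sup>2) * u n s - (\<omega> - (w s)\<^sup>2) * w s = R n s * (u n s - w s)" for n s
    by (simp add: R_def algebra_simps power2_eq_square)
  have \<omega>0: "\<omega> > 0" using \<omega> zero_le_power2[of Z] by linarith
  have R_bound: "\<bar>R n s\<bar> \<le> 7 * \<omega>" for n s
  proof -
    have "2 * \<bar>u n s * w s\<bar> \<le> (u n s)\<^sup>2 + (w s)\<^sup>2"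
      using sum_squares_bound[of "\<bar>u n s\<bar>" "\<bar>w s\<bar>"] by (simp add: abs_mult)
    then have "\<bar>u n s * w s\<bar> \<le> 2 * \<omega>" using sq(1)[of s] sq(2)[of n s] by linarith
    then show ?thesis using sq(1)[of s] sq(2)[of n s] \<omega>0 zero_le_power2[of "u n s"] zero_le_power2[of "w s"]
      unfolding R_def by linarith
  qed
  define E where "E = sqrt (exp ((7 * \<omega> + 2) * L))"
  have close_sq: "(u n s - w s)\<^sup>2 + (u' n s - w' s)\<^sup>2 \<le> (d n * E)\<^sup>2" if "s \<in> {0..L}" for n s
  proof -
    have "(u n s - w s)\<^sup>2 + (u' n s - w' s)\<^sup>2 \<le>
      ((u n 0 - w 0)\<^sup>2 + (u' n 0 - w' 0)\<^sup>2 + 0\<^sup>2 * L) * exp ((7 * \<omega> + 2) * L)"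
    proof (rule gronwall_energy[where R = "R n" and g = "\<lambda>s. 0"])
      fix s
      show "((\<lambda>s. u n s - w s) has_real_derivative u' n s - w' s) (at s within {0..L})"
        by (intro derivative_intros u w)
      show "((\<lambda>s. u' n s - w' s) has_real_derivative R n s * (u n s - w s) + 0) (at s within {0..L})"
        using DERIV_diff[OF u(2)[of n s] w(2)[of s]] by (simp add: R_eq)
    qed (use R_bound that in auto)
    then show ?thesis by (simp add: init d_def E_def power_mult_distrib)
  qed
  have close: "\<bar>u n s - w s\<bar> \<le> d n * E" "\<bar>u' n s - w' s\<bar> \<le> d n * E" if "s \<in> {0..L}" for n s
  proof -
    have "0 \<le> d n * E" using d[of n] by (simp add: E_def)
    moreover have "\<bar>u n s - w s\<bar>\<^sup>2 \<le> (d n * E)\<^sup>2" "\<bar>u' n s - w' s\<bar>\<^sup>2 \<le> (d n * E)\<^sup>2"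
      by (rule order_trans[OF _ close_sq[OF that, of n]], simp)+
    ultimately show "\<bar>u n s - w s\<bar> \<le> d n * E" "\<bar>u' n s - w' s\<bar> \<le> d n * E"
      using power2_le_imp_le by blast+
  qed
  define T where "T n = half_period \<omega> Z (m n)" for n
  have T: "0 < T n" "T n < L" for n
    using half_period_Robin(1)[OF \<omega> Z m0 m(2)] p(4)[OF m(1,2)] by (auto simp: T_def)
  define h where "h n s = u' n s - Z / 2 * u n s" for n s
  define h' where "h' n s = (\<omega> - (u n s)\<^sup>2) * u n s - Z / 2 * u' n s" for n s
  have h_deriv: "(h n has_real_derivative h' n s) (at s)" for n s
    unfolding h_def h'_def by (intro DERIV_diff DERIV_cmult u)
  have hT: "h n (T n) = 0" for n
    using half_period_Robin(2)[OF \<omega> Z m0 m(2)] by (simp add: h_def T_def u_def u'_def)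
  have "\<exists>\<xi>. T n < \<xi> \<and> \<xi> < L \<and> h n L - h n (T n) = (L - T n) * h' n \<xi>" for n
    by (rule MVT2[OF T(2)]) (rule h_deriv)
  then obtain \<xi> where \<xi>: "\<And>n. T n < \<xi> n" "\<And>n. \<xi> n < L" "\<And>n. h n L - h n (T n) = (L - T n) * h' n (\<xi> n)"
    by metis
  have \<xi>_in: "\<xi> n \<in> {0..L}" for n using \<xi>(1,2)[of n] T[of n] by auto
  have \<xi>_lim: "\<xi> \<longlonglongrightarrow> L"
    by (rule tendsto_sandwich[OF _ _ T_lim[folded T_def] tendsto_const]) (use \<xi> in \<open>auto intro!: always_eventually less_imp_le\<close>)
  have dE: "(\<lambda>n. d n * E) \<longlonglongrightarrow> 0" using tendsto_mult_right[OF d_lim, of E] by simp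
  have "isCont w L" "isCont w' L" using w[of L UNIV] by (auto intro: DERIV_isCont)
  then have w\<xi>: "(\<lambda>n. w (\<xi> n)) \<longlonglongrightarrow> w L" "(\<lambda>n. w' (\<xi> n)) \<longlonglongrightarrow> w' L"
    using \<xi>_lim by (auto intro: isCont_tendsto_compose)
  have diff0: "(\<lambda>n. u n (\<xi> n) - w (\<xi> n)) \<longlonglongrightarrow> 0" "(\<lambda>n. u' n (\<xi> n) - w' (\<xi> n)) \<longlonglongrightarrow> 0"
    by (rule Lim_null_comparison[OF _ dE]; use close[OF \<xi>_in] in \<open>auto intro!: always_eventually\<close>)+
  have u\<xi>: "(\<lambda>n. u n (\<xi> n)) \<longlonglongrightarrow> w L" "(\<lambda>n. u' n (\<xi> n)) \<longlonglongrightarrow> w' L"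
    using tendsto_add[OF diff0(1) w\<xi>(1)] tendsto_add[OF diff0(2) w\<xi>(2)] by auto
  have "(\<lambda>n. h' n (\<xi> n)) \<longlonglongrightarrow> (\<omega> - (w L)\<^sup>2) * w L - Z / 2 * w' L"
    unfolding h'_def by (intro tendsto_intros u\<xi>)
  moreover have "(\<omega> - (w L)\<^sup>2) * w L - Z / 2 * w' L < 0"
  proof -
    have "(\<omega> - (w L)\<^sup>2) * w L - Z / 2 * w' L = (\<omega> - (w L)\<^sup>2 - Z\<^sup>2 / 4) * w L"
      using R2(2) by (simp add: w_def w'_def algebra_simps power2_eq_square)
    also have "\<dots> < 0" using R2(3) wpos[of L] by (intro mult_neg_pos) (auto simp: w_def)
    finally show ?thesis .
  qed
  ultimately have "\<forall>\<^sub>F n in sequentially. h' n (\<xi> n) < 0" by (rule order_tendstoD)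
  then have hL: "\<forall>\<^sub>F n in sequentially. h n L \<le> 0"
  proof eventually_elim
    case (elim n)
    then have "(L - T n) * h' n (\<xi> n) \<le> 0" using T[of n] by (intro mult_nonneg_nonpos) auto
    then show ?case using \<xi>(3)[of n] hT by simp
  qed
  define e e' where "e n s = (u n s - w s) / d n" and "e' n s = (u' n s - w' s) / d n" for n s
  have e_sol: "sol2 L (R n) (e n) (e' n)" for n
    unfolding sol2_def e_def e'_def
  proof (intro ballI conjI)
    fix s
    show "((\<lambda>s. (u n s - w s) / d n) has_real_derivative (u' n s - w' s) / d n) (at s within {0..L})"
      by (intro DERIV_cdivide derivative_intros u w)
    show "((\<lambda>s. (u' n s - w' s) / d n) has_real_derivative R n s * ((u n s - w s) / d n)) (at s within {0..L})"
      using DERIV_cdivide[OF DERIV_diff[OF u(2)[of n s "{0..L}"] w(2)[of s "{0..L}"]], of "d n"] by (simp add: R_eq)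
  qed
  define B where "B = sqrt (2 * \<omega>)"
  have B: "\<bar>w s\<bar> \<le> B" "\<bar>u n s\<bar> \<le> B" for n s
    using sq(1)[of s] sq(2)[of n s] unfolding B_def by (auto intro: real_le_rsqrt)
  have lim: "(\<lambda>n. e n L) \<longlonglongrightarrow> v L" "(\<lambda>n. e' n L) \<longlonglongrightarrow> v' L"
  proof -
    have Q: "continuous_on {0..L} (\<lambda>s. \<omega> - 3 * (w s)\<^sup>2)"
      using w(1) by (intro continuous_intros) (meson DERIV_continuous continuous_on_eq_continuous_within)
    have init': "e n 0 = v 0" "e' n 0 = v' 0" for n
      using d[of n] by (auto simp: e_def e'_def init v d_def)
    have Rdiff: "\<bar>R n s - (\<omega> - 3 * (w s)\<^sup>2)\<bar> \<le> d n * E * (3 * B)" if "s \<in> {0..L}" for n s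
    proof -
      have "R n s - (\<omega> - 3 * (w s)\<^sup>2) = - ((u n s - w s) * (2 * w s + u n s))"
        by (simp add: R_def algebra_simps power2_eq_square)
      also have "\<bar>\<dots>\<bar> = \<bar>u n s - w s\<bar> * \<bar>2 * w s + u n s\<bar>" by (simp add: abs_mult)
      also have "\<dots> \<le> d n * E * (3 * B)"
      proof (rule mult_mono[OF close(1)[OF that]])
        show "\<bar>2 * w s + u n s\<bar> \<le> 3 * B" using B(1)[of s] B(2)[of n s] by linarith
        show "0 \<le> d n * E" using d[of n] by (simp add: E_def)
      qed simp
      finally show ?thesis .
    qed
    have lim0: "(\<lambda>n. d n * E * (3 * B)) \<longlonglongrightarrow> 0" using tendsto_mult_right[OF dE, of "3 * B"] by simp
    have "L \<in> {0..L}" using L by simp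
    from sol2_tendsto[OF v(1)[folded w_def] Q e_sol init' Rdiff lim0 this]
    show "(\<lambda>n. e n L) \<longlonglongrightarrow> v L" "(\<lambda>n. e' n L) \<longlonglongrightarrow> v' L" by auto
  qed
  have ev: "\<forall>\<^sub>F n in sequentially. e' n L \<le> Z / 2 * e n L"
    using hL
  proof eventually_elim
    case (elim n)
    have "u' n L - w' L \<le> Z / 2 * (u n L - w L)"
      using elim R2(2) by (simp add: h_def w_def w'_def algebra_simps)
    then have "(u' n L - w' L) / d n \<le> Z / 2 * (u n L - w L) / d n"
      using d[of n] by (intro divide_right_mono) auto
    then show ?case by (simp add: e_def e'_def)
  qed
  show ?thesis
    by (rule tendsto_le[OF _ _ _ ev]) (auto intro!: tendsto_intros lim)
qed

section \<open>The half-period problems\<close>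

locale peak_well =
  fixes L Z \<omega> :: real and w w' :: "real \<Rightarrow> real"
  assumes L: "0 < L" and Z: "Z \<noteq> 0"
    and w: "sol2 L (\<lambda>s. \<omega> - (w s)\<^sup>2) w w'"
    and w_pos: "\<And>s. 0 \<le> s \<Longrightarrow> s \<le> L \<Longrightarrow> w s > 0"
    and w'_0: "w' 0 = 0" and curvature: "(w 0)\<^sup>2 < \<omega>"
    and Robin: "w' L = Z / 2 * w L" and transversal: "(w L)\<^sup>2 > \<omega> - Z\<^sup>2 / 4"
    and increasing: "\<And>s. 0 < Z \<Longrightarrow> 0 < s \<Longrightarrow> s \<le> L \<Longrightarrow> w' s > 0"
    and turning: "Z < 0 \<Longrightarrow> \<exists>t. 0 < t \<and> t < L \<and> w' t = 0 \<and> (\<forall>s. 0 < s \<longrightarrow> s < t \<longrightarrow> w' s > 0) \<and>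
       (\<forall>s. t < s \<longrightarrow> s \<le> L \<longrightarrow> w' s < 0)"
    and variation_Robin: "\<And>v v'. sol2 L (\<lambda>s. \<omega> - 3 * (w s)\<^sup>2) v v' \<Longrightarrow> v 0 = 1 \<Longrightarrow> v' 0 = 0 \<Longrightarrow>
       v' L \<le> Z / 2 * v L"
begin

definition Q :: "real \<Rightarrow> real" where "Q s = \<omega> - 3 * (w s)\<^sup>2"

definition even_eigenvalue :: "real \<Rightarrow> bool" where
  "even_eigenvalue \<mu> \<longleftrightarrow> (\<exists>y y'. sol2 L (\<lambda>s. Q s - \<mu>) y y' \<and> y 0 = 1 \<and> y' 0 = 0 \<and> y' L = Z / 2 * y L)"

definition odd_eigenvalue :: "real \<Rightarrow> bool" where
  "odd_eigenvalue \<mu> \<longleftrightarrow> (\<exists>y y'. sol2 L (\<lambda>s. Q s - \<mu>) y y' \<and> y 0 = 0 \<and> y' 0 = 1 \<and> y L = 0)"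

lemma Q_cont: "continuous_on {0..L} (\<lambda>s. Q s - \<mu>)" "continuous_on {0..L} Q"
  unfolding Q_def by (intro continuous_intros sol2_continuous[OF w])+

definition w'' :: "real \<Rightarrow> real" where "w'' s = (\<omega> - (w s)\<^sup>2) * w s"

lemma w'_sol: "sol2 L Q w' w''"
  unfolding sol2_def
proof (intro ballI conjI)
  fix s assume s: "s \<in> {0..L}"
  show "(w' has_real_derivative w'' s) (at s within {0..L})"
    using sol2_deriv(2)[OF w s] by (simp add: w''_def)
  show "(w'' has_real_derivative Q s * w' s) (at s within {0..L})"
    unfolding w''_def Q_def
    by (rule derivative_eq_intros sol2_deriv(1)[OF w s] refl)+ (simp add: algebra_simps power2_eq_square)
qed

lemma w''_0: "w'' 0 > 0"
  using w_pos[of 0] curvature L by (simp add: w''_def)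

lemma solution_family:
  obtains c c' where "\<And>\<mu>. sol2 L (\<lambda>s. Q s - \<mu>) (c \<mu>) (c' \<mu>)" "\<And>\<mu>. c \<mu> 0 = \<alpha>" "\<And>\<mu>. c' \<mu> 0 = \<beta>"
  using sol2_exists[OF Q_cont(1) less_imp_le[OF L], of _ \<alpha> \<beta>] that by metis

lemma family_continuous:
  assumes c: "\<And>\<mu>. sol2 L (\<lambda>s. Q s - \<mu>) (c \<mu>) (c' \<mu>)" "\<And>\<mu>. c \<mu> 0 = \<alpha>" "\<And>\<mu>. c' \<mu> 0 = \<beta>"
  shows "continuous_on A (\<lambda>\<mu>. c \<mu> L)" "continuous_on A (\<lambda>\<mu>. c' \<mu> L)"
proof -
  have *: "(\<lambda>n. c (x n) L) \<longlonglongrightarrow> c a L \<and> (\<lambda>n. c' (x n) L) \<longlonglongrightarrow> c' a L" if "x \<longlonglongrightarrow> a" for x a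
  proof -
    have e: "(\<lambda>n. \<bar>x n - a\<bar>) \<longlonglongrightarrow> 0" using that by (simp add: LIM_zero tendsto_rabs_zero)
    have "L \<in> {0..L}" using L by simp
    from sol2_tendsto[OF c(1) Q_cont(1) c(1)[of "x _"] _ _ _ e this]
    show ?thesis by (auto simp: c)
  qed
  show "continuous_on A (\<lambda>\<mu>. c \<mu> L)" "continuous_on A (\<lambda>\<mu>. c' \<mu> L)"
    using * by (auto simp: continuous_on_sequentially o_def)
qed

lemma variation_after_zero:
  assumes v: "sol2 L Q v v'" "v 0 = 1" "v' 0 = 0"
    and t: "0 < t" "v t = 0" "\<And>s. 0 < s \<Longrightarrow> s < t \<Longrightarrow> v s > 0" and s: "t < s" "s \<le> L"
  shows "v s < 0"
proof -
  have W: "w' s * v' s - w'' s * v s = - w'' 0" if "s \<in> {0..L}" for s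
    using wronskian_const[OF w'_sol v(1) that] v w'_0 by simp
  have quot: "v b / w' b < v a / w' a"
    if ab: "0 < a" "a < b" "b \<le> L" and nz: "\<And>s. a \<le> s \<Longrightarrow> s \<le> b \<Longrightarrow> w' s \<noteq> 0" for a b
  proof (rule DERIV_neg_imp_decreasing_open[OF ab(2)])
    have sub: "{a..b} \<subseteq> {0..L}" using ab by auto
    show "continuous_on {a..b} (\<lambda>s. v s / w' s)"
      using nz by (intro continuous_on_divide continuous_on_subset[OF _ sub] sol2_continuous[OF v(1)]
          sol2_continuous[OF w'_sol]) auto
    fix x assume x: "a < x" "x < b"
    have "((\<lambda>s. v s / w' s) has_real_derivative (v' x * w' x - v x * w'' x) / (w' x * w' x)) (at x)"
      by (rule DERIV_divide) (use x ab nz sol2_deriv_at[OF v(1)] sol2_deriv_at[OF w'_sol] in auto)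
    moreover have "v' x * w' x - v x * w'' x < 0"
      using W[of x] x ab w''_0 by (simp add: algebra_simps)
    then have "(v' x * w' x - v x * w'' x) / (w' x * w' x) < 0"
      using nz[of x] x by (intro divide_neg_pos) (auto simp: zero_less_mult_iff linorder_neq_iff)
    ultimately show "\<exists>y. ((\<lambda>s. v s / w' s) has_real_derivative y) (at x) \<and> y < 0" by blast
  qed
  show ?thesis
  proof (cases "Z > 0")
    case True
    have nz: "w' r \<noteq> 0" if "t \<le> r" "r \<le> s" for r using increasing[OF True, of r] that t s by simp
    have "v s / w' s < v t / w' t"
      by (rule quot[OF t(1) s nz])
    then show ?thesis using increasing[OF True, of s] t s by (simp add: divide_less_0_iff)
  next
    case False
    then have Z0: "Z < 0" using Z by simp
    from turning[OF Z0] obtain x where x: "0 < x" "x < L" "w' x = 0"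
      "\<And>s. 0 < s \<Longrightarrow> s < x \<Longrightarrow> w' s > 0" "\<And>s. x < s \<Longrightarrow> s \<le> L \<Longrightarrow> w' s < 0" by blast
    have "w'' x \<le> 0"
    proof (rule ccontr)
      assume "\<not> w'' x \<le> 0"
      then have "w'' x > 0" by simp
      from DERIV_pos_inc_right[OF sol2_deriv_at(1)[OF w'_sol x(1,2)] this]
      obtain e where e: "e > 0" "\<forall>h>0. h < e \<longrightarrow> w' x < w' (x + h)" by auto
      define h where "h = min (e / 2) (L - x)"
      have "0 < h" "h < e" "x + h \<le> L" using e(1) x by (auto simp: h_def)
      then show False using e(2) x(3) x(5)[of "x + h"] by force
    qed
    moreover have "w'' x * v x = w'' 0" using W[of x] x by simp
    ultimately have vx: "v x < 0" using w''_0
      by (metis less_le_not_le mult_nonpos_nonneg not_less order_less_le_trans)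
    have tx: "t < x" using t(3)[of x] t(2) vx x(1) by (metis less_irrefl not_less_iff_gr_or_eq less_asym)
    consider "s < x" | "s = x" | "x < s" by linarith
    then show ?thesis
    proof cases
      case 1
      have nz: "w' r \<noteq> 0" if "t \<le> r" "r \<le> s" for r using x(4)[of r] that t 1 by simp
      have "v s / w' s < v t / w' t"
        by (rule quot[OF t(1) s nz])
      then show ?thesis using x(4)[of s] t s 1 by (simp add: divide_less_0_iff)
    next
      case 2 then show ?thesis using vx by simp
    next
      case 3
      show ?thesis
      proof (rule ccontr)
        assume "\<not> v s < 0"
        then have "v s / w' s \<le> 0" using x(5)[of s] 3 s by (simp add: divide_le_0_iff)
        moreover have "v L / w' L \<le> v s / w' s"
        proof (cases "s = L")
          case False
          have nz: "w' r \<noteq> 0" if "s \<le> r" "r \<le> L" for r using x(5)[of r] that 3 by simp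
          have "v L / w' L < v s / w' s"
            by (rule quot[OF _ _ _ nz]) (use t s False in auto)
          then show ?thesis by simp
        qed simp
        moreover have pL: "w' L < 0" using x(5)[of L] x(2) by simp
        ultimately have vL: "v L \<ge> 0" by (metis divide_le_0_iff not_less order_trans)
        have "v' L \<le> Z / 2 * v L" using variation_Robin v unfolding Q_def[abs_def] by blast
        then have "w' L * v' L \<ge> w' L * (Z / 2 * v L)" using pL by (simp add: mult_left_mono_neg)
        moreover have "w' L * v' L = w'' L * v L - w'' 0" using W[of L] L by simp
        ultimately have "(w' L * (Z / 2) - w'' L) * v L \<le> - w'' 0" by (simp add: algebra_simps)
        moreover have "w' L * (Z / 2) - w'' L = ((w L)\<^sup>2 - (\<omega> - Z\<^sup>2 / 4)) * w L"
          by (simp add: Robin w''_def algebra_simps power2_eq_square)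
        moreover have "((w L)\<^sup>2 - (\<omega> - Z\<^sup>2 / 4)) * w L * v L \<ge> 0"
          using transversal w_pos[of L] L vL by (intro mult_nonneg_nonneg) auto
        ultimately show False using w''_0 by simp
      qed
    qed
  qed
qed

lemma even_after_zero:
  assumes y: "sol2 L (\<lambda>s. Q s - \<mu>) y y'" "y 0 = 1" "y' 0 = 0" and \<mu>: "\<mu> < 0"
    and z: "0 < z" "z < L" "y z \<le> 0"
  shows "y L < 0" "y' L \<noteq> Z / 2 * y L"
proof -
  obtain v v' where v: "sol2 L Q v v'" "v 0 = 1" "v' 0 = 0"
    using sol2_exists[OF Q_cont(2) less_imp_le[OF L], of 1 0] by blast
  obtain t where t: "0 < t" "t \<le> z" "y t = 0" "y' t \<le> 0" "\<And>s. 0 < s \<Longrightarrow> s < t \<Longrightarrow> y s > 0"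
    using sol2_first_zero[OF y(1), of z] y(2) z by auto
  have tL: "t < L" using t z by simp
  have W0: "y 0 * v' 0 - y' 0 * v 0 = 0" by (simp add: y v)
  obtain s where s: "0 < s" "s \<le> t" "v s \<le> 0"
    using sturm_before_zero[OF y(1) v(1) \<mu> W0 t(1) less_imp_le[OF tL] t(3-5)] t(1) by force
  obtain t0 where t0: "0 < t0" "t0 \<le> s" "v t0 = 0" "v' t0 \<le> 0" "\<And>s. 0 < s \<Longrightarrow> s < t0 \<Longrightarrow> v s > 0"
    using sol2_first_zero[OF v(1), of s] v(2) s tL by auto
  have vneg: "\<And>s. t0 < s \<Longrightarrow> s \<le> L \<Longrightarrow> v s < 0"
    by (rule variation_after_zero[OF v t0(1,3,5)])
  have yinit: "y 0 > 0 \<or> y 0 = 0 \<and> y' 0 > 0" by (simp add: y)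
  note after = sturm_after_zero[OF y(1) v(1) \<mu> Q_cont(2) yinit W0 t0(5) vneg t0(3) t(1) tL t(3)]
  show "y L < 0" by (rule after(1))
  show "y' L \<noteq> Z / 2 * y L"
  proof
    assume eq: "y' L = Z / 2 * y L"
    have "y L * (v' L - Z / 2 * v L) = y L * v' L - y' L * v L" by (simp add: eq algebra_simps)
    then have "y L * (v' L - Z / 2 * v L) < 0" using after(2) by simp
    moreover have "v' L \<le> Z / 2 * v L" using variation_Robin v unfolding Q_def[abs_def] by blast
    ultimately show False using after(1) by (simp add: mult_less_0_iff)
  qed
qed

lemma same_eigenvalue_if_positive:
  assumes y: "sol2 L (\<lambda>s. Q s - \<mu>) y y'" and u: "sol2 L (\<lambda>s. Q s - \<nu>) u u'"
    and pos: "\<And>s. 0 < s \<Longrightarrow> s < L \<Longrightarrow> y s > 0" "\<And>s. 0 < s \<Longrightarrow> s < L \<Longrightarrow> u s > 0"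
    and W: "y 0 * u' 0 - y' 0 * u 0 = 0" "y L * u' L - y' L * u L = 0"
  shows "\<mu> = \<nu>"
proof (rule ccontr)
  assume "\<mu> \<noteq> \<nu>"
  then have sq: "(\<mu> - \<nu>)\<^sup>2 > 0" by simp
  have "(y 0 * u' 0 - y' 0 * u 0) * (\<mu> - \<nu>) < (y L * u' L - y' L * u L) * (\<mu> - \<nu>)"
  proof (rule wronskian_mono[OF y u])
    fix s assume "0 < s" "s < L"
    then have "(\<mu> - \<nu>)\<^sup>2 * (y s * u s) > 0" using sq pos by simp
    then show "0 < (Q s - \<nu> - (Q s - \<mu>)) * (y s * u s) * (\<mu> - \<nu>)"
      by (simp add: power2_eq_square mult_ac)
  qed (use L in auto)
  then show False by (simp add: W)
qed

lemma even_eigenvalue_unique: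
  assumes "even_eigenvalue \<mu>" "even_eigenvalue \<nu>" and neg: "\<mu> < 0" "\<nu> < 0"
  shows "\<mu> = \<nu>"
proof -
  from assms obtain y y' u u' where
    y: "sol2 L (\<lambda>s. Q s - \<mu>) y y'" "y 0 = 1" "y' 0 = 0" "y' L = Z / 2 * y L" and
    u: "sol2 L (\<lambda>s. Q s - \<nu>) u u'" "u 0 = 1" "u' 0 = 0" "u' L = Z / 2 * u L"
    by (auto simp: even_eigenvalue_def)
  show ?thesis
  proof (rule same_eigenvalue_if_positive[OF y(1) u(1)])
    show "y s > 0" "u s > 0" if "0 < s" "s < L" for s
      using even_after_zero(2)[OF y(1-3) neg(1) that] even_after_zero(2)[OF u(1-3) neg(2) that] y(4) u(4) by force+
  qed (simp_all add: y u)
qed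

lemma low_energy:
  "\<exists>M>0. \<forall>y y'. sol2 L (\<lambda>s. Q s - (- M)) y y' \<longrightarrow> y 0 > 0 \<and> y' 0 = 0 \<or> y 0 = 0 \<and> y' 0 > 0 \<longrightarrow>
     y L > 0 \<and> y' L > Z / 2 * y L"
proof -
  obtain B where B: "B \<ge> 0" "\<And>s. s \<in> {0..L} \<Longrightarrow> \<bar>w s\<bar> \<le> B"
    using continuous_on_Icc_bounded[OF sol2_continuous(1)[OF w]] by blast
  define M where "M = 2 * B\<^sup>2 + 1"
  have M: "2 * (w s)\<^sup>2 < M" if "s \<in> {0..L}" for s
    using power_mono[OF B(2)[OF that], of 2] by (simp add: M_def)
  show ?thesis
  proof (intro exI[of _ M] conjI allI impI)
    show "M > 0" by (simp add: M_def add_nonneg_pos)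
    fix y y' assume y: "sol2 L (\<lambda>s. Q s - (- M)) y y'" and init: "y 0 > 0 \<and> y' 0 = 0 \<or> y 0 = 0 \<and> y' 0 > 0"
    have lt: "\<omega> - (w s)\<^sup>2 < Q s - (- M)" if "0 < s" "s < L" for s
      using M[of s] that by (simp add: Q_def)
    have "w 0 * y' 0 - w' 0 * y 0 \<ge> 0" using init w'_0 w_pos[of 0] L by auto
    from comparison_positive[OF y w lt w_pos _ this L] init
    have "y L > 0" "w L * y' L - w' L * y L > 0" by auto
    moreover have "w L * y' L - w' L * y L = w L * (y' L - Z / 2 * y L)"
      by (simp add: Robin algebra_simps)
    ultimately show "y L > 0" "y' L > Z / 2 * y L"
      using w_pos[of L] L by (simp_all add: zero_less_mult_iff)
  qed
qed

lemma even_eigenvalue_exists: "\<exists>\<mu><0. even_eigenvalue \<mu>"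
proof -
  obtain c c' where c: "\<And>\<mu>. sol2 L (\<lambda>s. Q s - \<mu>) (c \<mu>) (c' \<mu>)" "\<And>\<mu>. c \<mu> 0 = 1" "\<And>\<mu>. c' \<mu> 0 = 0"
    using solution_family by blast
  define a where "a \<mu> = c' \<mu> L - Z / 2 * c \<mu> L" for \<mu>
  note cont = family_continuous[of c c', OF c]
  have a_cont: "continuous_on A a" for A unfolding a_def by (intro continuous_intros cont)
  from low_energy c obtain M where M: "M > 0" "c (- M) L > 0" "a (- M) > 0"
    unfolding a_def by (metis diff_gt_0_iff_gt zero_less_one)
  have root: ?thesis if \<nu>: "\<nu> \<le> 0" "- M \<le> \<nu>" "a \<nu> \<le> 0" "\<nu> = 0 \<Longrightarrow> a \<nu> < 0" for \<nu>
  proof -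
    obtain \<mu> where \<mu>: "- M \<le> \<mu>" "\<mu> \<le> \<nu>" "a \<mu> = 0"
      using IVT2'[of a \<nu> 0 "- M"] \<nu> M a_cont by auto
    then have "\<mu> < 0" using \<nu> by (cases "\<mu> = 0") auto
    moreover have "even_eigenvalue \<mu>"
      unfolding even_eigenvalue_def using c \<mu>(3) by (intro exI[of _ "c \<mu>"] exI[of _ "c' \<mu>"]) (simp add: a_def)
    ultimately show ?thesis by blast
  qed
  have v: "sol2 L Q (c 0) (c' 0)" using c(1)[of 0] by simp
  show ?thesis
  proof (cases "\<exists>z. 0 < z \<and> z < L \<and> c 0 z \<le> 0")
    case False
    have "(w 0 * c' 0 0 - w' 0 * c 0 0) * - 1 < (w L * c' 0 L - w' L * c 0 L) * - 1"
    proof (rule wronskian_mono[OF w v])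
      fix s assume s: "0 < s" "s < L"
      then have "w s > 0" "c 0 s > 0" using w_pos[of s] False by (auto simp: not_le)
      moreover have "(Q s - (\<omega> - (w s)\<^sup>2)) * (w s * c 0 s) * - 1 = 2 * (w s)\<^sup>2 * (w s * c 0 s)"
        by (simp add: Q_def algebra_simps)
      ultimately show "0 < (Q s - (\<omega> - (w s)\<^sup>2)) * (w s * c 0 s) * - 1" by simp
    qed (use L in auto)
    then have "w L * a 0 < 0" using w'_0 c by (simp add: a_def Robin algebra_simps)
    then have "a 0 < 0" using w_pos[of L] L by (simp add: mult_less_0_iff)
    then show ?thesis using root[of 0] M by simp
  next
    case True
    then obtain z where z: "0 < z" "z < L" "c 0 z \<le> 0" by blast
    obtain t where t: "0 < t" "t \<le> z" "c 0 t = 0" "c' 0 t \<le> 0" "\<And>s. 0 < s \<Longrightarrow> s < t \<Longrightarrow> c 0 s > 0"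
      using sol2_first_zero[OF v, of z] c z by auto
    have "c 0 L < 0"
      using variation_after_zero[OF v c(2,3) t(1,3,5), of L] t z by auto
    then obtain \<nu> where \<nu>: "- M \<le> \<nu>" "\<nu> \<le> 0" "c \<nu> L = 0"
      using IVT2'[of "\<lambda>\<mu>. c \<mu> L" 0 0 "- M"] M cont(1) by auto
    have "\<nu> \<noteq> 0" using \<nu>(3) \<open>c 0 L < 0\<close> by auto
    then have \<nu>0: "\<nu> < 0" using \<nu> by simp
    have init: "c \<nu> 0 > 0 \<or> c \<nu> 0 = 0 \<and> c' \<nu> 0 > 0" by (simp add: c)
    obtain s where s: "0 < s" "s \<le> L" "c \<nu> s = 0" "c' \<nu> s \<le> 0"
      using sol2_first_zero[OF c(1)[of \<nu>] init L order_refl eq_refl[OF \<nu>(3)]] by blast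
    have "s = L"
    proof (rule ccontr)
      assume "s \<noteq> L"
      then show False using even_after_zero(1)[OF c(1-3) \<nu>0, of s] s \<nu>(3) by simp
    qed
    then have "a \<nu> \<le> 0" using s \<nu>(3) by (simp add: a_def)
    then show ?thesis using root[of \<nu>] \<nu> \<nu>0 by simp
  qed
qed

lemma no_odd_eigenvalue:
  assumes "Z > 0" "\<mu> < 0"
  shows "\<not> odd_eigenvalue \<mu>"
proof
  assume "odd_eigenvalue \<mu>"
  then obtain y y' where y: "sol2 L (\<lambda>s. Q s - \<mu>) y y'" "y 0 = 0" "y' 0 = 1" "y L = 0"
    by (auto simp: odd_eigenvalue_def)
  obtain t where t: "0 < t" "t \<le> L" "y t = 0" "y' t \<le> 0" "\<And>s. 0 < s \<Longrightarrow> s < t \<Longrightarrow> y s > 0"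
    using sol2_first_zero[OF y(1), of L] y L by auto
  have "y 0 * w'' 0 - y' 0 * w' 0 = 0" by (simp add: y w'_0)
  from sturm_before_zero[OF y(1) w'_sol assms(2) this t] increasing[OF assms(1)] t(1,2)
  show False by force
qed

lemma odd_after_zero:
  assumes Z0: "Z < 0" and y: "sol2 L (\<lambda>s. Q s - \<mu>) y y'" "y 0 = 0" "y' 0 = 1" and \<mu>: "\<mu> < 0"
    and z: "0 < z" "z < L" "y z \<le> 0"
  shows "y L < 0"
proof -
  from turning[OF Z0] obtain x where x: "0 < x" "x < L" "w' x = 0"
    "\<And>s. 0 < s \<Longrightarrow> s < x \<Longrightarrow> w' s > 0" "\<And>s. x < s \<Longrightarrow> s \<le> L \<Longrightarrow> w' s < 0" by blast
  obtain t where t: "0 < t" "t \<le> z" "y t = 0"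
    using sol2_first_zero[OF y(1), of z] y z by auto
  have W0: "y 0 * w'' 0 - y' 0 * w' 0 = 0" by (simp add: y w'_0)
  show ?thesis
    by (rule sturm_after_zero(1)[OF y(1) w'_sol \<mu> Q_cont(2) _ W0 x(4,5,3) t(1) _ t(3)]) (use y t z in auto)
qed

lemma odd_eigenvalue_unique:
  assumes Z0: "Z < 0" and "odd_eigenvalue \<mu>" "odd_eigenvalue \<nu>" and neg: "\<mu> < 0" "\<nu> < 0"
  shows "\<mu> = \<nu>"
proof -
  from assms obtain y y' u u' where
    y: "sol2 L (\<lambda>s. Q s - \<mu>) y y'" "y 0 = 0" "y' 0 = 1" "y L = 0" and
    u: "sol2 L (\<lambda>s. Q s - \<nu>) u u'" "u 0 = 0" "u' 0 = 1" "u L = 0"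
    by (auto simp: odd_eigenvalue_def)
  show ?thesis
  proof (rule same_eigenvalue_if_positive[OF y(1) u(1)])
    show "y s > 0" "u s > 0" if "0 < s" "s < L" for s
      using odd_after_zero[OF Z0 y(1-3) neg(1) that] odd_after_zero[OF Z0 u(1-3) neg(2) that] y(4) u(4) by force+
  qed (simp_all add: y u)
qed

lemma odd_eigenvalue_exists:
  assumes Z0: "Z < 0"
  shows "\<exists>\<mu><0. odd_eigenvalue \<mu>"
proof -
  obtain c c' where c: "\<And>\<mu>. sol2 L (\<lambda>s. Q s - \<mu>) (c \<mu>) (c' \<mu>)" "\<And>\<mu>. c \<mu> 0 = 0" "\<And>\<mu>. c' \<mu> 0 = 1"
    using solution_family by blast
  note cont = family_continuous(1)[of c c', OF c]
  from low_energy c obtain M where M: "M > 0" "c (- M) L > 0" by (metis zero_less_one)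
  have v: "sol2 L Q (c 0) (c' 0)" using c(1)[of 0] by simp
  have "c 0 L = 1 / w'' 0 * w' L + 0 * w' L"
    using sol2_unique(1)[OF v sol2_lincomb[OF w'_sol w'_sol, of "1 / w'' 0" 0] Q_cont(2), of L]
      c w'_0 w''_0 L by simp
  moreover have "w' L < 0" unfolding Robin using Z0 w_pos[of L] L by (intro mult_neg_pos) auto
  ultimately have neg: "c 0 L < 0" using w''_0 by (simp add: divide_neg_pos)
  then obtain \<mu> where \<mu>: "- M \<le> \<mu>" "\<mu> \<le> 0" "c \<mu> L = 0"
    using IVT2'[of "\<lambda>\<mu>. c \<mu> L" 0 0 "- M"] M cont by auto
  have "\<mu> \<noteq> 0" using \<mu>(3) neg by auto
  then have "\<mu> < 0" using \<mu> by simp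
  moreover have "odd_eigenvalue \<mu>"
    unfolding odd_eigenvalue_def using c \<mu>(3) by blast
  ultimately show ?thesis by blast
qed

end

section \<open>Periodic extension\<close>

definition period_rep :: "real \<Rightarrow> real \<Rightarrow> real" where
  "period_rep L x = x - 2 * L * of_int \<lfloor>(x + L) / (2 * L)\<rfloor>"

text \<open>The \<open>2L\<close>-periodic function that is \<open>y(L - x)\<close> on \<open>[0, L]\<close> and is even (\<open>\<sigma> = 1\<close>) or odd
  (\<open>\<sigma> = -1\<close>).\<close>

definition reflect :: "real \<Rightarrow> real \<Rightarrow> (real \<Rightarrow> real) \<Rightarrow> real \<Rightarrow> complex" where
  "reflect L \<sigma> y x = of_real ((if 0 \<le> period_rep L x then 1 else \<sigma>) * y (L - \<bar>period_rep L x\<bar>))"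

lemma period_rep_range:
  assumes "0 < L"
  shows "- L \<le> period_rep L x" "period_rep L x < L"
proof -
  define n :: real where "n = of_int \<lfloor>(x + L) / (2 * L)\<rfloor>"
  have "n \<le> (x + L) / (2 * L)" "(x + L) / (2 * L) < n + 1" unfolding n_def by linarith+
  then have "n * (2 * L) \<le> x + L" "x + L < (n + 1) * (2 * L)" using assms by (simp_all add: field_simps)
  moreover have "period_rep L x = x - n * (2 * L)" by (simp add: period_rep_def n_def)
  ultimately show "- L \<le> period_rep L x" "period_rep L x < L" by (simp_all add: algebra_simps)
qed

lemma period_rep_eq:
  assumes "0 < L" "- L \<le> x - 2 * L * of_int n" "x - 2 * L * of_int n < L"
  shows "period_rep L x = x - 2 * L * of_int n"
proof -
  have "\<lfloor>(x + L) / (2 * L)\<rfloor> = n"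
    using assms by (intro floor_unique) (simp_all add: field_simps)
  then show ?thesis by (simp add: period_rep_def)
qed

lemma period_rep_add: "0 < L \<Longrightarrow> period_rep L (x + 2 * L) = period_rep L x"
proof -
  assume L: "0 < L"
  have "period_rep L (x + 2 * L) = x + 2 * L - 2 * L * of_int (\<lfloor>(x + L) / (2 * L)\<rfloor> + 1)"
    by (rule period_rep_eq[OF L]) (use period_rep_range[OF L, of x] in \<open>auto simp: period_rep_def algebra_simps\<close>)
  then show ?thesis by (simp add: period_rep_def algebra_simps)
qed

lemma periodic_int:
  fixes f :: "real \<Rightarrow> 'a"
  assumes f: "\<And>x. f (x + 2 * L) = f x"
  shows "f (x - 2 * L * of_int n) = f x"
proof -
  have nat: "f (x + 2 * L * real n) = f x" for n x
  proof (induction n)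
    case (Suc n)
    have "f (x + 2 * L * real (Suc n)) = f ((x + 2 * L * real n) + 2 * L)" by (simp add: algebra_simps)
    then show ?case using f Suc by simp
  qed simp
  show ?thesis
  proof (cases n)
    case (nonneg k)
    then show ?thesis using nat[of "x - 2 * L * of_int n" k] by simp
  next
    case (neg k)
    have "2 * L * of_int n = - (2 * L * real (Suc k))" unfolding neg by (simp add: algebra_simps)
    then show ?thesis using nat[of x "Suc k"] by (simp only: diff_minus_eq_add)
  qed
qed

lemma reflect_values:
  assumes L: "0 < L"
  shows "0 \<le> x \<Longrightarrow> x < L \<Longrightarrow> reflect L \<sigma> y x = of_real (y (L - x))"
    and "- L \<le> x \<Longrightarrow> x < 0 \<Longrightarrow> reflect L \<sigma> y x = of_real (\<sigma> * y (x + L))"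
    and "L \<le> x \<Longrightarrow> x < 2 * L \<Longrightarrow> reflect L \<sigma> y x = of_real (\<sigma> * y (x - L))"
  using period_rep_eq[OF L, of x 0] period_rep_eq[OF L, of x 1] L
  by (auto simp: reflect_def add.commute)

lemma reflect_periodic: "0 < L \<Longrightarrow> reflect L \<sigma> y (x + 2 * L) = reflect L \<sigma> y x"
  by (simp add: reflect_def period_rep_add)

lemma tendsto_Icc_ends:
  fixes f F :: "real \<Rightarrow> 'a::topological_space"
  assumes ab: "a < b" and F: "continuous_on {a..b} F" and eq: "\<And>x. a < x \<Longrightarrow> x < b \<Longrightarrow> f x = F x"
  shows "(f \<longlongrightarrow> F a) (at_right a)" "(f \<longlongrightarrow> F b) (at_left b)"
proof -
  have "(F \<longlongrightarrow> F a) (at_right a)" "(F \<longlongrightarrow> F b) (at_left b)"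
    using F ab unfolding continuous_on_def
    by (auto simp flip: at_within_Icc_at_right[OF ab] at_within_Icc_at_left[OF ab])
  moreover have "\<forall>\<^sub>F x in at_right a. F x = f x" "\<forall>\<^sub>F x in at_left b. F x = f x"
    using ab eq by (auto simp: eventually_at_right[OF ab] eventually_at_left[OF ab])
  ultimately show "(f \<longlongrightarrow> F a) (at_right a)" "(f \<longlongrightarrow> F b) (at_left b)"
    by (auto intro: Lim_transform_eventually)
qed

lemma reflect_continuous:
  assumes L: "0 < L" and y: "continuous_on {0..L} y" and bc: "y 0 = \<sigma> * y 0" "y L = \<sigma> * y L"
  shows "continuous_on UNIV (reflect L \<sigma> y)"
proof -
  let ?f = "reflect L \<sigma> y"
  have two: "?f (2 * L) = ?f 0" using reflect_periodic[OF L, of \<sigma> y 0] by simp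
  have 1: "continuous_on {0..L} ?f"
  proof (rule continuous_on_eq)
    show "continuous_on {0..L} (\<lambda>x. complex_of_real (y (L - x)))"
      by (intro continuous_intros continuous_on_compose2[OF y]) auto
    show "of_real (y (L - x)) = ?f x" if "x \<in> {0..L}" for x
      using that reflect_values(1)[OF L, of x \<sigma> y] reflect_values(3)[OF L, of x \<sigma> y] L bc by (cases "x = L") auto
  qed
  have 2: "continuous_on {L..2 * L} ?f"
  proof (rule continuous_on_eq)
    show "continuous_on {L..2 * L} (\<lambda>x. complex_of_real (\<sigma> * y (x - L)))"
      by (intro continuous_intros continuous_on_compose2[OF y]) auto
    show "of_real (\<sigma> * y (x - L)) = ?f x" if "x \<in> {L..2 * L}" for x
      using that reflect_values(1)[OF L, of 0 \<sigma> y] reflect_values(3)[OF L, of x \<sigma> y] L bc two by (cases "x = 2 * L") auto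
  qed
  have 3: "continuous_on {- L..0} ?f"
  proof (rule continuous_on_eq)
    show "continuous_on {- L..0} (\<lambda>x. complex_of_real (\<sigma> * y (x + L)))"
      by (intro continuous_intros continuous_on_compose2[OF y]) auto
    show "of_real (\<sigma> * y (x + L)) = ?f x" if "x \<in> {- L..0}" for x
      using that reflect_values(1)[OF L, of 0 \<sigma> y] reflect_values(2)[OF L, of x \<sigma> y] L bc by (cases "x = 0") auto
  qed
  have "continuous_on ({- L..0} \<union> ({0..L} \<union> {L..2 * L})) ?f"
    by (intro continuous_on_closed_Un 1 2 3) auto
  then have "continuous_on {- L<..<2 * L} ?f" by (rule continuous_on_subset) auto
  then have cont: "isCont ?f x" if "- L < x" "x < 2 * L" for x
    using that by (simp add: continuous_on_eq_continuous_at)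
  have "isCont ?f x" for x
  proof -
    define d where "d = 2 * L * of_int \<lfloor>x / (2 * L)\<rfloor>"
    have "of_int \<lfloor>x / (2 * L)\<rfloor> * (2 * L) \<le> x" "x < (of_int \<lfloor>x / (2 * L)\<rfloor> + 1) * (2 * L)"
      using L by (simp_all flip: pos_le_divide_eq pos_divide_less_eq)
    then have "0 \<le> x - d" "x - d < 2 * L" by (simp_all add: d_def algebra_simps)
    then have "isCont ?f (x - d)" using cont L by simp
    then have "isCont (\<lambda>x. ?f (x - d)) x"
      by (rule isCont_o2[where f = "\<lambda>x. x - d" and g = ?f, rotated]) simp
    moreover have "?f (z - d) = ?f z" for z
      unfolding d_def by (rule periodic_int[where f = ?f, OF reflect_periodic[OF L]])
    ultimately show ?thesis by simp
  qed
  then show ?thesis by (simp add: continuous_at_imp_continuous_on)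
qed

lemma reflect_in_domain:
  assumes L: "0 < L" and Z: "- y' L - \<sigma> * y' L = - Z * y L" and y: "sol2 L P y y'" and P: "continuous_on {0..L} P"
    and bc: "y 0 = \<sigma> * y 0" "y L = \<sigma> * y L" "- y' 0 = \<sigma> * y' 0"
    and q: "\<And>x. 0 < x \<Longrightarrow> x < 2 * L \<Longrightarrow> q x = P \<bar>L - x\<bar>"
  shows "reflect L \<sigma> y \<in> L1_domain L Z"
    and "\<exists>\<zeta>\<^sub>1\<in>L2_on {0<..<2 * L}. \<exists>\<zeta>\<^sub>2\<in>L2_on {0<..<2 * L}.
      weak_derivative {0<..<2 * L} (reflect L \<sigma> y) \<zeta>\<^sub>1 \<and> weak_derivative {0<..<2 * L} \<zeta>\<^sub>1 \<zeta>\<^sub>2 \<and>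
      (\<forall>x. 0 < x \<longrightarrow> x < 2 * L \<longrightarrow> \<zeta>\<^sub>2 x = of_real (q x) * reflect L \<sigma> y x)"
proof -
  let ?f = "reflect L \<sigma> y"
  define g where "g x = complex_of_real ((if 0 \<le> period_rep L x then - 1 else \<sigma>) * y' (L - \<bar>period_rep L x\<bar>))" for x
  define h where "h x = complex_of_real (P (L - \<bar>period_rep L x\<bar>)) * ?f x" for x
  have gv: "0 \<le> x \<Longrightarrow> x < L \<Longrightarrow> g x = of_real (- y' (L - x))"
    "- L \<le> x \<Longrightarrow> x < 0 \<Longrightarrow> g x = of_real (\<sigma> * y' (x + L))"
    "L \<le> x \<Longrightarrow> x < 2 * L \<Longrightarrow> g x = of_real (\<sigma> * y' (x - L))" for x
    using period_rep_eq[OF L, of x 0] period_rep_eq[OF L, of x 1] L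
    by (auto simp: g_def add.commute)
  have hv: "0 \<le> x \<Longrightarrow> x < L \<Longrightarrow> h x = of_real (P (L - x) * y (L - x))"
    "- L \<le> x \<Longrightarrow> x < 0 \<Longrightarrow> h x = of_real (\<sigma> * (P (x + L) * y (x + L)))"
    "L \<le> x \<Longrightarrow> x < 2 * L \<Longrightarrow> h x = of_real (\<sigma> * (P (x - L) * y (x - L)))" for x
    using period_rep_eq[OF L, of x 0] period_rep_eq[OF L, of x 1] L reflect_values[OF L, of x \<sigma> y]
    by (auto simp: h_def add.commute)
  have yc: "continuous_on {0..L} y" "continuous_on {0..L} y'" by (rule sol2_continuous[OF y])+
  have Pyc: "continuous_on {0..L} (\<lambda>s. P s * y s)" by (intro continuous_intros P yc)
  have c1: "continuous_on {0..L} (\<lambda>x. complex_of_real (u (L - x)))" if "continuous_on {0..L} u" for u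
    by (intro continuous_intros continuous_on_compose2[OF that]) auto
  have c1': "continuous_on {0..L} (\<lambda>x. complex_of_real (- u (L - x)))" if "continuous_on {0..L} u" for u
    by (rule c1[OF continuous_on_minus[OF that]])
  have c2: "continuous_on {L..2 * L} (\<lambda>x. complex_of_real (\<sigma> * u (x - L)))" if "continuous_on {0..L} u" for u
    by (intro continuous_intros continuous_on_compose2[OF that]) auto
  have c3: "continuous_on {- L..0} (\<lambda>x. complex_of_real (\<sigma> * u (x + L)))" if "continuous_on {0..L} u" for u
    by (intro continuous_intros continuous_on_compose2[OF that]) auto
  have d1: "((\<lambda>x. complex_of_real (y (L - x))) has_vector_derivative of_real (- y' (L - x))) (at x within {0..L})"
    "((\<lambda>x. complex_of_real (- y' (L - x))) has_vector_derivative of_real (P (L - x) * y (L - x))) (at x within {0..L})"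
    if "x \<in> {0..L}" for x
    using sol2_deriv[OF sol2_reverse[OF y] that]
    by (auto intro: has_vector_derivative_of_real simp only: has_real_derivative_iff_has_vector_derivative)
  have shift: "((\<lambda>x. complex_of_real (\<sigma> * u (x + p))) has_vector_derivative of_real (\<sigma> * u' (x + p))) (at x within {a..b})"
    if u: "\<And>s. s \<in> {0..L} \<Longrightarrow> (u has_real_derivative u' s) (at s within {0..L})"
      and p: "a + p = 0" "b + p = L" and x: "x \<in> {a..b}" for u u' p a b x
  proof -
    have img: "(\<lambda>x. x + p) ` {a..b} = {0..L}" using p by (simp add: image_add_atLeastAtMost')
    have "((\<lambda>x. u (x + p)) has_real_derivative u' (x + p) * 1) (at x within {a..b})"
      by (rule DERIV_image_chain[of u _ "\<lambda>x. x + p", unfolded o_def])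
        (use u[of "x + p"] x p in \<open>auto simp: img intro!: derivative_eq_intros\<close>)
    then have "((\<lambda>x. \<sigma> * u (x + p)) has_real_derivative \<sigma> * u' (x + p)) (at x within {a..b})"
      by (intro DERIV_cmult) simp
    then show ?thesis
      by (intro has_vector_derivative_of_real) (simp add: has_real_derivative_iff_has_vector_derivative)
  qed
  have d2: "((\<lambda>x. complex_of_real (\<sigma> * y (x - L))) has_vector_derivative of_real (\<sigma> * y' (x - L))) (at x within {L..2 * L})"
    "((\<lambda>x. complex_of_real (\<sigma> * y' (x - L))) has_vector_derivative of_real (\<sigma> * (P (x - L) * y (x - L)))) (at x within {L..2 * L})"
    if "x \<in> {L..2 * L}" for x
    using shift[OF sol2_deriv(1)[OF y], of L "- L" "2 * L" x] shift[OF sol2_deriv(2)[OF y], of L "- L" "2 * L" x] that by simp_all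
  have d3: "((\<lambda>x. complex_of_real (\<sigma> * y (x + L))) has_vector_derivative of_real (\<sigma> * y' (x + L))) (at x within {- L..0})"
    "((\<lambda>x. complex_of_real (\<sigma> * y' (x + L))) has_vector_derivative of_real (\<sigma> * (P (x + L) * y (x + L)))) (at x within {- L..0})"
    if "x \<in> {- L..0}" for x
    using shift[OF sol2_deriv(1)[OF y], of "- L" L 0 x] shift[OF sol2_deriv(2)[OF y], of "- L" L 0 x] that by simp_all
  have A: "piecewise_continuous (- L) 0 L U ?f (\<lambda>x. of_real (\<sigma> * y (x + L))) (\<lambda>x. of_real (y (L - x)))"
    "piecewise_continuous (- L) 0 L U g (\<lambda>x. of_real (\<sigma> * y' (x + L))) (\<lambda>x. of_real (- y' (L - x)))"
    "piecewise_continuous (- L) 0 L U h (\<lambda>x. of_real (\<sigma> * (P (x + L) * y (x + L)))) (\<lambda>x. of_real (P (L - x) * y (L - x)))"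
    if "U = {- L<..<L} \<or> U = {- L<..<L} - {0}" for U
    unfolding piecewise_continuous_def
    using L that c3[OF yc(1)] c1[OF yc(1)] c3[OF yc(2)] c1'[OF yc(2)] c3[OF Pyc] c1[OF Pyc]
      gv(1,2) hv(1,2) reflect_values(1,2)[OF L, of _ \<sigma> y] by auto
  have B: "piecewise_continuous 0 L (2 * L) {0<..<2 * L} ?f (\<lambda>x. of_real (y (L - x))) (\<lambda>x. of_real (\<sigma> * y (x - L)))"
    "piecewise_continuous 0 L (2 * L) {0<..<2 * L} g (\<lambda>x. of_real (- y' (L - x))) (\<lambda>x. of_real (\<sigma> * y' (x - L)))"
    "piecewise_continuous 0 L (2 * L) {0<..<2 * L} h (\<lambda>x. of_real (P (L - x) * y (L - x))) (\<lambda>x. of_real (\<sigma> * (P (x - L) * y (x - L))))"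
    unfolding piecewise_continuous_def
    using L c2[OF yc(1)] c1[OF yc(1)] c2[OF yc(2)] c1'[OF yc(2)] c2[OF Pyc] c1[OF Pyc]
      gv(1,3) hv(1,3) reflect_values(1,3)[OF L, of _ \<sigma> y] by auto
  have wA1: "weak_derivative U ?f g" if "U = {- L<..<L} \<or> U = {- L<..<L} - {0}" for U
    by (rule weak_derivative_piecewise[OF A(1,2)[OF that] d3(1) d1(1)]) (use bc(2) in auto)
  have wA2: "weak_derivative ({- L<..<L} - {0}) g h"
    by (rule weak_derivative_piecewise[OF A(2,3) d3(2) d1(2)]) auto
  have wB1: "weak_derivative {0<..<2 * L} ?f g"
    by (rule weak_derivative_piecewise[OF B(1,2) d1(1) d2(1)]) (use bc(1) in auto)
  have "complex_of_real (- y' 0) = of_real (\<sigma> * y' 0)" using bc(3) by simp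
  then have wB2: "weak_derivative {0<..<2 * L} g h"
    by (intro weak_derivative_piecewise[OF B(2,3) d1(2) d2(2)]) auto
  note L2 = piecewise_L2[OF A(1)] piecewise_L2[OF A(2)] piecewise_L2[OF A(3)]
    piecewise_L2[OF B(1)] piecewise_L2[OF B(2)] piecewise_L2[OF B(3)]
  have per: "?f \<in> H1_per L"
    using reflect_continuous[OF L yc(1) bc(1,2)] reflect_periodic[OF L] wA1[of "{- L<..<L}"] L2(1,2)[of "{- L<..<L}"]
    by (auto simp: H1_per_def H1_on_def)
  have "?f \<in> H2_on ({- L<..<L} - {0})"
    using wA1 wA2 L2(1,2,3)[of "{- L<..<L} - {0}"] by (auto simp: H2_on_def H1_on_def)
  moreover have "?f \<in> H2_on {0<..<2 * L}"
    using wB1 wB2 L2(4-6) by (auto simp: H2_on_def H1_on_def)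
  moreover have "((\<lambda>x. vector_derivative ?f (at x)) \<longlongrightarrow> of_real (- y' L)) (at_right 0)"
  proof -
    have "vector_derivative ?f (at x) = of_real (- y' (L - x))" if x: "0 < x" "x < L" for x
    proof (rule vector_derivative_at)
      have "((\<lambda>x. complex_of_real (y (L - x))) has_vector_derivative of_real (- y' (L - x))) (at x)"
        using d1(1)[of x] x at_within_Icc_at[of 0 x L] by simp
      then show "(?f has_vector_derivative of_real (- y' (L - x))) (at x)"
        by (rule has_vector_derivative_transform_within_open[of _ _ _ "{0<..<L}"])
          (use x reflect_values(1)[OF L, of _ \<sigma> y] in auto)
    qed
    from tendsto_Icc_ends(1)[OF L c1'[OF yc(2)] this] show ?thesis by simp
  qed
  moreover have "((\<lambda>x. vector_derivative ?f (at x)) \<longlongrightarrow> of_real (\<sigma> * y' L)) (at_left 0)"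
  proof -
    have "vector_derivative ?f (at x) = of_real (\<sigma> * y' (x + L))" if x: "- L < x" "x < 0" for x
    proof (rule vector_derivative_at)
      have "((\<lambda>x. complex_of_real (\<sigma> * y (x + L))) has_vector_derivative of_real (\<sigma> * y' (x + L))) (at x)"
        using d3(1)[of x] x at_within_Icc_at[of "- L" x 0] by simp
      then show "(?f has_vector_derivative of_real (\<sigma> * y' (x + L))) (at x)"
        by (rule has_vector_derivative_transform_within_open[of _ _ _ "{- L<..<0}"])
          (use x reflect_values(2)[OF L, of _ \<sigma> y] in auto)
    qed
    from tendsto_Icc_ends(2)[OF _ c3[OF yc(2)] this] L show ?thesis by simp
  qed
  moreover have "complex_of_real (- y' L) - of_real (\<sigma> * y' L) = - of_real Z * ?f 0"
    using Z reflect_values(1)[OF L, of 0 \<sigma> y] L by (simp flip: of_real_mult of_real_diff of_real_minus)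
  ultimately show "?f \<in> L1_domain L Z" using per unfolding L1_domain_def by blast
  have "h x = of_real (q x) * ?f x" if "0 < x" "x < 2 * L" for x
    using q[OF that] hv(1,3)[of x] reflect_values(1,3)[OF L, of x \<sigma> y] that
    by (cases "x < L") auto
  then show "\<exists>\<zeta>\<^sub>1\<in>L2_on {0<..<2 * L}. \<exists>\<zeta>\<^sub>2\<in>L2_on {0<..<2 * L}.
      weak_derivative {0<..<2 * L} ?f \<zeta>\<^sub>1 \<and> weak_derivative {0<..<2 * L} \<zeta>\<^sub>1 \<zeta>\<^sub>2 \<and>
      (\<forall>x. 0 < x \<longrightarrow> x < 2 * L \<longrightarrow> \<zeta>\<^sub>2 x = of_real (q x) * ?f x)"
    using wB1 wB2 L2(5,6) by blast
qed

lemma eigenfunction_split: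
  assumes L: "0 < L" and P: "continuous_on {0..L} P"
    and c: "sol2 L P c c'" "c 0 = 1" "c' 0 = 0" and S: "sol2 L P S S'" "S 0 = 0" "S' 0 = 1"
    and q: "\<And>x. 0 < x \<Longrightarrow> x < 2 * L \<Longrightarrow> q x = P \<bar>L - x\<bar>"
    and dom: "\<zeta> \<in> L1_domain L Z" and L2: "\<zeta>\<^sub>2 \<in> L2_on {0<..<2 * L}"
    and w1: "weak_derivative {0<..<2 * L} \<zeta> \<zeta>\<^sub>1" and w2: "weak_derivative {0<..<2 * L} \<zeta>\<^sub>1 \<zeta>\<^sub>2"
    and ae: "AE x in lebesgue_on {0<..<2 * L}. \<zeta>\<^sub>2 x = of_real (q x) * \<zeta> x"
  shows "\<exists>\<alpha> \<beta>. \<zeta> = (\<lambda>x. \<alpha> * reflect L 1 c x + \<beta> * reflect L (- 1) S x) \<and>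
    (\<alpha> = 0 \<or> c' L = Z / 2 * c L) \<and> (\<beta> = 0 \<or> S L = 0)"
proof -
  have cont: "continuous_on UNIV \<zeta>" and per: "\<And>x. \<zeta> (x + 2 * L) = \<zeta> x"
    using dom by (auto simp: L1_domain_def H1_per_def)
  obtain dp dm where dp: "((\<lambda>x. vector_derivative \<zeta> (at x)) \<longlongrightarrow> dp) (at_right 0)"
    and dm: "((\<lambda>x. vector_derivative \<zeta> (at x)) \<longlongrightarrow> dm) (at_left 0)" and jump: "dp - dm = - of_real Z * \<zeta> 0"
    using dom by (auto simp: L1_domain_def)
  have \<zeta>_cont: "continuous_on A \<zeta>" for A using cont continuous_on_subset by blast
  define h where "h x = of_real (P \<bar>L - x\<bar>) * \<zeta> x" for x
  have h_cont: "continuous_on {0..2 * L} h"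
    unfolding h_def by (intro continuous_intros \<zeta>_cont continuous_on_compose2[OF P]) auto
  have "AE x in lebesgue_on {0<..<2 * L}. \<zeta>\<^sub>2 x = h x"
    using ae AE_space[of "lebesgue_on {0<..<2 * L}"] by eventually_elim (auto simp: h_def q)
  from weak_second_derivative_regular[OF _ \<zeta>_cont h_cont w1 w2 _ this] L L2
  obtain \<zeta>' where d: "\<And>x. 0 < x \<Longrightarrow> x < 2 * L \<Longrightarrow> (\<zeta> has_vector_derivative \<zeta>' x) (at x)"
    "\<And>x. 0 < x \<Longrightarrow> x < 2 * L \<Longrightarrow> (\<zeta>' has_vector_derivative h x) (at x)"
    by (auto simp: L2_on_def)
  have real_part: "u (L + \<sigma> * s) = u L * c s + \<sigma> * u' L * S s \<and> \<sigma> * u' (L + \<sigma> * s) = u L * c' s + \<sigma> * u' L * S' s"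
    if u: "\<And>x. 0 < x \<Longrightarrow> x < 2 * L \<Longrightarrow> (u has_real_derivative u' x) (at x)"
      "\<And>x. 0 < x \<Longrightarrow> x < 2 * L \<Longrightarrow> (u' has_real_derivative P \<bar>L - x\<bar> * u x) (at x)"
      and \<sigma>: "\<sigma> = 1 \<or> \<sigma> = -1" and s: "0 \<le> s" "s < L" for u u' :: "real \<Rightarrow> real" and \<sigma> s
  proof -
    have sub: "sol2 s P (\<lambda>s. u (L + \<sigma> * s)) (\<lambda>s. \<sigma> * u' (L + \<sigma> * s))"
      unfolding sol2_def
    proof (intro ballI conjI)
      fix r assume r: "r \<in> {0..s}"
      have in_range: "0 < L + \<sigma> * r" "L + \<sigma> * r < 2 * L" and abs: "\<bar>L - (L + \<sigma> * r)\<bar> = r" and \<sigma>2: "\<sigma> * (X * \<sigma>) = X" for X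
        using r s \<sigma> by auto
      have inner: "((\<lambda>r. L + \<sigma> * r) has_real_derivative \<sigma>) (at r within {0..s})"
        by (auto intro!: derivative_eq_intros)
      show "((\<lambda>s. u (L + \<sigma> * s)) has_real_derivative \<sigma> * u' (L + \<sigma> * r)) (at r within {0..s})"
        using DERIV_chain2[OF u(1)[OF in_range] inner] by (simp add: mult.commute)
      show "((\<lambda>s. \<sigma> * u' (L + \<sigma> * s)) has_real_derivative P r * u (L + \<sigma> * r)) (at r within {0..s})"
        using DERIV_cmult[OF DERIV_chain2[OF u(2)[OF in_range] inner], of \<sigma>] unfolding abs \<sigma>2 .
    qed
    have "sol2 L P (\<lambda>s. u L * c s + \<sigma> * u' L * S s) (\<lambda>s. u L * c' s + \<sigma> * u' L * S' s)"
      by (rule sol2_lincomb[OF c(1) S(1)])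
    then have sub': "sol2 s P (\<lambda>s. u L * c s + \<sigma> * u' L * S s) (\<lambda>s. u L * c' s + \<sigma> * u' L * S' s)"
      by (rule sol2_subinterval) (use s in simp)
    have "continuous_on {0..s} P" by (rule continuous_on_subset[OF P]) (use s in auto)
    from sol2_unique[OF sub sub' this, of s] s show ?thesis by (simp add: c S)
  qed
  define \<alpha> \<beta> where "\<alpha> = \<zeta> L" and "\<beta> = - \<zeta>' L"
  have rep: "\<zeta> (L + of_real \<sigma> * s) = \<alpha> * of_real (c s) - of_real \<sigma> * \<beta> * of_real (S s) \<and>
     of_real \<sigma> * \<zeta>' (L + of_real \<sigma> * s) = \<alpha> * of_real (c' s) - of_real \<sigma> * \<beta> * of_real (S' s)"
    if \<sigma>: "\<sigma> = 1 \<or> \<sigma> = -1" and s: "0 \<le> s" "s < L" for \<sigma> s :: real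
  proof -
    have "((\<lambda>x. Re (\<zeta> x)) has_real_derivative Re (\<zeta>' x)) (at x)" "((\<lambda>x. Im (\<zeta> x)) has_real_derivative Im (\<zeta>' x)) (at x)"
      "((\<lambda>x. Re (\<zeta>' x)) has_real_derivative P \<bar>L - x\<bar> * Re (\<zeta> x)) (at x)"
      "((\<lambda>x. Im (\<zeta>' x)) has_real_derivative P \<bar>L - x\<bar> * Im (\<zeta> x)) (at x)" if "0 < x" "x < 2 * L" for x
      using bounded_linear.has_vector_derivative[OF bounded_linear_Re d(1)[OF that]]
        bounded_linear.has_vector_derivative[OF bounded_linear_Im d(1)[OF that]]
        bounded_linear.has_vector_derivative[OF bounded_linear_Re d(2)[OF that]]
        bounded_linear.has_vector_derivative[OF bounded_linear_Im d(2)[OF that]]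
      by (simp_all add: has_real_derivative_iff_has_vector_derivative h_def)
    from real_part[OF this(1,3) \<sigma> s] real_part[OF this(2,4) \<sigma> s]
    show ?thesis by (auto simp: complex_eq_iff \<alpha>_def \<beta>_def algebra_simps)
  qed
  have left1: "\<zeta> (L - s) = \<alpha> * of_real (c s) + \<beta> * of_real (S s)" if "0 \<le> s" "s < L" for s
    using rep[of "-1" s] that by simp
  have left2: "\<zeta>' (L - s) = - (\<alpha> * of_real (c' s) + \<beta> * of_real (S' s))" if "0 \<le> s" "s < L" for s
  proof -
    have "- \<zeta>' (L - s) = \<alpha> * of_real (c' s) + \<beta> * of_real (S' s)" using rep[of "-1" s] that by simp
    then show ?thesis by (metis minus_minus)
  qed
  note left = left1 left2
  have right: "\<zeta> (L + s) = \<alpha> * of_real (c s) - \<beta> * of_real (S s)"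
    "\<zeta>' (L + s) = \<alpha> * of_real (c' s) - \<beta> * of_real (S' s)" if "0 \<le> s" "s < L" for s
    using rep[of 1 s] that by auto
  have cc: "continuous_on {0..L} c" "continuous_on {0..L} c'" "continuous_on {0..L} S" "continuous_on {0..L} S'"
    using sol2_continuous[OF c(1)] sol2_continuous[OF S(1)] by auto
  have closed: "F L = G L" if "continuous_on {0..L} F" "continuous_on {0..L} G" "\<And>s. 0 \<le> s \<Longrightarrow> s < L \<Longrightarrow> F s = G s"
    for F G :: "real \<Rightarrow> complex"
    by (rule tendsto_unique[OF _ tendsto_Icc_ends(2)[OF L that(1)] tendsto_Icc_ends(2)[OF L that(2)]])
      (use that(3) in auto)
  have \<zeta>0: "\<zeta> 0 = \<alpha> * of_real (c L) + \<beta> * of_real (S L)"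
    using closed[of "\<lambda>s. \<zeta> (L - s)" "\<lambda>s. \<alpha> * of_real (c s) + \<beta> * of_real (S s)"] left(1)
    by (simp add: continuous_intros cc continuous_on_compose2[OF cont])
  have "\<zeta> (2 * L) = \<alpha> * of_real (c L) - \<beta> * of_real (S L)"
    using closed[of "\<lambda>s. \<zeta> (L + s)" "\<lambda>s. \<alpha> * of_real (c s) - \<beta> * of_real (S s)"] right(1)
    by (simp add: continuous_intros cc continuous_on_compose2[OF cont])
  with \<zeta>0 per[of 0] have \<beta>S: "\<beta> * of_real (S L) = 0" by (simp add: eq_neg_iff_add_eq_0 complex_eq_iff)
  have dp_eq: "dp = - (\<alpha> * of_real (c' L) + \<beta> * of_real (S' L))"
  proof (rule tendsto_unique[OF _ dp])
    have eq: "vector_derivative \<zeta> (at x) = - (\<alpha> * of_real (c' (L - x)) + \<beta> * of_real (S' (L - x)))"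
      if "0 < x" "x < L" for x
      using vector_derivative_at[OF d(1)[of x]] left(2)[of "L - x"] that by simp
    have "continuous_on {0..L} (\<lambda>x. - (\<alpha> * complex_of_real (c' (L - x)) + \<beta> * of_real (S' (L - x))))"
      by (intro continuous_intros continuous_on_compose2[OF cc(2)] continuous_on_compose2[OF cc(4)]) auto
    from tendsto_Icc_ends(1)[OF L this eq]
    show "((\<lambda>x. vector_derivative \<zeta> (at x)) \<longlongrightarrow> - (\<alpha> * of_real (c' L) + \<beta> * of_real (S' L))) (at_right 0)"
      by simp
  qed simp
  have dm_eq: "dm = \<alpha> * of_real (c' L) - \<beta> * of_real (S' L)"
  proof (rule tendsto_unique[OF _ dm])
    have eq: "vector_derivative \<zeta> (at x) = \<alpha> * of_real (c' (x + L)) - \<beta> * of_real (S' (x + L))" if x: "- L < x" "x < 0" for x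
    proof (rule vector_derivative_at)
      have "(\<zeta> has_vector_derivative \<zeta>' (x + 2 * L)) (at (x + 2 * L))"
        by (rule d(1)) (use x L in auto)
      moreover have "((\<lambda>x. x + 2 * L) has_vector_derivative 1) (at x)" by (auto intro!: derivative_eq_intros)
      ultimately have "((\<lambda>x. \<zeta> (x + 2 * L)) has_vector_derivative \<zeta>' (x + 2 * L)) (at x)"
        using vector_diff_chain_at[of "\<lambda>x. x + 2 * L" 1 x \<zeta> "\<zeta>' (x + 2 * L)"] by (simp add: o_def)
      moreover have "\<zeta>' (x + 2 * L) = \<alpha> * of_real (c' (x + L)) - \<beta> * of_real (S' (x + L))"
        using right(2)[of "x + L"] x by (simp add: algebra_simps)
      ultimately show "(\<zeta> has_vector_derivative \<alpha> * of_real (c' (x + L)) - \<beta> * of_real (S' (x + L))) (at x)"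
        by (simp add: per)
    qed
    have "continuous_on {- L..0} (\<lambda>x. \<alpha> * complex_of_real (c' (x + L)) - \<beta> * of_real (S' (x + L)))"
      by (intro continuous_intros continuous_on_compose2[OF cc(2)] continuous_on_compose2[OF cc(4)]) auto
    from tendsto_Icc_ends(2)[OF _ this eq] L
    show "((\<lambda>x. vector_derivative \<zeta> (at x)) \<longlongrightarrow> \<alpha> * of_real (c' L) - \<beta> * of_real (S' L)) (at_left 0)"
      by simp
  qed simp
  have "\<alpha> * of_real (c' L - Z / 2 * c L) = 0"
    using jump unfolding dp_eq dm_eq \<zeta>0 \<beta>S by (simp add: field_simps)
  then have \<alpha>: "\<alpha> = 0 \<or> c' L = Z / 2 * c L" by (simp flip: of_real_mult of_real_diff)
  have \<beta>: "\<beta> = 0 \<or> S L = 0" using \<beta>S by simp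
  have "\<zeta> x = \<alpha> * reflect L 1 c x + \<beta> * reflect L (- 1) S x" for x
  proof -
    define r where "r = period_rep L x"
    have r: "- L \<le> r" "r < L" using period_rep_range[OF L] by (auto simp: r_def)
    have rr: "reflect L \<sigma> y x = of_real ((if 0 \<le> r then 1 else \<sigma>) * y (L - \<bar>r\<bar>))" for \<sigma> y
      by (simp add: reflect_def r_def)
    have "\<zeta> x = \<zeta> r" unfolding r_def period_rep_def by (rule periodic_int[where f = \<zeta>, OF per, symmetric])
    also have "\<dots> = \<alpha> * reflect L 1 c x + \<beta> * reflect L (- 1) S x"
    proof (cases "0 \<le> r")
      case True
      show ?thesis
      proof (cases "r = 0")
        case True then show ?thesis using \<zeta>0 by (simp add: rr)
      next
        case False
        then show ?thesis using left(1)[of "L - r"] r \<open>0 \<le> r\<close> by (simp add: rr)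
      qed
    next
      case False
      have "\<zeta> r = \<zeta> (L + (L + r))" using per[of r] by (simp add: algebra_simps)
      then show ?thesis using right(1)[of "L + r"] r False by (simp add: rr)
    qed
    finally show ?thesis .
  qed
  with \<alpha> \<beta> show ?thesis by blast
qed

section \<open>Counting the negative eigenvalues\<close>

lemma peak_well_profile:
  assumes L: "L > 0" and Z: "Z \<noteq> 0" and \<omega>: "Z\<^sup>2 / 4 < \<omega>" and par: "peak_parameter L \<omega> Z \<eta>0"
  shows "peak_well L Z \<omega> (profile \<omega> \<eta>0) (profile' \<omega> \<eta>0)"
proof -
  note p = peak_parameterD[OF \<omega> Z par]
  have below: "\<eta>0\<^sup>2 < \<omega>" by (rule peak_theta_sq_less[OF \<omega> Z p(1)]) (use p in simp)
  note R = half_period_Robin[OF \<omega> Z p(1,2), unfolded p(3)]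
  show ?thesis
  proof (unfold_locales)
    show "sol2 L (\<lambda>s. \<omega> - (profile \<omega> \<eta>0 s)\<^sup>2) (profile \<omega> \<eta>0) (profile' \<omega> \<eta>0)"
      unfolding sol2_def using profile_deriv[OF p(1) below] profile'_deriv[OF p(1) below] by blast
    show "v' L \<le> Z / 2 * v L"
      if "sol2 L (\<lambda>s. \<omega> - 3 * (profile \<omega> \<eta>0 s)\<^sup>2) v v'" "v 0 = 1" "v' 0 = 0" for v v'
      by (rule profile_variation_Robin[OF \<omega> Z par that])
  qed (use L Z below R profile_pos[OF p(1) below] profile_0[OF p(1) below] profile'_0[OF p(1) below] in auto)
qed

context peak_well
begin

lemma eigenspace_eq:
  assumes q: "\<And>x. \<phi> x = w (L - \<bar>period_rep L x\<bar>)"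
    and c: "sol2 L (\<lambda>s. Q s - \<mu>) c c'" "c 0 = 1" "c' 0 = 0"
    and S: "sol2 L (\<lambda>s. Q s - \<mu>) S S'" "S 0 = 0" "S' 0 = 1"
  shows "\<zeta> \<in> L1_eigenspace L \<omega> Z \<phi> \<mu> \<Longrightarrow>
      \<exists>\<alpha> \<beta>. \<zeta> = (\<lambda>x. \<alpha> * reflect L 1 c x + \<beta> * reflect L (- 1) S x) \<and>
        (\<alpha> = 0 \<or> c' L = Z / 2 * c L) \<and> (\<beta> = 0 \<or> S L = 0)"
    and "c' L = Z / 2 * c L \<Longrightarrow> reflect L 1 c \<in> L1_eigenspace L \<omega> Z \<phi> \<mu>"
    and "S L = 0 \<Longrightarrow> reflect L (- 1) S \<in> L1_eigenspace L \<omega> Z \<phi> \<mu>"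
proof -
  define q where "q x = \<omega> - 3 * (\<phi> x)\<^sup>2 - \<mu>" for x
  have q_eq: "q x = Q \<bar>L - x\<bar> - \<mu>" if "0 < x" "x < 2 * L" for x
    using that period_rep_eq[OF L, of x 0] period_rep_eq[OF L, of x 1]
    by (cases "x < L") (auto simp: q_def assms(1) Q_def)
  have pot: "of_real \<mu> * z = - z2 + of_real \<omega> * z - 3 * of_real ((\<phi> x)\<^sup>2) * z \<longleftrightarrow> z2 = of_real (q x) * z"
    for x and z z2 :: complex
    unfolding q_def of_real_diff of_real_mult of_real_numeral by (auto simp: algebra_simps)
  note cont = Q_cont(1)[of \<mu>]
  show "\<exists>\<alpha> \<beta>. \<zeta> = (\<lambda>x. \<alpha> * reflect L 1 c x + \<beta> * reflect L (- 1) S x) \<and>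
        (\<alpha> = 0 \<or> c' L = Z / 2 * c L) \<and> (\<beta> = 0 \<or> S L = 0)"
    if mem: "\<zeta> \<in> L1_eigenspace L \<omega> Z \<phi> \<mu>"
  proof -
    from mem obtain \<zeta>\<^sub>1 \<zeta>\<^sub>2 where dom: "\<zeta> \<in> L1_domain L Z" and L2: "\<zeta>\<^sub>2 \<in> L2_on {0<..<2 * L}"
      and w: "weak_derivative {0<..<2 * L} \<zeta> \<zeta>\<^sub>1" "weak_derivative {0<..<2 * L} \<zeta>\<^sub>1 \<zeta>\<^sub>2"
      and ae: "AE x in lebesgue_on {0<..<2 * L}. \<zeta>\<^sub>2 x = of_real (q x) * \<zeta> x"
      unfolding L1_eigenspace_def L1_graph_def pot by blast
    show ?thesis by (rule eigenfunction_split[OF L cont c S q_eq dom L2 w ae])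
  qed
  have mem: "reflect L \<sigma> y \<in> L1_eigenspace L \<omega> Z \<phi> \<mu>"
    if y: "sol2 L (\<lambda>s. Q s - \<mu>) y y'" and bc: "- y' L - \<sigma> * y' L = - Z * y L" "y 0 = \<sigma> * y 0" "y L = \<sigma> * y L" "- y' 0 = \<sigma> * y' 0"
    for \<sigma> y y'
  proof -
    note dom = reflect_in_domain[OF L bc(1) y cont bc(2-4) q_eq]
    then obtain \<zeta>\<^sub>1 \<zeta>\<^sub>2 where z: "\<zeta>\<^sub>1 \<in> L2_on {0<..<2 * L}" "\<zeta>\<^sub>2 \<in> L2_on {0<..<2 * L}"
      "weak_derivative {0<..<2 * L} (reflect L \<sigma> y) \<zeta>\<^sub>1" "weak_derivative {0<..<2 * L} \<zeta>\<^sub>1 \<zeta>\<^sub>2"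
      "\<And>x. 0 < x \<Longrightarrow> x < 2 * L \<Longrightarrow> \<zeta>\<^sub>2 x = of_real (q x) * reflect L \<sigma> y x" by blast
    have "AE x in lebesgue_on {0<..<2 * L}. \<zeta>\<^sub>2 x = of_real (q x) * reflect L \<sigma> y x"
      by (rule AE_I2) (use z(5) in auto)
    with dom(1) z(1-4) show ?thesis unfolding L1_eigenspace_def L1_graph_def pot by blast
  qed
  show "reflect L 1 c \<in> L1_eigenspace L \<omega> Z \<phi> \<mu>" if "c' L = Z / 2 * c L"
    by (rule mem[OF c(1)]) (use c that in auto)
  show "reflect L (- 1) S \<in> L1_eigenspace L \<omega> Z \<phi> \<mu>" if "S L = 0"
    by (rule mem[OF S(1)]) (use S that in auto)
qed

lemma eigenspace_dim:
  assumes q: "\<And>x. \<phi> x = w (L - \<bar>period_rep L x\<bar>)"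
  shows "\<exists>B. finite B \<and> L1_eigenspace L \<omega> Z \<phi> \<mu> \<subseteq> cfun.span B"
    and "cfun.dim (L1_eigenspace L \<omega> Z \<phi> \<mu>) = of_bool (even_eigenvalue \<mu>) + of_bool (odd_eigenvalue \<mu>)"
    and "(\<exists>\<zeta>\<in>L1_eigenspace L \<omega> Z \<phi> \<mu>. \<zeta> \<noteq> (\<lambda>x. 0)) \<longleftrightarrow> even_eigenvalue \<mu> \<or> odd_eigenvalue \<mu>"
proof -
  obtain c c' where c: "sol2 L (\<lambda>s. Q s - \<mu>) c c'" "c 0 = 1" "c' 0 = 0"
    using sol2_exists[OF Q_cont(1) less_imp_le[OF L], of \<mu> 1 0] by blast
  obtain S S' where S: "sol2 L (\<lambda>s. Q s - \<mu>) S S'" "S 0 = 0" "S' 0 = 1"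
    using sol2_exists[OF Q_cont(1) less_imp_le[OF L], of \<mu> 0 1] by blast
  let ?E = "L1_eigenspace L \<omega> Z \<phi> \<mu>"
  let ?e = "reflect L 1 c" and ?o = "reflect L (- 1) S"
  note E = eigenspace_eq[OF q c S]
  have LL: "L \<in> {0..L}" using L by simp
  have even: "even_eigenvalue \<mu> \<longleftrightarrow> c' L = Z / 2 * c L"
    unfolding even_eigenvalue_def
  proof
    assume "\<exists>y y'. sol2 L (\<lambda>s. Q s - \<mu>) y y' \<and> y 0 = 1 \<and> y' 0 = 0 \<and> y' L = Z / 2 * y L"
    then obtain y y' where y: "sol2 L (\<lambda>s. Q s - \<mu>) y y'" "y 0 = 1" "y' 0 = 0" "y' L = Z / 2 * y L" by blast
    show "c' L = Z / 2 * c L"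
      using sol2_unique[OF c(1) y(1) Q_cont(1) _ _ LL] c y by simp
  qed (use c in blast)
  have odd: "odd_eigenvalue \<mu> \<longleftrightarrow> S L = 0"
    unfolding odd_eigenvalue_def
  proof
    assume "\<exists>y y'. sol2 L (\<lambda>s. Q s - \<mu>) y y' \<and> y 0 = 0 \<and> y' 0 = 1 \<and> y L = 0"
    then obtain y y' where y: "sol2 L (\<lambda>s. Q s - \<mu>) y y'" "y 0 = 0" "y' 0 = 1" "y L = 0" by blast
    show "S L = 0" using sol2_unique(1)[OF S(1) y(1) Q_cont(1) _ _ LL] S y by simp
  qed (use S in blast)
  have eL: "?e L = 1" "?o L = 0" using reflect_values(3)[OF L, of L] L c S by auto
  obtain d where d: "0 < d" "d \<le> L" "\<And>s. 0 < s \<Longrightarrow> s < d \<Longrightarrow> S s > 0"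
    using sol2_pos_near_0[OF S(1) L] S by auto
  have o_nz: "?o (L - d / 2) \<noteq> 0"
    using reflect_values(1)[OF L, of "L - d / 2" "- 1" S] d(1,2) d(3)[of "d / 2"] by simp
  have enz: "?e \<noteq> (\<lambda>x. 0)" and onz: "?o \<noteq> (\<lambda>x. 0)" using eL o_nz zero_neq_one by metis+
  have neq: "?e \<noteq> ?o" using eL by auto
  define B where "B = (if c' L = Z / 2 * c L then {?e} else {}) \<union> (if S L = 0 then {?o} else {})"
  have fin: "finite B" by (simp add: B_def)
  have BE: "B \<subseteq> ?E" using E(2,3) by (auto simp: B_def)
  have EB: "?E \<subseteq> cfun.span B"
  proof
    fix \<zeta> assume "\<zeta> \<in> ?E"
    from E(1)[OF this] obtain \<alpha> \<beta> where \<zeta>: "\<zeta> = (\<lambda>x. \<alpha> * ?e x + \<beta> * ?o x)"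
      and \<alpha>: "\<alpha> = 0 \<or> c' L = Z / 2 * c L" and \<beta>: "\<beta> = 0 \<or> S L = 0" by blast
    have "(\<lambda>x. \<alpha> * ?e x) \<in> cfun.span B"
    proof (cases "\<alpha> = 0")
      case True then show ?thesis using cfun.span_zero[of B] by (simp add: zero_fun_def)
    next
      case False
      then have "?e \<in> B" using \<alpha> by (simp add: B_def)
      then show ?thesis by (intro cfun.span_scale cfun.span_base)
    qed
    moreover have "(\<lambda>x. \<beta> * ?o x) \<in> cfun.span B"
    proof (cases "\<beta> = 0")
      case True then show ?thesis using cfun.span_zero[of B] by (simp add: zero_fun_def)
    next
      case False
      then have "?o \<in> B" using \<beta> by (simp add: B_def)
      then show ?thesis by (intro cfun.span_scale cfun.span_base)
    qed
    ultimately have "(\<lambda>x. \<alpha> * ?e x) + (\<lambda>x. \<beta> * ?o x) \<in> cfun.span B" by (rule cfun.span_add)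
    then show "\<zeta> \<in> cfun.span B" by (simp add: \<zeta> plus_fun_def)
  qed
  have "cfun.independent {?e, ?o}"
  proof (rule cfun.independent_insertI)
    show "?e \<notin> cfun.span {?o}"
    proof
      assume "?e \<in> cfun.span {?o}"
      then obtain k where "?e = (\<lambda>x. k * ?o x)" by (auto simp: cfun.span_singleton)
      then have "?e L = k * ?o L" by metis
      then show False using eL by simp
    qed
    show "cfun.independent {?o}" using onz by (simp add: cfun.dependent_single zero_fun_def)
  qed
  then have ind: "cfun.independent B" by (rule cfun.independent_mono) (auto simp: B_def)
  have "card B = of_bool (c' L = Z / 2 * c L) + of_bool (S L = 0)" using neq by (auto simp: B_def)
  with cfun.dim_unique[OF BE EB ind]
  show "cfun.dim ?E = of_bool (even_eigenvalue \<mu>) + of_bool (odd_eigenvalue \<mu>)"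
    by (simp only: even odd)
  show "\<exists>B. finite B \<and> ?E \<subseteq> cfun.span B" using fin EB by blast
  show "(\<exists>\<zeta>\<in>?E. \<zeta> \<noteq> (\<lambda>x. 0)) \<longleftrightarrow> even_eigenvalue \<mu> \<or> odd_eigenvalue \<mu>"
  proof
    assume "\<exists>\<zeta>\<in>?E. \<zeta> \<noteq> (\<lambda>x. 0)"
    then obtain \<zeta> where \<zeta>: "\<zeta> \<in> ?E" "\<zeta> \<noteq> (\<lambda>x. 0)" by blast
    from E(1)[OF \<zeta>(1)] obtain \<alpha> \<beta> where *: "\<zeta> = (\<lambda>x. \<alpha> * ?e x + \<beta> * ?o x)"
      and \<alpha>\<beta>: "\<alpha> = 0 \<or> c' L = Z / 2 * c L" "\<beta> = 0 \<or> S L = 0" by blast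
    have "\<alpha> \<noteq> 0 \<or> \<beta> \<noteq> 0" using * \<zeta>(2) by auto
    then show "even_eigenvalue \<mu> \<or> odd_eigenvalue \<mu>" using \<alpha>\<beta> even odd by blast
  next
    assume "even_eigenvalue \<mu> \<or> odd_eigenvalue \<mu>"
    then show "\<exists>\<zeta>\<in>?E. \<zeta> \<noteq> (\<lambda>x. 0)" using E(2,3) even odd enz onz by blast
  qed
qed

lemma n_L1_eq:
  assumes q: "\<And>x. \<phi> x = w (L - \<bar>period_rep L x\<bar>)"
  shows "Z > 0 \<Longrightarrow> n_L1 L \<omega> Z \<phi> = 1" and "Z < 0 \<Longrightarrow> n_L1 L \<omega> Z \<phi> = 2"
proof -
  note E = eigenspace_dim[OF q]
  let ?N = "L1_negative_eigenvalues L \<omega> Z \<phi>"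
  have N: "?N = {\<mu>. \<mu> < 0 \<and> (even_eigenvalue \<mu> \<or> odd_eigenvalue \<mu>)}"
    unfolding L1_negative_eigenvalues_def E(3) ..
  have n: "n_L1 L \<omega> Z \<phi> = enat (\<Sum>\<mu>\<in>?N. of_bool (even_eigenvalue \<mu>) + of_bool (odd_eigenvalue \<mu>))"
    if "finite ?N" using that E(1) by (simp add: n_L1_def E(2))
  obtain \<mu> where \<mu>: "\<mu> < 0" "even_eigenvalue \<mu>" using even_eigenvalue_exists by blast
  have ev: "even_eigenvalue \<nu> \<longleftrightarrow> \<nu> = \<mu>" if "\<nu> < 0" for \<nu>
    using even_eigenvalue_unique[OF \<mu>(2) _ \<mu>(1) that] \<mu> by blast
  show "n_L1 L \<omega> Z \<phi> = 1" if "Z > 0"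
  proof -
    have "?N = {\<mu>}" unfolding N using ev no_odd_eigenvalue[OF that] \<mu> by blast
    then show ?thesis using n no_odd_eigenvalue[OF that \<mu>(1)] \<mu>(2) by (simp add: one_enat_def)
  qed
  show "n_L1 L \<omega> Z \<phi> = 2" if Z0: "Z < 0"
  proof -
    obtain \<nu> where \<nu>: "\<nu> < 0" "odd_eigenvalue \<nu>" using odd_eigenvalue_exists[OF Z0] by blast
    have od: "odd_eigenvalue \<kappa> \<longleftrightarrow> \<kappa> = \<nu>" if "\<kappa> < 0" for \<kappa>
      using odd_eigenvalue_unique[OF Z0 \<nu>(2) _ \<nu>(1) that] \<nu> by blast
    have "?N = {\<mu>, \<nu>}" unfolding N using ev od \<mu> \<nu> by blast
    then have "n_L1 L \<omega> Z \<phi> = enat 2"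
      using n ev[OF \<mu>(1)] ev[OF \<nu>(1)] od[OF \<mu>(1)] od[OF \<nu>(1)] by (cases "\<mu> = \<nu>") auto
    then show ?thesis by (simp add: numeral_eq_enat)
  qed
qed

end

theorem lemma6p9:
  fixes L \<omega> Z \<eta>\<^sub>2 :: real
  assumes "L > 0" and "Z \<noteq> 0"
    and "\<omega> > pi\<^sup>2 / (2 * L\<^sup>2)" and "\<omega> > Z\<^sup>2 / 4"
    and "peak_parameter L \<omega> Z \<eta>\<^sub>2"
  shows "(Z > 0 \<longrightarrow> n_L1 L \<omega> Z (dnoidal_peak L \<omega> Z \<eta>\<^sub>2) = 1) \<and>
         (Z < 0 \<longrightarrow> n_L1 L \<omega> Z (dnoidal_peak L \<omega> Z \<eta>\<^sub>2) = 2)"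
proof -
  interpret peak_well L Z \<omega> "profile \<omega> \<eta>\<^sub>2" "profile' \<omega> \<eta>\<^sub>2"
    by (rule peak_well_profile[OF assms(1,2,4,5)])
  show ?thesis
    using n_L1_eq[of "dnoidal_peak L \<omega> Z \<eta>\<^sub>2"] dnoidal_peak_eq_profile[OF assms(4,2,5)]
    by (simp add: period_rep_def)
qed

end
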